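(* Fix $\alpha>0$, $M_0>0$, $M>0$, $\rho>0$ and $\gamma>0$. Suppose $p\le \exp(\gamma n)$. Then the minimax risk, under the operator norm, of estimating the covariance matrix $\Sigma=\Sigma_{p\times p}$ from an i.i.d. sample $\mathbf X_1,\dots,\mathbf X_n$ whose common distribution lies in $\mathcal P_\alpha=\mathcal P_\alpha(M_0,M,\rho)$ satisfies $$\inf_{\hat\Sigma}\ \sup_{\mathcal P_\alpha}\ \mathbb E\|\hat\Sigma-\Sigma\|^2\ \asymp\ \min\left\{ n^{-\frac{2\alpha}{2\alpha+1}}+\frac{\log p}{n},\ \frac pn\right\},$$ where the infimum is over all estimators $\hat\Sigma=\hat\Sigma(\mathbf X_1,\dots,\mathbf X_n)$ of $\Sigma$.
   Context: $\mathbf X_1,\dots,\mathbf X_n$ are i.i.d. random vectors in $\mathbb R^p$ with covariance matrix $\Sigma=(\sigma_{ij})_{1\le i,j\le p}$ (the mean is unknown). For a matrix $A$, $\|A\|=\sup_{\|x\|_2=1}\|Ax\|_2$ is the operator norm. $\mathcal F_\alpha(M_0,M)$ is the set of $p\times p$ covariance matrices $\Sigma$ such that $\max_j\sum_{i:\,|i-j|>k}|\sigma_{ij}|\le Mk^{-\alpha}$ for all $k$ (positive integers), and $\lambda_{\max}(\Sigma)\le M_0$, where $\lambda_{\max}$ is the largest eigenvalue. $\mathcal P_\alpha(M_0,M,\rho)$ is the set of distributions of $\mathbf X_1$ on $\mathbb R^p$ whose covariance matrix lies in $\mathcal F_\alpha(M_0,M)$ and which are sub-Gaussian in the sense that $\mathbb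 P\{|\mathbf v^T(\mathbf X_1-\mathbb E\mathbf X_1)|>t\}\le e^{-t^2\rho/2}$ for all $t>0$ and all $\|\mathbf v\|_2=1$. $a\asymp b$ means that there are constants $0<c\le C$, independent of $n$ and $p$ (they may depend on $\alpha,M_0,M,\rho,\gamma$), with $c\le a/b\le C$. *)

theory Defs
  imports "HOL-Probability.Probability" "Jordan_Normal_Form.Spectral_Radius"
begin

text \<open>
  The dimension \<open>p\<close> varies inside the statement, so a point of \<open>\<real>\<^sup>p\<close> on which measures live is an
  extensional function on \<open>{..<p}\<close>, while linear algebra uses the dimension-carrying matrices and
  vectors of Jordan_Normal_Form. Indices run from \<open>0\<close> to \<open>p - 1\<close>.
\<close>

definition euclid_space :: "nat \<Rightarrow> (nat \<Rightarrow> real) measure" where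
  "euclid_space p = PiM {..<p} (\<lambda>_. borel)"

text \<open>For a sample \<open>X\<close>, \<open>X k i\<close> is the \<open>i\<close>-th coordinate of the \<open>k\<close>-th observation.\<close>

definition sample_space :: "nat \<Rightarrow> nat \<Rightarrow> (nat \<Rightarrow> nat \<Rightarrow> real) measure" where
  "sample_space n p = PiM {..<n} (\<lambda>_. euclid_space p)"

definition l2_norm :: "real Matrix.vec \<Rightarrow> real" where
  "l2_norm x = sqrt (scalar_prod x x)"

definition op_norm :: "real mat \<Rightarrow> real" where
  "op_norm A = (SUP x \<in> {x \<in> carrier_vec (dim_col A). l2_norm x = 1}. l2_norm (A *\<^sub>v x))"

definition lambda_max :: "real mat \<Rightarrow> real" where
  "lambda_max A = Max (spectrum A)"

definition square_integrable_dist :: "nat \<Rightarrow> (nat \<Rightarrow> real) measure \<Rightarrow> bool" where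
  "square_integrable_dist p P \<longleftrightarrow> prob_space P \<and> sets P = sets (euclid_space p) \<and>
     (\<forall>i<p. integrable P (\<lambda>x. (x i)\<^sup>2))"

definition mean_vec :: "nat \<Rightarrow> (nat \<Rightarrow> real) measure \<Rightarrow> real Matrix.vec" where
  "mean_vec p P = Matrix.vec p (\<lambda>i. \<integral>x. x i \<partial>P)"

definition cov_mat :: "nat \<Rightarrow> (nat \<Rightarrow> real) measure \<Rightarrow> real mat" where
  "cov_mat p P = mat p p (\<lambda>(i, j). \<integral>x. (x i - (\<integral>y. y i \<partial>P)) * (x j - (\<integral>y. y j \<partial>P)) \<partial>P)"

definition covariance_matrices :: "nat \<Rightarrow> real mat set" where
  "covariance_matrices p = {cov_mat p P | P. square_integrable_dist p P}"

definition F_class :: "nat \<Rightarrow> real \<Rightarrow> real \<Rightarrow> real \<Rightarrow> real mat set" where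
  "F_class p \<alpha> M0 M = {S \<in> covariance_matrices p.
     (\<forall>k::nat. k \<ge> 1 \<longrightarrow>
        (MAX j\<in>{..<p}. \<Sum>i | i < p \<and> \<bar>int i - int j\<bar> > int k. \<bar>S $$ (i, j)\<bar>)
          \<le> M * real k powr (- \<alpha>)) \<and>
     lambda_max S \<le> M0}"

definition sub_gaussian :: "nat \<Rightarrow> real \<Rightarrow> (nat \<Rightarrow> real) measure \<Rightarrow> bool" where
  "sub_gaussian p \<rho> P \<longleftrightarrow> (\<forall>t>0. \<forall>v\<in>carrier_vec p. l2_norm v = 1 \<longrightarrow>
     measure P {x \<in> space P. \<bar>scalar_prod v (Matrix.vec p x - mean_vec p P)\<bar> > t}
       \<le> exp (- (t\<^sup>2 * \<rho> / 2)))"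

definition P_class :: "nat \<Rightarrow> real \<Rightarrow> real \<Rightarrow> real \<Rightarrow> real \<Rightarrow> (nat \<Rightarrow> real) measure set" where
  "P_class p \<alpha> M0 M \<rho> = {P. square_integrable_dist p P \<and>
     cov_mat p P \<in> F_class p \<alpha> M0 M \<and> sub_gaussian p \<rho> P}"

text \<open>
  An estimator is any Borel function (entrywise) of the sample with values in the real
  \<open>p \<times> p\<close> matrices; it need not be symmetric or positive semidefinite.
\<close>

definition estimators :: "nat \<Rightarrow> nat \<Rightarrow> ((nat \<Rightarrow> nat \<Rightarrow> real) \<Rightarrow> real mat) set" where
  "estimators n p = {S. (\<forall>X\<in>space (sample_space n p). S X \<in> carrier_mat p p) \<and>
     (\<forall>i<p. \<forall>j<p. (\<lambda>X. S X $$ (i, j)) \<in> borel_measurable (sample_space n p))}"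

text \<open>
  The law of an i.i.d. sample from \<open>P\<close> is the \<open>n\<close>-fold product of \<open>P\<close>. The risk is computed in
  \<open>ennreal\<close>, so that an estimator with non-integrable loss has risk \<open>\<infinity>\<close> rather than \<open>0\<close>.
\<close>

definition risk :: "nat \<Rightarrow> nat \<Rightarrow> ((nat \<Rightarrow> nat \<Rightarrow> real) \<Rightarrow> real mat) \<Rightarrow> (nat \<Rightarrow> real) measure \<Rightarrow> ennreal" where
  "risk n p S P = (\<integral>\<^sup>+X. ennreal ((op_norm (S X - cov_mat p P))\<^sup>2) \<partial>(PiM {..<n} (\<lambda>_. P)))"

definition minimax_risk :: "nat \<Rightarrow> nat \<Rightarrow> real \<Rightarrow> real \<Rightarrow> real \<Rightarrow> real \<Rightarrow> ennreal" where
  "minimax_risk n p \<alpha> M0 M \<rho> =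
     (INF S\<in>estimators n p. SUP P\<in>P_class p \<alpha> M0 M \<rho>. risk n p S P)"

definition minimax_rate :: "nat \<Rightarrow> nat \<Rightarrow> real \<Rightarrow> real" where
  "minimax_rate n p \<alpha> =
     min (real n powr (- (2 * \<alpha> / (2 * \<alpha> + 1))) + ln (real p) / real n) (real p / real n)"

end

theory Submission
  imports Defs
begin

text \<open>
  Upper bound. Differences of consecutive observations have mean zero and twice the covariance, so
  their empirical covariance is unbiased. Cut the indices into blocks of length
  \<open>k \<approx> n powr (1 / (2\<alpha>+1))\<close> and keep only entries in equal or neighbouring blocks. The discarded
  entries lie further than \<open>k\<close> from the diagonal, which bounds the bias by \<open>M * k powr (-\<alpha>)\<close>. The
  quadratic form of the retained error splits into forms living on windows of length \<open>2k\<close>; on each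
  window a net of \<open>exp (O k)\<close> rounded vectors suffices, and a Chernoff bound with a union over the
  \<open>p * exp (O k)\<close> net vectors gives variance \<open>(k + ln p) / n\<close>.

  Lower bound. All laws used are finitely supported and lazy: with probability \<open>3/4\<close> the observation
  is the mean. For \<open>ln p / n\<close>, one of \<open>p\<close> independent coordinates gets a variance perturbed by
  \<open>sqrt (ln p / n)\<close>; the uniform mixture of the product laws has bounded second moment relative to the
  unperturbed one (Le Cam). For \<open>k / n\<close>, the signs \<open>a\<^sub>1, \<dots>, a\<^sub>k\<close> are independent given signs
  \<open>b\<^sub>1, \<dots>, b\<^sub>k\<close> with conditional means \<open>\<theta>\<^sub>i * s * hub b\<close>, where \<open>s\<^sup>2 \<approx> 1/n\<close> and \<open>hub\<close> has
  correlation \<open>1 / sqrt k\<close> with each \<open>b\<^sub>j\<close>. Applying the covariance matrix to the unit vector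
  proportional to the indicator of the \<open>b\<close> block returns \<open>s * \<theta>\<close> up to a constant, while flipping one
  \<open>\<theta>\<^sub>i\<close> keeps the \<open>n\<close>-fold Hellinger affinity above \<open>3/4\<close>, so \<open>\<theta>\<close> cannot be estimated (Assouad).
\<close>

section \<open>Quadratic forms and the operator norm\<close>

no_notation Finite_Cartesian_Product.vec_nth (infixl "$" 90)

text \<open>The bandwidth is forced from both sides. Keeping entries up to distance about
  \<open>k\<close> costs variance \<open>k / n\<close> and squared bias
  \<open>k powr (-2 * \<alpha>)\<close>, which agree at
  \<open>k = n powr (1 / (2 * \<alpha> + 1))\<close>. In the lower bound the same \<open>k\<close>
  is the largest order for which the perturbed rows, with absolute sums of order
  \<open>sqrt (k / n)\<close>, still obey the decay \<open>k powr (-\<alpha>)\<close> of the class.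
  When \<open>p\<close> is below this \<open>k\<close>, one block holds every index, there is no
  bias, and the rate turns into \<open>p / n\<close>. Pairing disjoint observations removes the
  unknown mean exactly and keeps the summands independent. The loss is the operator norm of an
  arbitrary entrywise measurable matrix. The upper bound majorises it pointwise by finite maxima of
  measurable forms, and the lower bounds sum it over finitely many sample points, so integrals are
  compared by monotonicity only. Since \<open>lambda_max\<close> is a maximum over a set, bounding
  it requires an actual eigenvalue; every law of the lower bounds therefore has a coordinate that is
  uncorrelated with all others.\<close>

definition bil :: "nat \<Rightarrow> (nat \<Rightarrow> nat \<Rightarrow> real) \<Rightarrow> (nat \<Rightarrow> real) \<Rightarrow> (nat \<Rightarrow> real) \<Rightarrow> real" where
  "bil p A x y = (\<Sum>i<p. \<Sum>j<p. x i * A i j * y j)"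

definition sqn :: "nat \<Rightarrow> (nat \<Rightarrow> real) \<Rightarrow> real" where
  "sqn p x = (\<Sum>i<p. (x i)\<^sup>2)"

lemma sqn_nonneg [simp]: "0 \<le> sqn p x"
  unfolding sqn_def by (simp add: sum_nonneg)

lemma bil_add_left: "bil p A (\<lambda>i. x i + y i) z = bil p A x z + bil p A y z"
  unfolding bil_def by (simp add: algebra_simps sum.distrib)

lemma bil_add_right: "bil p A z (\<lambda>i. x i + y i) = bil p A z x + bil p A z y"
  unfolding bil_def by (simp add: algebra_simps sum.distrib)

lemma bil_diff_left: "bil p A (\<lambda>i. x i - y i) z = bil p A x z - bil p A y z"
  unfolding bil_def by (simp add: algebra_simps sum_subtractf)

lemma bil_diff_right: "bil p A z (\<lambda>i. x i - y i) = bil p A z x - bil p A z y"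
  unfolding bil_def by (simp add: algebra_simps sum_subtractf)

lemma bil_scale_left: "bil p A (\<lambda>i. c * x i) z = c * bil p A x z"
  unfolding bil_def by (simp add: algebra_simps sum_distrib_left)

lemma bil_scale_right: "bil p A z (\<lambda>i. c * x i) = c * bil p A z x"
  unfolding bil_def by (simp add: algebra_simps sum_distrib_left)

lemma sqn_scale: "sqn p (\<lambda>i. c * x i) = c\<^sup>2 * sqn p x"
  unfolding sqn_def by (simp add: power_mult_distrib sum_distrib_left)

lemma sqn_parallelogram:
  "sqn p (\<lambda>i. x i + y i) + sqn p (\<lambda>i. x i - y i) = 2 * sqn p x + 2 * sqn p y"
  unfolding sqn_def
  by (simp add: power2_sum power2_diff sum.distrib sum_subtractf sum_distrib_left)

lemma bil_commute:
  assumes "\<And>i j. i < p \<Longrightarrow> j < p \<Longrightarrow> A i j = A j i"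
  shows "bil p A x y = bil p A y x"
proof -
  have "bil p A x y = (\<Sum>j<p. \<Sum>i<p. x i * A i j * y j)"
    unfolding bil_def by (rule sum.swap)
  also have "\<dots> = bil p A y x"
    unfolding bil_def by (intro sum.cong refl) (use assms in \<open>auto simp: mult_ac\<close>)
  finally show ?thesis .
qed

text \<open>Polarization with the parallelogram law: \<open>x + y\<close> and \<open>x - y\<close>
  keep the support \<open>J\<close>, so a bound on the quadratic form over vectors supported in
  \<open>J\<close> passes to the bilinear form. The right side has the sum of the squared norms, not
  a product of norms; \<open>op_norm_sym_le\<close> and \<open>net_bound\<close> rescale their
  vectors to balance it.\<close>

lemma bil_polarization:
  assumes sym: "\<And>i j. i < p \<Longrightarrow> j < p \<Longrightarrow> A i j = A j i"
    and q: "\<And>x. (\<And>i. i \<notin> J \<Longrightarrow> x i = 0) \<Longrightarrow> \<bar>bil p A x x\<bar> \<le> q * sqn p x"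
    and x: "\<And>i. i \<notin> J \<Longrightarrow> x i = 0" and y: "\<And>i. i \<notin> J \<Longrightarrow> y i = 0"
  shows "\<bar>bil p A x y\<bar> \<le> q * (sqn p x + sqn p y) / 2"
proof -
  let ?u = "\<lambda>i. x i + y i" and ?v = "\<lambda>i. x i - y i"
  have "4 * bil p A x y = bil p A ?u ?u - bil p A ?v ?v"
    by (simp add: bil_add_left bil_add_right bil_diff_left bil_diff_right
        bil_commute[of p A y x, OF sym])
  moreover have "\<bar>bil p A ?u ?u\<bar> \<le> q * sqn p ?u" "\<bar>bil p A ?v ?v\<bar> \<le> q * sqn p ?v"
    using x y by (intro q; simp)+
  ultimately have "\<bar>4 * bil p A x y\<bar> \<le> q * (sqn p ?u + sqn p ?v)"
    by (simp add: algebra_simps)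
  also have "\<dots> = q * (2 * sqn p x + 2 * sqn p y)"
    by (simp only: sqn_parallelogram)
  finally show ?thesis by (simp add: algebra_simps)
qed

text \<open>Schur test: \<open>2 * a * b \<le> a\<^sup>2 + b\<^sup>2\<close> turns each entry into
  weights on two squares, and by symmetry both double sums are governed by the same sums. It bounds
  the bias, i.e. the covariance entries that the estimator discards.\<close>

lemma bil_row_sum_le:
  assumes sym: "\<And>i j. i < p \<Longrightarrow> j < p \<Longrightarrow> A i j = A j i"
    and r: "\<And>j. j < p \<Longrightarrow> (\<Sum>i<p. \<bar>A i j\<bar>) \<le> r"
  shows "\<bar>bil p A x x\<bar> \<le> r * sqn p x"
proof -
  have "\<bar>bil p A x x\<bar> \<le> (\<Sum>i<p. \<Sum>j<p. \<bar>x i * A i j * x j\<bar>)"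
    unfolding bil_def by (intro order_trans[OF sum_abs] sum_mono sum_abs)
  also have "\<dots> \<le> (\<Sum>i<p. \<Sum>j<p. \<bar>A i j\<bar> * (x i)\<^sup>2 / 2 + \<bar>A i j\<bar> * (x j)\<^sup>2 / 2)"
  proof (intro sum_mono)
    fix i j
    have "2 * (\<bar>x i\<bar> * \<bar>x j\<bar>) \<le> (x i)\<^sup>2 + (x j)\<^sup>2"
      using sum_squares_bound[of "\<bar>x i\<bar>" "\<bar>x j\<bar>"] by simp
    then have "\<bar>A i j\<bar> * (2 * (\<bar>x i\<bar> * \<bar>x j\<bar>)) \<le> \<bar>A i j\<bar> * ((x i)\<^sup>2 + (x j)\<^sup>2)"
      by (intro mult_left_mono) auto
    then show "\<bar>x i * A i j * x j\<bar> \<le> \<bar>A i j\<bar> * (x i)\<^sup>2 / 2 + \<bar>A i j\<bar> * (x j)\<^sup>2 / 2"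
      by (simp add: abs_mult algebra_simps)
  qed
  also have "\<dots> = (\<Sum>i<p. (x i)\<^sup>2 * (\<Sum>j<p. \<bar>A i j\<bar>) / 2)
      + (\<Sum>j<p. (x j)\<^sup>2 * (\<Sum>i<p. \<bar>A i j\<bar>) / 2)"
  proof -
    have "(\<Sum>i<p. \<Sum>j<p. \<bar>A i j\<bar> * (x j)\<^sup>2 / 2) = (\<Sum>j<p. \<Sum>i<p. \<bar>A i j\<bar> * (x j)\<^sup>2 / 2)"
      by (rule sum.swap)
    then show ?thesis
      by (simp add: sum.distrib sum_distrib_left sum_divide_distrib mult_ac)
  qed
  also have "(\<Sum>i<p. (x i)\<^sup>2 * (\<Sum>j<p. \<bar>A i j\<bar>) / 2) = (\<Sum>j<p. (x j)\<^sup>2 * (\<Sum>i<p. \<bar>A i j\<bar>) / 2)"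
    by (intro sum.cong refl arg_cong[of _ _ "\<lambda>t. _ * t / 2"]) (use sym in auto)
  also have "\<dots> + \<dots> = (\<Sum>j<p. (x j)\<^sup>2 * (\<Sum>i<p. \<bar>A i j\<bar>))"
    by (simp add: sum.distrib[symmetric])
  also have "\<dots> \<le> (\<Sum>j<p. (x j)\<^sup>2 * r)"
    by (intro sum_mono mult_left_mono r) auto
  also have "\<dots> = r * sqn p x"
    unfolding sqn_def by (simp add: sum_distrib_left mult_ac)
  finally show ?thesis .
qed

section \<open>Operator norm and largest eigenvalue\<close>

lemma l2_norm_sqn: "v \<in> carrier_vec p \<Longrightarrow> (l2_norm v)\<^sup>2 = sqn p (\<lambda>i. v $ i)"
  unfolding l2_norm_def sqn_def scalar_prod_def
  by (simp add: sum_nonneg power2_eq_square atLeast0LessThan)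

lemma l2_norm_nonneg [simp]: "0 \<le> l2_norm v"
  unfolding l2_norm_def scalar_prod_def by (simp add: sum_nonneg)

lemma l2_norm_eq_1_iff: "v \<in> carrier_vec p \<Longrightarrow> l2_norm v = 1 \<longleftrightarrow> sqn p (\<lambda>i. v $ i) = 1"
  using l2_norm_sqn[of v p] l2_norm_nonneg[of v]
  by (metis one_power2 power2_eq_iff_nonneg zero_le_one)

lemma l2_norm_mult_mat_vec:
  assumes "A \<in> carrier_mat p p" "v \<in> carrier_vec p"
  shows "(l2_norm (A *\<^sub>v v))\<^sup>2 = (\<Sum>i<p. (\<Sum>j<p. A $$ (i, j) * v $ j)\<^sup>2)"
  using assms
  by (subst l2_norm_sqn[of _ p])
    (auto simp: sqn_def scalar_prod_def atLeast0LessThan intro!: sum.cong)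

lemma unit_vec_l2: "0 < p \<Longrightarrow> l2_norm (Matrix.unit_vec p 0) = 1"
  by (subst l2_norm_eq_1_iff[of _ p]) (auto simp: sqn_def unit_vec_def if_distrib[of "\<lambda>t. t\<^sup>2"] cong: if_cong)

text \<open>A real supremum carries information only for a set bounded above; the Frobenius norm
  supplies the bound, by Cauchy-Schwarz in each row.\<close>

lemma op_norm_bdd:
  assumes A: "A \<in> carrier_mat p p"
  shows "bdd_above ((\<lambda>x. l2_norm (A *\<^sub>v x)) ` {x \<in> carrier_vec (dim_col A). l2_norm x = 1})"
proof (rule bdd_aboveI2)
  fix v assume "v \<in> {x \<in> carrier_vec (dim_col A). l2_norm x = 1}"
  then have v: "v \<in> carrier_vec p" "sqn p (\<lambda>i. v $ i) = 1"
    using A l2_norm_eq_1_iff by auto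
  have "(l2_norm (A *\<^sub>v v))\<^sup>2 = (\<Sum>i<p. (\<Sum>j<p. A $$ (i, j) * v $ j)\<^sup>2)"
    by (rule l2_norm_mult_mat_vec[OF A v(1)])
  also have "\<dots> \<le> (\<Sum>i<p. (\<Sum>j<p. (A $$ (i, j))\<^sup>2) * (\<Sum>j<p. (v $ j)\<^sup>2))"
    by (intro sum_mono Cauchy_Schwarz_ineq_sum)
  also have "\<dots> = (\<Sum>i<p. \<Sum>j<p. (A $$ (i, j))\<^sup>2)"
    using v(2) by (simp add: sqn_def)
  finally show "l2_norm (A *\<^sub>v v) \<le> sqrt (\<Sum>i<p. \<Sum>j<p. (A $$ (i, j))\<^sup>2)"
    by (rule real_le_rsqrt)
qed

text \<open>Stated for squares and without symmetry, since estimators need not be symmetric; every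
  lower bound on the loss comes from testing one well-chosen unit vector.\<close>

lemma op_norm_ge:
  assumes A: "A \<in> carrier_mat p p" and u: "sqn p u = 1"
  shows "(\<Sum>i<p. (\<Sum>j<p. A $$ (i, j) * u j)\<^sup>2) \<le> (op_norm A)\<^sup>2"
proof -
  let ?v = "Matrix.vec p u"
  have v: "?v \<in> carrier_vec p" "l2_norm ?v = 1"
    using u by (auto simp: l2_norm_eq_1_iff[of _ p] sqn_def)
  have "l2_norm (A *\<^sub>v ?v) \<le> op_norm A"
    unfolding op_norm_def using v A by (intro cSUP_upper op_norm_bdd[OF A]) auto
  then have "(l2_norm (A *\<^sub>v ?v))\<^sup>2 \<le> (op_norm A)\<^sup>2"
    by (intro power_mono) auto
  then show ?thesis
    using v by (simp add: l2_norm_mult_mat_vec[OF A v(1)])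
qed

lemma op_norm_entry:
  assumes A: "A \<in> carrier_mat p p" and "m < p"
  shows "(A $$ (m, m))\<^sup>2 \<le> (op_norm A)\<^sup>2"
proof -
  let ?u = "\<lambda>i. if i = m then 1 else 0 :: real"
  have "sqn p ?u = 1"
    using assms by (simp add: sqn_def if_distrib[of "\<lambda>t. t\<^sup>2"] cong: if_cong)
  from op_norm_ge[OF A this] have "(\<Sum>i<p. (A $$ (i, m))\<^sup>2) \<le> (op_norm A)\<^sup>2"
    using assms by (simp add: if_distrib[of "\<lambda>t. _ * t"] cong: if_cong)
  moreover have "(A $$ (m, m))\<^sup>2 \<le> (\<Sum>i<p. (A $$ (i, m))\<^sup>2)"
    using assms by (intro member_le_sum) auto
  ultimately show ?thesis by linarith
qed

text \<open>The quadratic form of a symmetric matrix controls its norm without diagonalisation: test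
  the bilinear form on \<open>y = A v\<close> against a multiple of \<open>v\<close>. Nonnegativity
  is recorded because the norm is squared later; it needs a unit vector, hence
  \<open>0 < p\<close>.\<close>

lemma op_norm_sym_le:
  assumes A: "A \<in> carrier_mat p p" and p: "0 < p"
    and sym: "\<And>i j. i < p \<Longrightarrow> j < p \<Longrightarrow> A $$ (i, j) = A $$ (j, i)"
    and q: "\<And>x. \<bar>bil p (\<lambda>i j. A $$ (i, j)) x x\<bar> \<le> q * sqn p x" and q0: "0 \<le> q"
  shows "0 \<le> op_norm A \<and> op_norm A \<le> q"
proof -
  let ?S = "{x \<in> carrier_vec (dim_col A). l2_norm x = 1}"
  have ne: "Matrix.unit_vec p 0 \<in> ?S"
    using A p unit_vec_l2 by auto
  have "l2_norm (A *\<^sub>v v) \<le> q" if "v \<in> ?S" for v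
  proof -
    from that have v: "v \<in> carrier_vec p" "sqn p (\<lambda>i. v $ i) = 1"
      using A l2_norm_eq_1_iff by auto
    define y where "y = (\<lambda>i. \<Sum>j<p. A $$ (i, j) * v $ j)"
    have Y: "(l2_norm (A *\<^sub>v v))\<^sup>2 = sqn p y"
      using l2_norm_mult_mat_vec[OF A v(1)] by (simp add: y_def sqn_def)
    have bY: "bil p (\<lambda>i j. A $$ (i, j)) y (\<lambda>i. v $ i) = sqn p y"
      unfolding bil_def sqn_def
      by (simp add: y_def power2_eq_square sum_distrib_left sum_distrib_right mult_ac)
    \<comment> \<open>Scaling \<open>v\<close> by \<open>q\<close> balances the two squared norms:
      after cancelling \<open>q\<close> the inequality reads
      \<open>sqn p y \<le> (sqn p y + q\<^sup>2) / 2\<close>. The cancellation is why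
      \<open>q = 0\<close> is treated apart.\<close>
    have "\<bar>bil p (\<lambda>i j. A $$ (i, j)) y (\<lambda>i. q * v $ i)\<bar> \<le> q * (sqn p y + sqn p (\<lambda>i. q * v $ i)) / 2"
      by (rule bil_polarization[where J=UNIV]) (use sym q in auto)
    then have le: "q * sqn p y \<le> q * ((sqn p y + q\<^sup>2) / 2)"
      using q0 v(2) by (simp add: bil_scale_right sqn_scale bY)
    have "sqn p y \<le> q\<^sup>2"
    proof (cases "q = 0")
      case True
      have "\<bar>bil p (\<lambda>i j. A $$ (i, j)) y (\<lambda>i. v $ i)\<bar> \<le> q * (sqn p y + sqn p (\<lambda>i. v $ i)) / 2"
        by (rule bil_polarization[where J=UNIV]) (use sym q in auto)
      then show ?thesis using True bY by simp
    next
      case False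
      with le q0 have "sqn p y \<le> (sqn p y + q\<^sup>2) / 2" by simp
      then show ?thesis by simp
    qed
    then show ?thesis
      using Y q0 by (metis power2_le_imp_le)
  qed
  then have "op_norm A \<le> q"
    unfolding op_norm_def using ne by (intro cSUP_least) auto
  moreover have "l2_norm (A *\<^sub>v Matrix.unit_vec p 0) \<le> op_norm A"
    unfolding op_norm_def by (intro cSUP_upper op_norm_bdd[OF A] ne)
  ultimately show ?thesis
    using l2_norm_nonneg order_trans by blast
qed

text \<open>\<open>Max\<close> of an empty spectrum is unspecified, so an eigenvalue has to be
  exhibited; a column without off-diagonal entries makes a unit vector an eigenvector. The upper
  bound is Gershgorin's argument at the coordinate where an eigenvector is largest in absolute
  value.\<close>

lemma lambda_max_le:
  assumes A: "A \<in> carrier_mat p p" and m: "m < p"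
    and ev: "\<And>i. i < p \<Longrightarrow> i \<noteq> m \<Longrightarrow> A $$ (i, m) = 0"
    and r: "\<And>i. i < p \<Longrightarrow> (\<Sum>j<p. \<bar>A $$ (i, j)\<bar>) \<le> r"
  shows "lambda_max A \<le> r"
proof -
  have "eigenvector A (Matrix.unit_vec p m) (A $$ (m, m))"
    unfolding eigenvector_def
  proof (intro conjI)
    show "A *\<^sub>v Matrix.unit_vec p m = A $$ (m, m) \<cdot>\<^sub>v Matrix.unit_vec p m"
    proof (rule eq_vecI)
      fix i assume "i < dim_vec (A $$ (m, m) \<cdot>\<^sub>v Matrix.unit_vec p m)"
      then have i: "i < p" by simp
      then show "(A *\<^sub>v Matrix.unit_vec p m) $ i = (A $$ (m, m) \<cdot>\<^sub>v Matrix.unit_vec p m) $ i"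
        using A m ev[OF i] by (cases "i = m") (auto simp: scalar_prod_right_unit)
    qed (use A in auto)
  qed (use A m in auto)
  then have ne: "spectrum A \<noteq> {}"
    unfolding spectrum_def eigenvalue_def by auto
  have "l \<le> r" if "l \<in> spectrum A" for l
  proof -
    from that obtain v where v: "v \<in> carrier_vec p" "v \<noteq> 0\<^sub>v p" "A *\<^sub>v v = l \<cdot>\<^sub>v v"
      using A unfolding spectrum_def eigenvalue_def eigenvector_def by auto
    obtain i where i: "i < p" "\<And>j. j < p \<Longrightarrow> \<bar>v $ j\<bar> \<le> \<bar>v $ i\<bar>"
    proof -
      have f: "finite ((\<lambda>j. \<bar>v $ j\<bar>) ` {..<p})" "(\<lambda>j. \<bar>v $ j\<bar>) ` {..<p} \<noteq> {}"
        using m by auto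
      obtain i where "i < p" "\<bar>v $ i\<bar> = Max ((\<lambda>j. \<bar>v $ j\<bar>) ` {..<p})"
        using Max_in[OF f] by auto
      then show thesis using that[of i] f by auto
    qed
    have pos: "0 < \<bar>v $ i\<bar>"
    proof (rule ccontr)
      assume "\<not> 0 < \<bar>v $ i\<bar>"
      then have "v $ j = 0" if "j < p" for j using i(2)[OF that] by simp
      then show False using v(1,2) by (auto intro!: eq_vecI)
    qed
    have "l * v $ i = (\<Sum>j<p. A $$ (i, j) * v $ j)"
    proof -
      have "(A *\<^sub>v v) $ i = l * v $ i" using v(1) i(1) unfolding v(3) by simp
      moreover have "(A *\<^sub>v v) $ i = (\<Sum>j<p. A $$ (i, j) * v $ j)"
        using A v(1) i(1) by (auto simp: scalar_prod_def atLeast0LessThan intro!: sum.cong)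
      ultimately show ?thesis by simp
    qed
    then have "l * \<bar>v $ i\<bar> \<le> (\<Sum>j<p. \<bar>A $$ (i, j)\<bar> * \<bar>v $ i\<bar>)"
    proof -
      have "l * \<bar>v $ i\<bar> \<le> \<bar>l * v $ i\<bar>" by (simp add: abs_mult mult_right_mono)
      also have "\<dots> \<le> (\<Sum>j<p. \<bar>A $$ (i, j) * v $ j\<bar>)"
        using \<open>l * v $ i = _\<close> by simp
      also have "\<dots> \<le> (\<Sum>j<p. \<bar>A $$ (i, j)\<bar> * \<bar>v $ i\<bar>)"
        by (intro sum_mono) (use i in \<open>auto simp: abs_mult intro!: mult_left_mono\<close>)
      finally show ?thesis .
    qed
    also have "\<dots> = (\<Sum>j<p. \<bar>A $$ (i, j)\<bar>) * \<bar>v $ i\<bar>"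
      by (simp add: sum_distrib_right)
    also have "\<dots> \<le> r * \<bar>v $ i\<bar>"
      using r[OF i(1)] by (intro mult_right_mono) auto
    finally show ?thesis using pos by simp
  qed
  then show ?thesis
    unfolding lambda_max_def using card_finite_spectrum(1)[OF A] ne by (subst Max_le_iff) auto
qed

section \<open>Nets and block-tridiagonal forms\<close>

text \<open>The induction carries \<open>3 - 2 * (1/2) ^ L\<close>: the two new terms add at most
  \<open>2 * (1/2) ^ Suc L\<close>, exactly the amount by which that bound grows.\<close>

lemma sum_exp_neg_sq_le: "(\<Sum>m\<in>{-int L..int L}. exp (- (real_of_int m)\<^sup>2)) \<le> 3"
proof -
  have "(\<Sum>m\<in>{-int L..int L}. exp (- (real_of_int m)\<^sup>2)) \<le> 3 - 2 * (1/2) ^ L"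
  proof (induction L)
    case 0
    then show ?case by simp
  next
    case (Suc L)
    have e: "exp (- ((1 + real L)\<^sup>2)) \<le> (1/2) ^ Suc L"
    proof -
      have "exp (- ((1 + real L)\<^sup>2)) \<le> exp (- real (Suc L))"
      proof -
        have "1 * (1 + real L) \<le> (1 + real L) * (1 + real L)"
          by (intro mult_right_mono) auto
        then have "real (Suc L) \<le> (1 + real L)\<^sup>2" by (simp add: power2_eq_square)
        then show ?thesis by (simp only: exp_le_cancel_iff neg_le_iff_le)
      qed
      also have "\<dots> = exp (-1) ^ Suc L"
        by (subst exp_of_nat_mult[symmetric]) simp
      also have "\<dots> \<le> (1/2) ^ Suc L"
      proof (rule power_mono)
        have "(2::real) \<le> exp 1" using exp_ge_add_one_self[of 1] by simp
        then have "inverse (exp (1::real)) \<le> inverse 2" by (intro le_imp_inverse_le) auto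
        then show "exp (-1) \<le> (1/2 :: real)" by (simp add: exp_minus)
      qed simp
      finally show ?thesis .
    qed
    have "{-int (Suc L)..int (Suc L)} = insert (- int (Suc L)) (insert (int (Suc L)) {-int L..int L})"
      by auto
    then have "(\<Sum>m\<in>{-int (Suc L)..int (Suc L)}. exp (- (real_of_int m)\<^sup>2)) =
      (\<Sum>m\<in>{-int L..int L}. exp (- (real_of_int m)\<^sup>2)) + 2 * exp (- ((1 + real L)\<^sup>2))"
      by (simp add: power2_commute power2_eq_square algebra_simps)
    then show ?case using Suc e by simp
  qed
  then show ?thesis
    by (smt (verit, best) zero_le_power divide_nonneg_nonneg)
qed

text \<open>Lattice points in the ball of radius \<open>8 * sqrt d\<close>; \<open>net_vec\<close>
  scales them into the unit ball. Integer coordinates allow counting by a product formula, and the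
  box makes the set visibly finite.\<close>

definition net :: "nat set \<Rightarrow> nat \<Rightarrow> (nat \<Rightarrow> int) set" where
  "net J d = {z \<in> PiE J (\<lambda>_. {-int (8 * d)..int (8 * d)}). (\<Sum>i\<in>J. (z i)\<^sup>2) \<le> 64 * int d}"

definition net_vec :: "nat set \<Rightarrow> nat \<Rightarrow> (nat \<Rightarrow> int) \<Rightarrow> nat \<Rightarrow> real" where
  "net_vec J d z = (\<lambda>i. if i \<in> J then real_of_int (z i) / (8 * sqrt d) else 0)"

lemma finite_net: "finite J \<Longrightarrow> finite (net J d)"
  unfolding net_def
  by (rule finite_subset[of _ "PiE J (\<lambda>_. {-int (8 * d)..int (8 * d)})"])
    (auto intro: finite_PiE)

text \<open>Counting by an exponential weight: \<open>exp (64 * d)\<close> times the product of the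
  \<open>exp (- (z i)\<^sup>2)\<close> is at least one on the net, and over the whole box it
  factorises into coordinate sums, each at most 3.\<close>

lemma card_net_le:
  assumes J: "finite J" "card J \<le> d"
  shows "real (card (net J d)) \<le> (3 * exp 64) ^ d"
proof -
  let ?P = "PiE J (\<lambda>_. {-int (8 * d)..int (8 * d)})"
  have "real (card (net J d)) = (\<Sum>z\<in>net J d. 1)" by simp
  also have "\<dots> \<le> (\<Sum>z\<in>net J d. exp (64 * real d) * (\<Prod>i\<in>J. exp (- (real_of_int (z i))\<^sup>2)))"
  proof (rule sum_mono)
    fix z assume "z \<in> net J d"
    then have "(\<Sum>i\<in>J. (z i)\<^sup>2) \<le> 64 * int d" by (simp add: net_def)
    then have "real_of_int (\<Sum>i\<in>J. (z i)\<^sup>2) \<le> real_of_int (64 * int d)"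
      by (simp only: of_int_le_iff)
    then have "0 \<le> 64 * real d + (\<Sum>i\<in>J. - (real_of_int (z i))\<^sup>2)"
      by (simp add: sum_negf)
    then have "1 \<le> exp (64 * real d + (\<Sum>i\<in>J. - (real_of_int (z i))\<^sup>2))" by simp
    then show "1 \<le> exp (64 * real d) * (\<Prod>i\<in>J. exp (- (real_of_int (z i))\<^sup>2))"
      by (simp only: exp_add exp_sum[OF J(1)])
  qed
  also have "\<dots> \<le> (\<Sum>z\<in>?P. exp (64 * real d) * (\<Prod>i\<in>J. exp (- (real_of_int (z i))\<^sup>2)))"
    using J by (intro sum_mono2 finite_PiE) (auto simp: net_def intro!: mult_nonneg_nonneg prod_nonneg)
  also have "\<dots> = exp (64 * real d) * (\<Prod>i\<in>J. \<Sum>m\<in>{-int (8 * d)..int (8 * d)}. exp (- (real_of_int m)\<^sup>2))"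
    by (subst prod_sum_PiE) (use J in \<open>auto simp: sum_distrib_left\<close>)
  also have "\<dots> \<le> exp (64 * real d) * (\<Prod>i\<in>J. 3)"
    by (intro mult_left_mono prod_mono) (use sum_exp_neg_sq_le[of "8 * d"] in \<open>auto intro!: sum_nonneg\<close>)
  also have "\<dots> \<le> exp (64 * real d) * 3 ^ d"
    using J by (auto intro!: mult_left_mono power_increasing)
  also have "\<dots> = (3 * exp 64) ^ d"
    by (simp add: power_mult_distrib exp_of_nat2_mult[symmetric] mult.commute)
  finally show ?thesis .
qed

lemma sqn_supp:
  assumes "J \<subseteq> {..<p}" "\<And>i. i \<notin> J \<Longrightarrow> x i = 0"
  shows "sqn p x = (\<Sum>i\<in>J. (x i)\<^sup>2)"
  unfolding sqn_def by (rule sum.mono_neutral_right) (use assms in auto)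

lemma sqn_net_vec_le:
  assumes "J \<subseteq> {..<p}" "0 < d" "z \<in> net J d"
  shows "sqn p (net_vec J d z) \<le> 1"
proof -
  have "sqn p (net_vec J d z) = (\<Sum>i\<in>J. (real_of_int (z i) / (8 * sqrt d))\<^sup>2)"
    using assms by (subst sqn_supp[of J]) (auto simp: net_vec_def)
  also have "\<dots> = real_of_int (\<Sum>i\<in>J. (z i)\<^sup>2) / (64 * real d)"
    by (simp add: power_divide power_mult_distrib sum_divide_distrib)
  also have "\<dots> \<le> real_of_int (64 * int d) / (64 * real d)"
  proof (rule divide_right_mono)
    show "real_of_int (\<Sum>i\<in>J. (z i)\<^sup>2) \<le> real_of_int (64 * int d)"
      using assms(3) by (simp only: net_def of_int_le_iff mem_Collect_eq)
  qed simp
  finally show ?thesis using assms by simp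
qed

text \<open>Rounding towards zero, rather than to the nearest integer, does not lengthen the vector,
  so it stays in the ball that defines the net.\<close>

lemma round_to_zero:
  fixes t :: real
  obtains m :: int where "\<bar>real_of_int m\<bar> \<le> \<bar>t\<bar>" "\<bar>t - real_of_int m\<bar> \<le> 1"
proof -
  have pos: "\<exists>m::int. 0 \<le> real_of_int m \<and> real_of_int m \<le> u \<and> u < real_of_int m + 1" if "0 \<le> u" for u :: real
    using that floor_correct[of u] by (intro exI[of _ "\<lfloor>u\<rfloor>"]) auto
  from pos[of "\<bar>t\<bar>"] obtain m :: int
    where m: "0 \<le> real_of_int m" "real_of_int m \<le> \<bar>t\<bar>" "\<bar>t\<bar> < real_of_int m + 1"
    by auto
  show ?thesis
  proof (cases "0 \<le> t")
    case True
    with m show ?thesis by (intro that[of m]) auto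
  next
    case False
    with m show ?thesis by (intro that[of "- m"]) auto
  qed
qed

text \<open>Each of at most \<open>d\<close> coordinates moves by at most
  \<open>1 / (8 * sqrt d)\<close>, which gives distance at most \<open>1 / 8\<close>.\<close>

lemma net_approx:
  assumes J: "J \<subseteq> {..<p}" "card J \<le> d" "0 < d"
    and x: "\<And>i. i \<notin> J \<Longrightarrow> x i = 0" "sqn p x \<le> 1"
  obtains z where "z \<in> net J d" "sqn p (\<lambda>i. x i - net_vec J d z i) \<le> 1 / 64"
proof -
  have fJ: "finite J" using J finite_subset by blast
  let ?c = "8 * sqrt (real d)"
  have c: "?c > 0" using J by simp
  have "\<exists>m::int. \<bar>real_of_int m\<bar> \<le> \<bar>?c * x i\<bar> \<and> \<bar>?c * x i - real_of_int m\<bar> \<le> 1" for i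
    using round_to_zero[of "?c * x i"] by metis
  then obtain m :: "nat \<Rightarrow> int" where m: "\<And>i. \<bar>real_of_int (m i)\<bar> \<le> \<bar>?c * x i\<bar>"
      "\<And>i. \<bar>?c * x i - real_of_int (m i)\<bar> \<le> 1"
    by metis
  define z where "z = restrict m J"
  have "real_of_int (\<Sum>i\<in>J. (z i)\<^sup>2) \<le> (\<Sum>i\<in>J. (?c * x i)\<^sup>2)"
    unfolding z_def using m(1) by (auto intro!: sum_mono simp: abs_le_square_iff)
  also have "\<dots> = 64 * real d * sqn p x"
    by (subst sqn_supp[OF J(1) x(1)]) (simp_all add: power_mult_distrib sum_distrib_left)
  also have "\<dots> \<le> 64 * real d * 1" using x(2) by (intro mult_left_mono) auto
  also have "\<dots> = real_of_int (64 * int d)" by simp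
  finally have S: "(\<Sum>i\<in>J. (z i)\<^sup>2) \<le> 64 * int d" by (simp only: of_int_le_iff)
  have "z i \<in> {-int (8 * d)..int (8 * d)}" if "i \<in> J" for i
  proof -
    have "(z i)\<^sup>2 \<le> (\<Sum>i\<in>J. (z i)\<^sup>2)" using that fJ by (intro member_le_sum) auto
    also have "\<dots> \<le> 64 * int d" by (rule S)
    also have "\<dots> \<le> (8 * int d)\<^sup>2"
      using J(3) by (simp add: power2_eq_square)
    finally have "\<bar>z i\<bar> \<le> \<bar>8 * int d\<bar>" by (simp only: abs_le_square_iff)
    then show ?thesis by auto
  qed
  then have zn: "z \<in> net J d"
    unfolding net_def using S by (auto simp: z_def PiE_def)
  have "sqn p (\<lambda>i. x i - net_vec J d z i) = (\<Sum>i\<in>J. (x i - real_of_int (m i) / ?c)\<^sup>2)"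
    by (subst sqn_supp[OF J(1)]) (auto simp: net_vec_def x z_def)
  also have "\<dots> \<le> (\<Sum>i\<in>J. 1 / (64 * real d))"
  proof (rule sum_mono)
    fix i
    have "(?c * x i - real_of_int (m i))\<^sup>2 \<le> 1"
      using m(2)[of i] by (simp add: abs_square_le_1)
    moreover have "x i - real_of_int (m i) / ?c = (?c * x i - real_of_int (m i)) / ?c"
      using c by (simp add: field_simps)
    moreover have "?c\<^sup>2 = 64 * real d" by (simp add: power_mult_distrib)
    ultimately show "(x i - real_of_int (m i) / ?c)\<^sup>2 \<le> 1 / (64 * real d)"
      by (simp only: power_divide) (intro divide_right_mono; simp)
  qed
  also have "\<dots> = real (card J) / real d * (1 / 64)" by simp
  also have "\<dots> \<le> 1 * (1 / 64)" using J by (intro mult_right_mono) auto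
  finally show ?thesis using that zn by simp
qed

lemma bil_le_of_unit:
  assumes B: "\<And>x. (\<And>i. i \<notin> J \<Longrightarrow> x i = 0) \<Longrightarrow> sqn p x \<le> 1 \<Longrightarrow> \<bar>bil p A x x\<bar> \<le> q"
    and x: "\<And>i. i \<notin> J \<Longrightarrow> x i = 0"
  shows "\<bar>bil p A x x\<bar> \<le> q * sqn p x"
proof (cases "sqn p x = 0")
  case True
  then have "\<forall>i\<in>{..<p}. (x i)\<^sup>2 = 0"
    unfolding sqn_def by (subst (asm) sum_nonneg_eq_0_iff) auto
  then have "bil p A x x = 0" unfolding bil_def by (auto intro!: sum.neutral)
  then show ?thesis using True by simp
next
  case False
  then have pos: "sqn p x > 0" using sqn_nonneg[of p x] by linarith
  let ?c = "1 / sqrt (sqn p x)"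
  have c2: "?c\<^sup>2 = 1 / sqn p x" using pos by (simp add: power_divide)
  have "\<bar>bil p A (\<lambda>i. ?c * x i) (\<lambda>i. ?c * x i)\<bar> \<le> q"
    by (rule B) (use x c2 pos in \<open>simp_all only: sqn_scale, auto\<close>)
  moreover have "bil p A (\<lambda>i. ?c * x i) (\<lambda>i. ?c * x i) = ?c\<^sup>2 * bil p A x x"
    by (simp only: bil_scale_left bil_scale_right power2_eq_square mult.assoc)
  ultimately have "\<bar>bil p A x x\<bar> / sqn p x \<le> q"
    using pos by (simp only: c2 abs_mult) simp
  then show ?thesis using pos by (simp add: field_simps)
qed

text \<open>A self-bounding argument: let \<open>q\<close> be the supremum of the form over the unit
  ball of vectors supported in \<open>J\<close>. Passing to a net point costs at most
  \<open>q / 4\<close>, so \<open>q \<le> B + q / 4\<close>, and this can be solved for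
  \<open>q\<close> because the supremum is finite.\<close>

lemma net_bound:
  assumes J: "J \<subseteq> {..<p}" "card J \<le> d" "0 < d"
    and sym: "\<And>i j. i < p \<Longrightarrow> j < p \<Longrightarrow> A i j = A j i"
    and B: "\<And>z. z \<in> net J d \<Longrightarrow> \<bar>bil p A (net_vec J d z) (net_vec J d z)\<bar> \<le> B"
    and x: "\<And>i. i \<notin> J \<Longrightarrow> x i = 0"
  shows "\<bar>bil p A x x\<bar> \<le> 2 * B * sqn p x"
proof -
  define U where "U = {x. (\<forall>i. i \<notin> J \<longrightarrow> x i = 0) \<and> sqn p x \<le> 1}"
  define q where "q = (SUP x\<in>U. \<bar>bil p A x x\<bar>)"
  have U0: "(\<lambda>_. 0) \<in> U" by (auto simp: U_def sqn_def)
  have bdd: "bdd_above ((\<lambda>x. \<bar>bil p A x x\<bar>) ` U)"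
  proof (rule bdd_aboveI2)
    fix x assume "x \<in> U"
    then have x: "sqn p x \<le> 1" by (auto simp: U_def)
    have x1: "\<bar>x i\<bar> \<le> 1" if "i < p" for i
    proof -
      have "(x i)\<^sup>2 \<le> sqn p x" unfolding sqn_def using that by (intro member_le_sum) auto
      then show ?thesis using x by (simp flip: abs_square_le_1)
    qed
    show "\<bar>bil p A x x\<bar> \<le> (\<Sum>i<p. \<Sum>j<p. \<bar>A i j\<bar>)"
      unfolding bil_def
    proof (intro order_trans[OF sum_abs] sum_mono order_trans[OF sum_abs])
      fix i j assume "i \<in> {..<p}" "j \<in> {..<p}"
      then have "\<bar>x i\<bar> * \<bar>A i j\<bar> * \<bar>x j\<bar> \<le> 1 * \<bar>A i j\<bar> * 1"
        using x1 by (intro mult_mono) auto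
      then show "\<bar>x i * A i j * x j\<bar> \<le> \<bar>A i j\<bar>" by (simp add: abs_mult)
    qed
  qed
  have up: "\<bar>bil p A x x\<bar> \<le> q" if "x \<in> U" for x
    unfolding q_def by (rule cSUP_upper[OF that bdd])
  have q: "\<bar>bil p A x x\<bar> \<le> q * sqn p x" if "\<And>i. i \<notin> J \<Longrightarrow> x i = 0" for x
    by (rule bil_le_of_unit[where J=J]) (use up that in \<open>auto simp: U_def\<close>)
  have "q \<le> B + q / 4"
    unfolding q_def
  proof (rule cSUP_least)
    fix x assume xU: "x \<in> U"
    then obtain z where z: "z \<in> net J d" "sqn p (\<lambda>i. x i - net_vec J d z i) \<le> 1 / 64"
      using net_approx[OF J, of x] by (auto simp: U_def)
    let ?y = "net_vec J d z"
    have y: "sqn p ?y \<le> 1" by (rule sqn_net_vec_le[OF J(1,3) z(1)])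
    \<comment> \<open>The difference is short and the sum is long; the factors 4 and 1/4 cancel in
      the bilinear form and bring both squared norms to at most \<open>1 / 4\<close>.\<close>
    let ?u = "\<lambda>i. 4 * (x i - ?y i)" and ?v = "\<lambda>i. (1/4) * (x i + ?y i)"
    have supp: "\<And>i. i \<notin> J \<Longrightarrow> ?y i = 0" by (simp add: net_vec_def)
    have "sqn p ?u \<le> 1 / 4" using z(2) by (subst sqn_scale) simp
    moreover have "sqn p (\<lambda>i. x i + ?y i) \<le> 4"
    proof -
      have "sqn p x \<le> 1" using xU by (auto simp: U_def)
      then show ?thesis
        using sqn_parallelogram[of p x ?y] sqn_nonneg[of p "\<lambda>i. x i - ?y i"] y by linarith
    qed
    then have "sqn p ?v \<le> 1 / 4" by (subst sqn_scale) (simp add: power2_eq_square)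
    ultimately have uv: "(sqn p ?u + sqn p ?v) / 2 \<le> 1 / 4" by simp
    have q0: "0 \<le> q" using up[OF U0] by linarith
    have "\<bar>bil p A ?u ?v\<bar> \<le> q * (sqn p ?u + sqn p ?v) / 2"
      by (rule bil_polarization[where J=J]) (use sym q supp xU in \<open>auto simp: U_def\<close>)
    also have "\<dots> \<le> q * (1 / 4)" using mult_left_mono[OF uv q0] by simp
    finally have "\<bar>bil p A (\<lambda>i. x i - ?y i) (\<lambda>i. x i + ?y i)\<bar> \<le> q / 4"
      unfolding bil_scale_right bil_scale_left by simp
    moreover have "bil p A (\<lambda>i. x i - ?y i) (\<lambda>i. x i + ?y i) = bil p A x x - bil p A ?y ?y"
      by (simp add: bil_add_right bil_diff_left bil_commute[of p A ?y x, OF sym])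
    ultimately show "\<bar>bil p A x x\<bar> \<le> B + (SUP x\<in>U. \<bar>bil p A x x\<bar>) / 4"
      using B[OF z(1)] unfolding q_def[symmetric] by linarith
  qed (use U0 in auto)
  moreover have "0 \<le> q" using up[OF U0] by linarith
  ultimately have "q \<le> 2 * B" by linarith
  then have "q * sqn p x \<le> 2 * B * sqn p x" by (intro mult_right_mono) auto
  moreover have "\<bar>bil p A x x\<bar> \<le> q * sqn p x" by (rule q) (rule x)
  ultimately show ?thesis by linarith
qed

section \<open>From windows to the block-tridiagonal form\<close>

lemma sum_swap22:
  "(\<Sum>i\<in>I. \<Sum>j\<in>J. \<Sum>a\<in>K. \<Sum>b\<in>L. F i j a b) = (\<Sum>a\<in>K. \<Sum>b\<in>L. \<Sum>i\<in>I. \<Sum>j\<in>J. F i j a b)"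
proof -
  have "(\<Sum>i\<in>I. \<Sum>j\<in>J. \<Sum>a\<in>K. \<Sum>b\<in>L. F i j a b) = (\<Sum>i\<in>I. \<Sum>a\<in>K. \<Sum>j\<in>J. \<Sum>b\<in>L. F i j a b)"
    by (intro sum.cong refl sum.swap)
  also have "\<dots> = (\<Sum>a\<in>K. \<Sum>i\<in>I. \<Sum>j\<in>J. \<Sum>b\<in>L. F i j a b)"
    by (rule sum.swap)
  also have "\<dots> = (\<Sum>a\<in>K. \<Sum>i\<in>I. \<Sum>b\<in>L. \<Sum>j\<in>J. F i j a b)"
    by (intro sum.cong refl sum.swap)
  also have "\<dots> = (\<Sum>a\<in>K. \<Sum>b\<in>L. \<Sum>i\<in>I. \<Sum>j\<in>J. F i j a b)"
    by (intro sum.cong refl sum.swap)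
  finally show ?thesis .
qed

definition adj :: "nat \<Rightarrow> nat \<Rightarrow> bool" where
  "adj a b \<longleftrightarrow> a \<le> b + 1 \<and> b \<le> a + 1"

lemma adj_commute: "adj a b \<longleftrightarrow> adj b a"
  by (auto simp: adj_def)

lemma card_adj_le: "(\<Sum>b<p. if adj a b then 1 else 0 :: real) \<le> 3"
proof -
  have "(\<Sum>b<p. if adj a b then 1 else 0 :: real) = real (card {b\<in>{..<p}. adj a b})"
    by (subst sum.inter_filter[symmetric]) auto
  also have "card {b\<in>{..<p}. adj a b} \<le> card {a - 1, a, a + 1}"
    by (intro card_mono) (auto simp: adj_def)
  also have "\<dots> \<le> 3" by (auto simp: card_insert_if)
  finally show ?thesis by simp
qed

text \<open>Cut the vector into blocks; two neighbouring blocks lie in a common window of length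
  \<open>2 * k\<close>, where polarization applies. A block has at most three neighbours, itself
  included, whence the factor 3.\<close>

lemma block_bound:
  assumes k: "0 < k"
    and sym: "\<And>i j. i < p \<Longrightarrow> j < p \<Longrightarrow> A i j = A j i"
    and q: "\<And>b x. (\<And>i. i \<notin> {b * k..<(b + 2) * k} \<Longrightarrow> x i = 0) \<Longrightarrow> \<bar>bil p A x x\<bar> \<le> q * sqn p x"
    and q0: "0 \<le> q"
  shows "\<bar>bil p (\<lambda>i j. if adj (i div k) (j div k) then A i j else 0) x x\<bar> \<le> 3 * q * sqn p x"
proof -
  define X where "X a = (\<lambda>i. if i div k = a then x i else 0)" for a :: nat
  have lt: "i div k < p" if "i < p" for i
    using that by (meson div_le_dividend le_less_trans)
  \<comment> \<open>Only one block contains \<open>i\<close>, so a factor depending on that block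
    may be spread over all block indices; those below \<open>p\<close> suffice since
    \<open>i div k \<le> i\<close>.\<close>
  have exp1: "x i * f (i div k) = (\<Sum>a<p. X a i * f a)" if "i < p" for i and f :: "nat \<Rightarrow> real"
    using lt[OF that] by (simp add: X_def if_distrib[of "\<lambda>t. t * _"] sum.delta' cong: if_cong)
  have "bil p (\<lambda>i j. if adj (i div k) (j div k) then A i j else 0) x x
      = (\<Sum>i<p. \<Sum>j<p. \<Sum>a<p. \<Sum>b<p. (if adj a b then 1 else 0) * (X a i * A i j * X b j))"
    unfolding bil_def
  proof (intro sum.cong refl)
    fix i j assume i: "i \<in> {..<p}" and j: "j \<in> {..<p}"
    have "x i * (if adj (i div k) (j div k) then A i j else 0) * x j
        = x i * ((if adj (i div k) (j div k) then A i j else 0) * x j)" by simp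
    also have "\<dots> = (\<Sum>a<p. X a i * ((if adj a (j div k) then A i j else 0) * x j))"
      by (rule exp1) (use i in auto)
    also have "\<dots> = (\<Sum>a<p. X a i * (\<Sum>b<p. X b j * (if adj a b then A i j else 0)))"
      by (intro sum.cong refl arg_cong[of _ _ "\<lambda>t. _ * t"])
        (subst exp1[symmetric], use j in \<open>auto\<close>)
    also have "\<dots> = (\<Sum>a<p. \<Sum>b<p. (if adj a b then 1 else 0) * (X a i * A i j * X b j))"
      by (auto simp: sum_distrib_left intro!: sum.cong)
    finally show "x i * (if adj (i div k) (j div k) then A i j else 0) * x j = \<dots>" .
  qed
  also have "\<dots> = (\<Sum>a<p. \<Sum>b<p. (if adj a b then 1 else 0) * bil p A (X a) (X b))"
    unfolding bil_def sum_distrib_left by (rule sum_swap22)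
  finally have eq: "bil p (\<lambda>i j. if adj (i div k) (j div k) then A i j else 0) x x = \<dots>" .
  have pair: "\<bar>(if adj a b then 1 else 0) * bil p A (X a) (X b)\<bar>
      \<le> (if adj a b then 1 else 0) * (q * sqn p (X a) / 2) + (if adj b a then 1 else 0) * (q * sqn p (X b) / 2)"
    for a b
  proof (cases "adj a b")
    case True
    \<comment> \<open>The window that starts at the smaller block index contains both
      blocks.\<close>
    have "X c i = 0" if "c \<in> {a, b}" "i \<notin> {min a b * k..<(min a b + 2) * k}" for c i
    proof (rule ccontr)
      assume "X c i \<noteq> 0"
      then have c: "i div k = c" by (auto simp: X_def split: if_splits)
      have "c * k \<le> i" "i < (c + 1) * k"
        using c k by (auto simp: div_times_less_eq_dividend dividend_less_div_times)
      moreover have "min a b * k \<le> c * k" "(c + 1) * k \<le> (min a b + 2) * k"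
        using True that(1) by (intro mult_right_mono; auto simp: adj_def)+
      ultimately show False using that(2) by (meson atLeastLessThan_iff le_trans less_le_trans)
    qed
    then have "\<bar>bil p A (X a) (X b)\<bar> \<le> q * (sqn p (X a) + sqn p (X b)) / 2"
      by (intro bil_polarization[where J="{min a b * k..<(min a b + 2) * k}"] sym q) auto
    then show ?thesis using True adj_commute[of a b] by (simp add: algebra_simps)
  qed (simp add: adj_commute[of b a])
  have "\<bar>bil p (\<lambda>i j. if adj (i div k) (j div k) then A i j else 0) x x\<bar>
      \<le> (\<Sum>a<p. \<Sum>b<p. \<bar>(if adj a b then 1 else 0) * bil p A (X a) (X b)\<bar>)"
    unfolding eq by (intro order_trans[OF sum_abs] sum_mono sum_abs)
  also have "\<dots> \<le> (\<Sum>a<p. \<Sum>b<p. (if adj a b then 1 else 0) * (q * sqn p (X a) / 2)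
      + (if adj b a then 1 else 0) * (q * sqn p (X b) / 2))"
    by (intro sum_mono pair)
  also have "\<dots> = (\<Sum>a<p. \<Sum>b<p. (if adj a b then 1 else 0) * (q * sqn p (X a) / 2))
      + (\<Sum>b<p. \<Sum>a<p. (if adj b a then 1 else 0) * (q * sqn p (X b) / 2))"
    unfolding sum.distrib by (subst (2) sum.swap) simp
  also have "\<dots> = (\<Sum>a<p. (\<Sum>b<p. if adj a b then 1 else 0) * (q * sqn p (X a)))"
    by (simp only: sum_distrib_right[symmetric] sum.distrib[symmetric]) (simp add: field_simps)
  also have "\<dots> \<le> (\<Sum>a<p. 3 * (q * sqn p (X a)))"
    using q0 by (intro sum_mono mult_right_mono card_adj_le) auto
  also have "\<dots> = 3 * q * (\<Sum>a<p. sqn p (X a))" by (simp add: sum_distrib_left mult_ac)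
  also have "(\<Sum>a<p. sqn p (X a)) = (\<Sum>i<p. \<Sum>a<p. (X a i)\<^sup>2)"
    unfolding sqn_def by (rule sum.swap)
  also have "\<dots> = sqn p x"
    unfolding sqn_def
  proof (intro sum.cong refl)
    fix i assume "i \<in> {..<p}"
    then show "(\<Sum>a<p. (X a i)\<^sup>2) = (x i)\<^sup>2"
      using lt[of i] by (simp add: X_def if_distrib[of "\<lambda>t. t\<^sup>2"] sum.delta' cong: if_cong)
  qed
  finally show ?thesis .
qed

section \<open>Exponential moments\<close>

text \<open>Using \<open>exp x - 1 \<le> x * exp x\<close> twice gives the quadratic remainder. For
  negative \<open>x\<close> the second use is replaced by \<open>x \<le> exp x - 1\<close>, which
  multiplication by \<open>x\<close> reverses.\<close>

lemma exp_le_quadratic: "exp x \<le> 1 + x + x\<^sup>2 * exp \<bar>x\<bar>" for x :: real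
proof -
  have a: "exp x - 1 \<le> x * exp x"
  proof -
    have "1 - x \<le> exp (- x)" using exp_ge_add_one_self[of "- x"] by simp
    then have "(1 - x) * exp x \<le> exp (- x) * exp x" by (intro mult_right_mono) auto
    then show ?thesis by (simp add: algebra_simps flip: exp_add)
  qed
  then have b: "exp x - 1 - x \<le> x * (exp x - 1)" by (simp add: algebra_simps)
  show ?thesis
  proof (cases "0 \<le> x")
    case True
    then have "x * (exp x - 1) \<le> x * (x * exp x)" using a by (intro mult_left_mono) auto
    then show ?thesis using b True by (simp add: power2_eq_square)
  next
    case False
    then have "x * (exp x - 1) \<le> x * x"
    proof (intro mult_left_mono_neg)
      show "x \<le> exp x - 1" using exp_ge_add_one_self[of x] by linarith
    qed auto
    also have "\<dots> \<le> x\<^sup>2 * exp \<bar>x\<bar>"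
      using mult_left_mono[of 1 "exp \<bar>x\<bar>" "x\<^sup>2"] by (simp add: power2_eq_square)
    finally show ?thesis using b by simp
  qed
qed

lemma sq_le_2_exp: "0 \<le> u \<Longrightarrow> u\<^sup>2 \<le> 2 * exp u" for u :: real
  using exp_lower_Taylor_quadratic[of u] by simp

text \<open>The sum over \<open>m\<close> of
  \<open>exp (\<rho> / 4 * (m + 1)) * exp (- (m * \<rho> / 2))\<close>: half of the tail exponent
  pays for the exponential moment and the other half leaves a geometric series.\<close>

definition tail_const :: "real \<Rightarrow> real" where
  "tail_const \<rho> = exp (\<rho> / 4) / (1 - exp (- (\<rho> / 4)))"

lemma tail_const_ge_1: "0 < \<rho> \<Longrightarrow> 1 \<le> tail_const \<rho>"
proof -
  assume r: "0 < \<rho>"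
  have "1 - exp (- (\<rho> / 4)) \<le> exp (\<rho> / 4)"
    using r by (smt (verit) exp_gt_zero one_le_exp_iff divide_pos_pos)
  then show ?thesis using r by (simp add: tail_const_def field_simps)
qed

text \<open>Slice the values of the squared function into unit intervals and pay the tail
  probability on each slice.\<close>

lemma nn_integral_exp_sq_le:
  assumes "prob_space M" and f [measurable]: "f \<in> borel_measurable M" and \<rho>: "0 < \<rho>"
    and tail: "\<And>t. 0 < t \<Longrightarrow> measure M {x \<in> space M. \<bar>f x\<bar> > t} \<le> exp (- (t\<^sup>2 * \<rho> / 2))"
  shows "(\<integral>\<^sup>+x. ennreal (exp (\<rho> / 4 * (f x)\<^sup>2)) \<partial>M) \<le> ennreal (tail_const \<rho>)"
proof -
  interpret prob_space M by fact
  \<comment> \<open>The clause \<open>m = 0\<close> makes the lowest slice the whole space, because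
    the tail bound is available for positive \<open>t\<close> only.\<close>
  define A where "A m = {x \<in> space M. m = 0 \<or> \<bar>f x\<bar> > sqrt (real m)}" for m :: nat
  have A [measurable]: "A m \<in> sets M" for m unfolding A_def by measurable
  have mA: "measure M (A m) \<le> exp (- (real m * \<rho> / 2))" for m
  proof (cases "m = 0")
    case False
    then have "measure M (A m) \<le> exp (- ((sqrt (real m))\<^sup>2 * \<rho> / 2))"
      using tail[of "sqrt (real m)"] unfolding A_def by simp
    then show ?thesis by simp
  qed simp
  have pt: "ennreal (exp (\<rho> / 4 * (f x)\<^sup>2))
      \<le> (\<Sum>m. ennreal (exp (\<rho> / 4 * (real m + 1))) * indicator (A m) x)" if x: "x \<in> space M" for x
  proof -
    \<comment> \<open>Ceiling minus one instead of the floor: for positive \<open>m\<close> it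
      yields \<open>m < (f x)\<^sup>2\<close> strictly, as the open tail event demands.\<close>
    define m where "m = nat (\<lceil>(f x)\<^sup>2\<rceil> - 1)"
    have c: "real_of_int \<lceil>(f x)\<^sup>2\<rceil> - 1 < (f x)\<^sup>2" "(f x)\<^sup>2 \<le> real_of_int \<lceil>(f x)\<^sup>2\<rceil>"
      using ceiling_correct[of "(f x)\<^sup>2"] by auto
    have "(f x)\<^sup>2 \<le> real m + 1"
      using c(2) unfolding m_def by linarith
    then have 1: "exp (\<rho> / 4 * (f x)\<^sup>2) \<le> exp (\<rho> / 4 * (real m + 1))"
      using \<rho> by simp
    have "x \<in> A m"
    proof (cases "m = 0")
      case False
      then have "real m = real_of_int \<lceil>(f x)\<^sup>2\<rceil> - 1" unfolding m_def by linarith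
      then have "real m < (f x)\<^sup>2" using c(1) by simp
      then have "sqrt (real m) < sqrt ((f x)\<^sup>2)" by (simp only: real_sqrt_less_iff)
      then show ?thesis using x by (simp add: A_def)
    qed (use x in \<open>simp add: A_def\<close>)
    have "ennreal (exp (\<rho> / 4 * (f x)\<^sup>2)) \<le> ennreal (exp (\<rho> / 4 * (real m + 1))) * indicator (A m) x"
      using 1 \<open>x \<in> A m\<close> by (simp add: ennreal_leI)
    also have "\<dots> = (\<Sum>i\<in>{m}. ennreal (exp (\<rho> / 4 * (real i + 1))) * indicator (A i) x)"
      by (simp only: sum.insert finite.emptyI sum.empty add_0_right not_False_eq_True empty_iff)
    also have "\<dots> \<le> (\<Sum>i. ennreal (exp (\<rho> / 4 * (real i + 1))) * indicator (A i) x)"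
      by (intro sum_le_suminf) auto
    finally show ?thesis .
  qed
  let ?q = "exp (- (\<rho> / 4))"
  have q: "0 \<le> ?q" "?q < 1" using \<rho> by auto
  have "(\<integral>\<^sup>+x. ennreal (exp (\<rho> / 4 * (f x)\<^sup>2)) \<partial>M)
      \<le> (\<integral>\<^sup>+x. (\<Sum>m. ennreal (exp (\<rho> / 4 * (real m + 1))) * indicator (A m) x) \<partial>M)"
    by (intro nn_integral_mono pt)
  also have "\<dots> = (\<Sum>m. \<integral>\<^sup>+x. ennreal (exp (\<rho> / 4 * (real m + 1))) * indicator (A m) x \<partial>M)"
    by (intro nn_integral_suminf) auto
  also have "\<dots> = (\<Sum>m. ennreal (exp (\<rho> / 4 * (real m + 1))) * emeasure M (A m))"
    by (intro suminf_cong nn_integral_cmult_indicator) auto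
  also have "\<dots> \<le> (\<Sum>m. ennreal (exp (\<rho> / 4) * ?q ^ m))"
  proof (intro suminf_le)
    fix m :: nat
    have "exp (\<rho> / 4 * (real m + 1)) * measure M (A m)
        \<le> exp (\<rho> / 4 * (real m + 1)) * exp (- (real m * \<rho> / 2))"
      by (intro mult_left_mono mA) auto
    also have "\<dots> = exp (\<rho> / 4) * ?q ^ m"
      by (simp add: exp_of_nat_mult[symmetric] exp_add[symmetric] algebra_simps)
    finally show "ennreal (exp (\<rho> / 4 * (real m + 1))) * emeasure M (A m) \<le> ennreal (exp (\<rho> / 4) * ?q ^ m)"
      by (simp add: emeasure_eq_measure ennreal_mult[symmetric] ennreal_leI)
  qed auto
  also have "\<dots> = ennreal (\<Sum>m. exp (\<rho> / 4) * ?q ^ m)"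
    by (intro suminf_ennreal2 summable_mult summable_geometric) (use q in auto)
  also have "(\<Sum>m. exp (\<rho> / 4) * ?q ^ m) = tail_const \<rho>"
    using q by (simp add: suminf_mult suminf_geometric summable_geometric tail_const_def)
  finally show ?thesis .
qed

definition mgf_const :: "real \<Rightarrow> real \<Rightarrow> real" where
  "mgf_const s K = 8 / s\<^sup>2 * (exp K * K)"

text \<open>A nonnegative variable with one exponential moment has a centred Laplace transform that
  is Gaussian near zero: the linear term of \<open>exp_le_quadratic\<close> integrates to zero, and
  the remainder is integrable because \<open>\<bar>l\<bar> \<le> s / 2\<close> keeps half of the
  exponent in reserve.\<close>

lemma centered_mgf_le:
  assumes "prob_space M" and W [measurable]: "W \<in> borel_measurable M"
    and W0: "\<And>x. 0 \<le> W x" and s: "0 < s" and K: "0 \<le> K"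
    and mom: "(\<integral>\<^sup>+x. ennreal (exp (s * W x)) \<partial>M) \<le> ennreal K"
  shows "s * (\<integral>x. W x \<partial>M) \<le> K" (is ?A)
    and "\<And>l. \<bar>l\<bar> \<le> s / 2 \<Longrightarrow>
      (\<integral>\<^sup>+x. ennreal (exp (l * (W x - (\<integral>x. W x \<partial>M)))) \<partial>M) \<le> ennreal (exp (mgf_const s K * l\<^sup>2))"
proof -
  interpret prob_space M by fact
  define \<sigma> where "\<sigma> = (\<integral>x. W x \<partial>M)"
  have iE: "integrable M (\<lambda>x. exp (s * W x))"
    by (rule integrableI_nonneg) (use mom in \<open>auto intro: le_less_trans\<close>)
  have eE: "(\<integral>x. exp (s * W x) \<partial>M) \<le> K"
  proof -
    have "ennreal (\<integral>x. exp (s * W x) \<partial>M) \<le> ennreal K"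
      using mom by (subst nn_integral_eq_integral[OF iE, symmetric]) auto
    then show ?thesis using K by simp
  qed
  have sW: "s * W x \<le> exp (s * W x)" for x
    using exp_ge_add_one_self[of "s * W x"] by linarith
  have iW: "integrable M (\<lambda>x. s * W x)"
    by (rule Bochner_Integration.integrable_bound[OF iE])
      (use sW W0 s in \<open>auto simp: abs_mult\<close>)
  then have iW': "integrable M W" using s by simp
  have "s * \<sigma> = (\<integral>x. s * W x \<partial>M)" by (simp add: \<sigma>_def)
  also have "\<dots> \<le> (\<integral>x. exp (s * W x) \<partial>M)"
    by (intro integral_mono iW iE sW)
  finally have s\<sigma>: "s * \<sigma> \<le> K" using eE by simp
  then show ?A by (simp add: \<sigma>_def)
  have \<sigma>0: "0 \<le> \<sigma>" unfolding \<sigma>_def using W0 by (simp add: integral_nonneg_AE)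
  fix l :: real assume l: "\<bar>l\<bar> \<le> s / 2"
  let ?c = "8 / s\<^sup>2 * exp K * l\<^sup>2"
  have pt: "exp (l * (W x - \<sigma>)) \<le> 1 + l * (W x - \<sigma>) + ?c * exp (s * W x)" for x
  proof -
    \<comment> \<open>With \<open>u\<close> built from \<open>s / 2\<close>, the bound
      \<open>u\<^sup>2 \<le> 2 * exp u\<close> turns the remainder into \<open>exp (2 * u)\<close>,
      which is \<open>exp (s * \<bar>W x - \<sigma>\<bar>)\<close>.\<close>
    define u where "u = s / 2 * \<bar>W x - \<sigma>\<bar>"
    have u: "0 \<le> u" using s by (simp add: u_def)
    have au: "\<bar>l * (W x - \<sigma>)\<bar> \<le> u"
      unfolding u_def abs_mult using l by (intro mult_right_mono) auto
    have "u\<^sup>2 * exp u \<le> 2 * exp u * exp u"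
      using sq_le_2_exp[OF u] by (intro mult_right_mono) auto
    also have "\<dots> = 2 * exp (s * \<bar>W x - \<sigma>\<bar>)"
      by (simp add: u_def mult_exp_exp)
    also have "\<dots> \<le> 2 * (exp K * exp (s * W x))"
    proof -
      \<comment> \<open>Centring costs only the factor \<open>exp K\<close>, by
        \<open>s * \<sigma> \<le> K\<close>.\<close>
      have "\<bar>W x - \<sigma>\<bar> \<le> \<sigma> + W x" using W0[of x] \<sigma>0 by linarith
      then have "s * \<bar>W x - \<sigma>\<bar> \<le> s * (\<sigma> + W x)" using s by (intro mult_left_mono) auto
      also have "\<dots> \<le> K + s * W x" using s\<sigma> by (simp add: algebra_simps)
      finally have "exp (s * \<bar>W x - \<sigma>\<bar>) \<le> exp (K + s * W x)" by simp
      then show ?thesis by (simp add: exp_add)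
    qed
    finally have ue: "u\<^sup>2 * exp u \<le> 2 * (exp K * exp (s * W x))" .
    have "(l * (W x - \<sigma>))\<^sup>2 * exp \<bar>l * (W x - \<sigma>)\<bar> \<le> (l * (W x - \<sigma>))\<^sup>2 * exp u"
      using au by (intro mult_left_mono) auto
    also have "(l * (W x - \<sigma>))\<^sup>2 = 4 * l\<^sup>2 / s\<^sup>2 * u\<^sup>2"
      using s by (simp add: u_def power_mult_distrib power_divide)
    also have "4 * l\<^sup>2 / s\<^sup>2 * u\<^sup>2 * exp u \<le> 4 * l\<^sup>2 / s\<^sup>2 * (2 * (exp K * exp (s * W x)))"
      unfolding mult.assoc[of _ "u\<^sup>2"] by (intro mult_left_mono ue) auto
    also have "\<dots> = ?c * exp (s * W x)" by simp
    finally have "(l * (W x - \<sigma>))\<^sup>2 * exp \<bar>l * (W x - \<sigma>)\<bar> \<le> ?c * exp (s * W x)"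
      by (simp only: \<open>(l * (W x - \<sigma>))\<^sup>2 = 4 * l\<^sup>2 / s\<^sup>2 * u\<^sup>2\<close>)
    then show ?thesis using exp_le_quadratic[of "l * (W x - \<sigma>)"] by linarith
  qed
  have iR: "integrable M (\<lambda>x. 1 + l * (W x - \<sigma>) + ?c * exp (s * W x))"
    using iW' iE by auto
  have "(\<integral>\<^sup>+x. ennreal (exp (l * (W x - \<sigma>))) \<partial>M)
      \<le> (\<integral>\<^sup>+x. ennreal (1 + l * (W x - \<sigma>) + ?c * exp (s * W x)) \<partial>M)"
    by (intro nn_integral_mono ennreal_leI pt)
  also have "\<dots> = ennreal (\<integral>x. 1 + l * (W x - \<sigma>) + ?c * exp (s * W x) \<partial>M)"
    by (intro nn_integral_eq_integral iR AE_I2) (meson pt exp_ge_zero order_trans)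
  also have "(\<integral>x. 1 + l * (W x - \<sigma>) + ?c * exp (s * W x) \<partial>M) = 1 + ?c * (\<integral>x. exp (s * W x) \<partial>M)"
    using iW' iE by (simp add: \<sigma>_def prob_space)
  also have "\<dots> \<le> 1 + ?c * K"
    by (intro add_left_mono mult_left_mono eE) auto
  also have "\<dots> = 1 + mgf_const s K * l\<^sup>2" by (simp add: mgf_const_def)
  also have "\<dots> \<le> exp (mgf_const s K * l\<^sup>2)" by (rule exp_ge_add_one_self)
  finally show "(\<integral>\<^sup>+x. ennreal (exp (l * (W x - (\<integral>x. W x \<partial>M)))) \<partial>M) \<le> ennreal (exp (mgf_const s K * l\<^sup>2))"
    by (simp add: \<sigma>_def ennreal_leI)
qed

section \<open>Independent pairs and a maximal inequality\<close>

lemma nn_integral_prod_pairs: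
  assumes "prob_space P" and f [measurable]: "case_prod f \<in> borel_measurable (P \<Otimes>\<^sub>M P)"
    and n: "2 * m \<le> n"
  shows "(\<integral>\<^sup>+X. (\<Prod>l<m. f (X (2 * l)) (X (2 * l + 1))) \<partial>PiM {..<n} (\<lambda>_. P))
    = (\<integral>\<^sup>+x. \<integral>\<^sup>+y. f x y \<partial>P \<partial>P) ^ m"
  \<comment> \<open>Strong induction, because a step peels off either one coordinate beyond the last
    pair, whose integral is one, or the last pair itself.\<close>
  using n
proof (induction n arbitrary: m rule: less_induct)
  case (less n)
  interpret P: prob_space P by fact
  interpret product_sigma_finite "\<lambda>_. P" by standard
  have meas: "(\<lambda>X. \<Prod>l<m. f (X (2 * l)) (X (2 * l + 1))) \<in> borel_measurable (PiM {..<n} (\<lambda>_. P))"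
    if "2 * m \<le> n" for m n :: nat
  proof (intro borel_measurable_prod_ennreal)
    fix l assume "l \<in> {..<m}"
    then have "2 * l \<in> {..<n}" "2 * l + 1 \<in> {..<n}" using that by auto
    then have "(\<lambda>X. (X (2 * l), X (2 * l + 1))) \<in> PiM {..<n} (\<lambda>_. P) \<rightarrow>\<^sub>M P \<Otimes>\<^sub>M P"
      by (intro measurable_Pair measurable_component_singleton)
    from measurable_compose[OF this f]
    show "(\<lambda>X. f (X (2 * l)) (X (2 * l + 1))) \<in> borel_measurable (PiM {..<n} (\<lambda>_. P))" by simp
  qed
  have pp: "prob_space (PiM {..<k} (\<lambda>_. P))" for k :: nat
    by (intro prob_space_PiM P.prob_space_axioms)
  show ?case
  proof (cases "2 * m < n")
    case True
    then obtain n' where n': "n = Suc n'" "2 * m \<le> n'" by (cases n) auto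
    have eq: "{..<n} = insert n' {..<n'}" using n' by auto
    have "(\<integral>\<^sup>+X. (\<Prod>l<m. f (X (2 * l)) (X (2 * l + 1))) \<partial>PiM {..<n} (\<lambda>_. P))
      = (\<integral>\<^sup>+X. \<integral>\<^sup>+y. (\<Prod>l<m. f ((X(n' := y)) (2 * l)) ((X(n' := y)) (2 * l + 1))) \<partial>P \<partial>PiM {..<n'} (\<lambda>_. P))"
      unfolding eq by (intro product_nn_integral_insert) (use meas[of m n] less.prems eq in auto)
    also have "\<dots> = (\<integral>\<^sup>+X. \<integral>\<^sup>+y. (\<Prod>l<m. f (X (2 * l)) (X (2 * l + 1))) \<partial>P \<partial>PiM {..<n'} (\<lambda>_. P))"
      by (intro nn_integral_cong prod.cong refl) (use n' in auto)
    also have "\<dots> = (\<integral>\<^sup>+X. (\<Prod>l<m. f (X (2 * l)) (X (2 * l + 1))) \<partial>PiM {..<n'} (\<lambda>_. P))"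
      by (simp add: P.emeasure_space_1)
    also have "\<dots> = (\<integral>\<^sup>+x. \<integral>\<^sup>+y. f x y \<partial>P \<partial>P) ^ m"
      by (rule less.IH) (use n' in auto)
    finally show ?thesis .
  next
    case False
    then have n: "n = 2 * m" using less.prems by simp
    show ?thesis
    proof (cases m)
      case 0
      then show ?thesis using prob_space.emeasure_space_1[OF pp[of n]] by simp
    next
      case (Suc m')
      let ?c = "\<integral>\<^sup>+x. \<integral>\<^sup>+y. f x y \<partial>P \<partial>P"
      have eq: "{..<n} = insert (2 * m' + 1) (insert (2 * m') {..<2 * m'})" using n Suc by auto
      have eq': "insert (2 * m') {..<2 * m'} = {..<2 * m' + 1}" by auto
      let ?F = "\<lambda>X. \<Prod>l<m. f (X (2 * l)) (X (2 * l + 1))"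
      have mF: "?F \<in> borel_measurable (PiM (insert (2 * m' + 1) {..<2 * m' + 1}) (\<lambda>_. P))"
        using meas[of m n] n unfolding eq eq' by simp
      have mG: "(\<lambda>X. \<integral>\<^sup>+y. ?F (X(2 * m' + 1 := y)) \<partial>P) \<in> borel_measurable (PiM {..<2 * m' + 1} (\<lambda>_. P))"
      proof -
        have [measurable]: "?F \<in> borel_measurable (PiM (insert (2 * m' + 1) {..<2 * m' + 1}) (\<lambda>_. P))"
          by (rule mF)
        show ?thesis
        proof (rule P.borel_measurable_nn_integral)
          have "(\<lambda>(X, y). X(2 * m' + 1 := y)) \<in> PiM {..<2 * m' + 1} (\<lambda>_. P) \<Otimes>\<^sub>M P \<rightarrow>\<^sub>M PiM (insert (2 * m' + 1) {..<2 * m' + 1}) (\<lambda>_. P)"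
            by (rule measurable_add_dim)
          from measurable_compose[OF this mF]
          show "(\<lambda>(X, y). ?F (X(2 * m' + 1 := y))) \<in> borel_measurable (PiM {..<2 * m' + 1} (\<lambda>_. P) \<Otimes>\<^sub>M P)"
            by (simp add: case_prod_beta)
        qed
      qed
      have "(\<integral>\<^sup>+X. ?F X \<partial>PiM {..<n} (\<lambda>_. P))
        = (\<integral>\<^sup>+X. \<integral>\<^sup>+y. ?F (X(2 * m' + 1 := y)) \<partial>P \<partial>PiM {..<2 * m' + 1} (\<lambda>_. P))"
        unfolding eq eq' by (intro product_nn_integral_insert mF) auto
      also have "\<dots> = (\<integral>\<^sup>+X. \<integral>\<^sup>+x. \<integral>\<^sup>+y. ?F (X(2 * m' := x, 2 * m' + 1 := y)) \<partial>P \<partial>P \<partial>PiM {..<2 * m'} (\<lambda>_. P))"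
        unfolding eq'[symmetric] by (intro product_nn_integral_insert) (use mG eq' in auto)
      also have "\<dots> = (\<integral>\<^sup>+X. \<integral>\<^sup>+x. \<integral>\<^sup>+y. (\<Prod>l<m'. f (X (2 * l)) (X (2 * l + 1))) * f x y \<partial>P \<partial>P \<partial>PiM {..<2 * m'} (\<lambda>_. P))"
        unfolding Suc prod.lessThan_Suc
        by (intro nn_integral_cong arg_cong2[of _ _ _ _ "(*)"] prod.cong refl) auto
      also have "\<dots> = (\<integral>\<^sup>+X. (\<Prod>l<m'. f (X (2 * l)) (X (2 * l + 1))) * ?c \<partial>PiM {..<2 * m'} (\<lambda>_. P))"
      proof (intro nn_integral_cong)
        fix X
        let ?p = "\<Prod>l<m'. f (X (2 * l)) (X (2 * l + 1))"
        have "(\<integral>\<^sup>+x. \<integral>\<^sup>+y. ?p * f x y \<partial>P \<partial>P) = (\<integral>\<^sup>+x. ?p * (\<integral>\<^sup>+y. f x y \<partial>P) \<partial>P)"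
        proof (rule nn_integral_cong)
          fix x assume "x \<in> space P"
          from measurable_compose[OF measurable_Pair1'[OF this] f]
          have "f x \<in> borel_measurable P" by simp
          then show "(\<integral>\<^sup>+y. ?p * f x y \<partial>P) = ?p * (\<integral>\<^sup>+y. f x y \<partial>P)"
            by (rule nn_integral_cmult)
        qed
        also have "\<dots> = ?p * ?c"
          by (intro nn_integral_cmult P.borel_measurable_nn_integral f)
        finally show "(\<integral>\<^sup>+x. \<integral>\<^sup>+y. ?p * f x y \<partial>P \<partial>P) = ?p * ?c" .
      qed
      also have "\<dots> = (\<integral>\<^sup>+X. (\<Prod>l<m'. f (X (2 * l)) (X (2 * l + 1))) \<partial>PiM {..<2 * m'} (\<lambda>_. P)) * ?c"
        by (intro nn_integral_multc meas) auto
      also have "\<dots> = ?c ^ m' * ?c"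
        by (subst less.IH) (use n Suc in auto)
      finally show ?thesis using Suc by (simp add: mult.commute)
    qed
  qed
qed

text \<open>A union bound carried out on moments. With \<open>\<eta>\<close> the maximum of the
  \<open>\<bar>D z x\<bar>\<close>, its square is at most \<open>2 * t\<^sup>2\<close> plus a
  multiple of \<open>exp (s * (\<eta> - t))\<close>, hence plus a sum over \<open>Z\<close> of
  exponentials with known integrals. The loss \<open>F\<close> enters only by pointwise comparison
  with this majorant.\<close>

lemma maximal_second_moment:
  assumes Z: "finite Z" and D [measurable]: "\<And>z. z \<in> Z \<Longrightarrow> D z \<in> borel_measurable M"
    and M: "prob_space M"
    and s: "0 < s" and cardZ: "real (card Z) \<le> exp L" and LV: "0 \<le> L + V"
    and up: "\<And>z. z \<in> Z \<Longrightarrow> (\<integral>\<^sup>+x. ennreal (exp (s * D z x)) \<partial>M) \<le> ennreal (exp V)"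
    and lo: "\<And>z. z \<in> Z \<Longrightarrow> (\<integral>\<^sup>+x. ennreal (exp (- (s * D z x))) \<partial>M) \<le> ennreal (exp V)"
    and F: "\<And>x \<eta>. x \<in> space M \<Longrightarrow> 0 \<le> \<eta> \<Longrightarrow> (\<And>z. z \<in> Z \<Longrightarrow> \<bar>D z x\<bar> \<le> \<eta>) \<Longrightarrow> F x \<le> a + b * \<eta>\<^sup>2"
    and a: "0 \<le> a" and b: "0 \<le> b"
  shows "(\<integral>\<^sup>+x. ennreal (F x) \<partial>M) \<le> ennreal (a + b * (2 * ((L + V) / s)\<^sup>2 + 8 / s\<^sup>2))"
proof -
  interpret prob_space M by fact
  \<comment> \<open>At this threshold \<open>exp (- (s * t))\<close> cancels both the cardinality
    bound \<open>exp L\<close> and the moment bound \<open>exp V\<close>.\<close>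
  define t where "t = (L + V) / s"
  have t: "0 \<le> t" "s * t = L + V" using s LV by (auto simp: t_def)
  define h where "h z x = exp (s * D z x) + exp (- (s * D z x))" for z x
  have h0: "0 \<le> h z x" for z x by (simp add: h_def)
  let ?c = "4 / s\<^sup>2 * exp (- (s * t))"
  have pt: "F x \<le> a + b * (2 * t\<^sup>2) + (\<Sum>z\<in>Z. b * ?c * h z x)" if x: "x \<in> space M" for x
  proof -
    \<comment> \<open>Inserting 0 keeps the maximum meaningful when \<open>Z\<close> is
      empty.\<close>
    define \<eta> where "\<eta> = Max (insert 0 ((\<lambda>z. \<bar>D z x\<bar>) ` Z))"
    have fin: "finite (insert 0 ((\<lambda>z. \<bar>D z x\<bar>) ` Z))" using Z by simp
    have \<eta>0: "0 \<le> \<eta>" unfolding \<eta>_def using fin by (intro Max_ge) auto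
    have D\<eta>: "\<bar>D z x\<bar> \<le> \<eta>" if "z \<in> Z" for z unfolding \<eta>_def using fin that by (intro Max_ge) auto
    have "\<eta> \<in> insert 0 ((\<lambda>z. \<bar>D z x\<bar>) ` Z)" unfolding \<eta>_def by (rule Max_in[OF fin]) auto
    then consider "\<eta> = 0" | z where "z \<in> Z" "\<eta> = \<bar>D z x\<bar>" by auto
    then have "\<eta>\<^sup>2 \<le> 2 * t\<^sup>2 + ?c * (\<Sum>z\<in>Z. h z x)"
    proof cases
      case 1
      have "0 \<le> 2 * t\<^sup>2 + ?c * (\<Sum>z\<in>Z. h z x)"
        using h0 by (intro add_nonneg_nonneg mult_nonneg_nonneg sum_nonneg) auto
      then show ?thesis using 1 by simp
    next
      case 2
      have "\<eta>\<^sup>2 \<le> 2 * t\<^sup>2 + 4 / s\<^sup>2 * exp (s * (\<eta> - t))"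
      proof (cases "\<eta> \<le> t")
        case True
        then have "\<eta>\<^sup>2 \<le> t\<^sup>2" using \<eta>0 by (intro power_mono)
        moreover have "0 \<le> t\<^sup>2" "0 \<le> 4 / s\<^sup>2 * exp (s * (\<eta> - t))" by auto
        ultimately show ?thesis by linarith
      next
        case False
        have "\<eta>\<^sup>2 \<le> 2 * t\<^sup>2 + 2 * (\<eta> - t)\<^sup>2"
          using sum_squares_bound[of \<eta> "2 * t"] by (simp add: power2_eq_square algebra_simps)
        moreover have "(s * (\<eta> - t))\<^sup>2 \<le> 2 * exp (s * (\<eta> - t))"
          using False s by (intro sq_le_2_exp) auto
        then have "(\<eta> - t)\<^sup>2 \<le> 2 / s\<^sup>2 * exp (s * (\<eta> - t))"
          using s unfolding power_mult_distrib by (simp add: pos_le_divide_eq mult.commute)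
        ultimately show ?thesis by simp
      qed
      also have "exp (s * (\<eta> - t)) = exp (- (s * t)) * exp (s * \<eta>)"
        by (simp add: algebra_simps flip: exp_add)
      also have "exp (s * \<eta>) \<le> h z x"
      proof (cases "0 \<le> D z x")
        case True then show ?thesis using 2 by (simp add: h_def)
      next
        case False then show ?thesis using 2 by (simp add: h_def)
      qed
      also have "h z x \<le> (\<Sum>z\<in>Z. h z x)" using Z 2 h0 by (intro member_le_sum) auto
      finally show ?thesis
        by (simp add: mult_left_mono divide_right_mono)
    qed
    then have b\<eta>: "b * \<eta>\<^sup>2 \<le> b * (2 * t\<^sup>2 + ?c * (\<Sum>z\<in>Z. h z x))" using b by (intro mult_left_mono)
    have "b * (2 * t\<^sup>2 + ?c * (\<Sum>z\<in>Z. h z x)) = b * (2 * t\<^sup>2) + (\<Sum>z\<in>Z. b * ?c * h z x)"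
      unfolding distrib_left mult.assoc[of b, symmetric] sum_distrib_left ..
    then show ?thesis using F[OF x \<eta>0 D\<eta>] b\<eta> by linarith
  qed
  have hI: "(\<integral>\<^sup>+x. ennreal (h z x) \<partial>M) \<le> ennreal (2 * exp V)" if z: "z \<in> Z" for z
  proof -
    have "(\<integral>\<^sup>+x. ennreal (h z x) \<partial>M)
      = (\<integral>\<^sup>+x. ennreal (exp (s * D z x)) \<partial>M) + (\<integral>\<^sup>+x. ennreal (exp (- (s * D z x))) \<partial>M)"
      unfolding h_def using D[OF z] by (simp add: nn_integral_add)
    also have "\<dots> \<le> ennreal (exp V) + ennreal (exp V)"
      by (intro add_mono up lo z)
    finally show ?thesis by (simp flip: ennreal_plus)
  qed
  have "(\<integral>\<^sup>+x. ennreal (F x) \<partial>M)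
    \<le> (\<integral>\<^sup>+x. ennreal (a + b * (2 * t\<^sup>2)) + (\<Sum>z\<in>Z. ennreal (b * ?c) * ennreal (h z x)) \<partial>M)"
  proof (intro nn_integral_mono)
    fix x assume "x \<in> space M"
    from pt[OF this] have "ennreal (F x) \<le> ennreal (a + b * (2 * t\<^sup>2) + (\<Sum>z\<in>Z. b * ?c * h z x))"
      by (rule ennreal_leI)
    also have "\<dots> = ennreal (a + b * (2 * t\<^sup>2)) + (\<Sum>z\<in>Z. ennreal (b * ?c * h z x))"
      using a b h0 by (simp add: ennreal_plus sum_nonneg sum_ennreal)
    also have "\<dots> = ennreal (a + b * (2 * t\<^sup>2)) + (\<Sum>z\<in>Z. ennreal (b * ?c) * ennreal (h z x))"
      using b h0 by (intro arg_cong2[of _ _ _ _ "(+)"] sum.cong refl ennreal_mult) auto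
    finally show "ennreal (F x) \<le> \<dots>" .
  qed
  also have "\<dots> = ennreal (a + b * (2 * t\<^sup>2)) + (\<Sum>z\<in>Z. ennreal (b * ?c) * (\<integral>\<^sup>+x. ennreal (h z x) \<partial>M))"
  proof -
    have [measurable]: "h z \<in> borel_measurable M" if "z \<in> Z" for z
      unfolding h_def using D[OF that] by measurable
    show ?thesis
      by (subst nn_integral_add) (auto simp: nn_integral_sum nn_integral_cmult emeasure_space_1)
  qed
  also have "\<dots> \<le> ennreal (a + b * (2 * t\<^sup>2)) + (\<Sum>z\<in>Z. ennreal (b * ?c) * ennreal (2 * exp V))"
    by (intro add_left_mono sum_mono mult_left_mono hI) auto
  also have "\<dots> = ennreal (a + b * (2 * t\<^sup>2) + real (card Z) * (b * ?c * (2 * exp V)))"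
    using a b by (simp add: ennreal_mult[symmetric] ennreal_of_nat_eq_real_of_nat flip: ennreal_plus)
  also have "\<dots> \<le> ennreal (a + b * (2 * t\<^sup>2 + 8 / s\<^sup>2))"
  proof (rule ennreal_leI)
    have "real (card Z) * (b * ?c * (2 * exp V)) \<le> exp L * (b * ?c * (2 * exp V))"
      using b by (intro mult_right_mono cardZ) auto
    also have "\<dots> = b * (8 / s\<^sup>2) * (exp L * exp V * exp (- (L + V)))"
      by (simp add: t(2))
    also have "exp L * exp V * exp (- (L + V)) = 1"
      by (simp flip: exp_add)
    finally show "a + b * (2 * t\<^sup>2) + real (card Z) * (b * ?c * (2 * exp V)) \<le> a + b * (2 * t\<^sup>2 + 8 / s\<^sup>2)"
      by (simp add: algebra_simps)
  qed
  finally show ?thesis by (simp add: t_def)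
qed

section \<open>The block-banded estimator\<close>

locale square_integrable_law =
  fixes p :: nat and P :: "(nat \<Rightarrow> real) measure"
  assumes sq: "square_integrable_dist p P"
begin

sublocale prob_space P
  using sq by (simp add: square_integrable_dist_def)

lemma sets_P [measurable_cong]: "sets P = sets (PiM {..<p} (\<lambda>_. borel))"
  using sq by (simp add: square_integrable_dist_def euclid_space_def)

lemma measurable_coord: "i < p \<Longrightarrow> (\<lambda>x. x i) \<in> borel_measurable P"
  by (subst measurable_cong_sets[OF sets_P refl]) simp

lemma integrable_coord_sq: "i < p \<Longrightarrow> integrable P (\<lambda>x. (x i)\<^sup>2)"
  using sq by (simp add: square_integrable_dist_def)

lemma integrable_coord: "i < p \<Longrightarrow> integrable P (\<lambda>x. x i)"
  by (rule square_integrable_imp_integrable[OF measurable_coord integrable_coord_sq])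

definition mu :: "nat \<Rightarrow> real" where
  "mu i = (\<integral>x. x i \<partial>P)"

definition sig :: "nat \<Rightarrow> nat \<Rightarrow> real" where
  "sig i j = (\<integral>x. (x i - mu i) * (x j - mu j) \<partial>P)"

lemma cov_mat_index: "i < p \<Longrightarrow> j < p \<Longrightarrow> cov_mat p P $$ (i, j) = sig i j"
  by (simp add: cov_mat_def sig_def mu_def)

lemma cov_mat_carrier: "cov_mat p P \<in> carrier_mat p p"
  by (simp add: cov_mat_def)

lemma sig_commute: "sig i j = sig j i"
  by (simp add: sig_def mult.commute)

lemma integrable_centered_sq: "i < p \<Longrightarrow> integrable P (\<lambda>x. (x i - mu i)\<^sup>2)"
  by (simp add: power2_diff integrable_coord integrable_coord_sq)

lemma integrable_centered_prod:
  assumes "i < p" "j < p"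
  shows "integrable P (\<lambda>x. (x i - mu i) * (x j - mu j))"
proof (rule Bochner_Integration.integrable_bound)
  show "integrable P (\<lambda>x. (x i - mu i)\<^sup>2 + (x j - mu j)\<^sup>2)"
    using assms by (intro Bochner_Integration.integrable_add integrable_centered_sq)
  show "(\<lambda>x. (x i - mu i) * (x j - mu j)) \<in> borel_measurable P"
    using assms by (intro borel_measurable_times borel_measurable_diff measurable_coord) auto
  show "AE x in P. norm ((x i - mu i) * (x j - mu j)) \<le> norm ((x i - mu i)\<^sup>2 + (x j - mu j)\<^sup>2)"
  proof (rule AE_I2)
    fix x
    have "2 * (\<bar>x i - mu i\<bar> * \<bar>x j - mu j\<bar>) \<le> (x i - mu i)\<^sup>2 + (x j - mu j)\<^sup>2"
      using sum_squares_bound[of "\<bar>x i - mu i\<bar>" "\<bar>x j - mu j\<bar>"] by simp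
    moreover have "0 \<le> \<bar>x i - mu i\<bar> * \<bar>x j - mu j\<bar>" by simp
    ultimately have "\<bar>x i - mu i\<bar> * \<bar>x j - mu j\<bar> \<le> (x i - mu i)\<^sup>2 + (x j - mu j)\<^sup>2"
      by linarith
    then show "norm ((x i - mu i) * (x j - mu j)) \<le> norm ((x i - mu i)\<^sup>2 + (x j - mu j)\<^sup>2)"
      by (simp add: abs_mult)
  qed
qed

definition lin :: "(nat \<Rightarrow> real) \<Rightarrow> (nat \<Rightarrow> real) \<Rightarrow> real" where
  "lin v x = (\<Sum>i<p. v i * (x i - mu i))"

lemma measurable_lin [measurable]: "lin v \<in> borel_measurable P"
  unfolding lin_def
  by (intro borel_measurable_sum borel_measurable_times borel_measurable_diff measurable_coord) auto

lemma integrable_lin: "integrable P (lin v)" and integral_lin: "(\<integral>x. lin v x \<partial>P) = 0"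
proof -
  show "integrable P (lin v)"
    unfolding lin_def
    by (intro Bochner_Integration.integrable_sum integrable_mult_right Bochner_Integration.integrable_diff integrable_coord)
      auto
  have "(\<integral>x. lin v x \<partial>P) = (\<Sum>i<p. v i * (\<integral>x. x i - mu i \<partial>P))"
    unfolding lin_def by (subst Bochner_Integration.integral_sum) (auto intro: integrable_coord)
  also have "\<dots> = 0"
    by (intro sum.neutral ballI) (simp add: integrable_coord prob_space mu_def)
  finally show "(\<integral>x. lin v x \<partial>P) = 0" .
qed

lemma lin_sq: "(lin v x)\<^sup>2 = (\<Sum>i<p. \<Sum>j<p. v i * v j * ((x i - mu i) * (x j - mu j)))"
  unfolding lin_def power2_eq_square sum_product by (intro sum.cong refl) (simp add: mult_ac)

lemma integrable_lin_sq: "integrable P (\<lambda>x. (lin v x)\<^sup>2)"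
  unfolding lin_sq by (intro Bochner_Integration.integrable_sum integrable_mult_right integrable_centered_prod) auto

lemma integral_lin_sq: "(\<integral>x. (lin v x)\<^sup>2 \<partial>P) = bil p sig v v"
  unfolding lin_sq bil_def sig_def
  by (subst Bochner_Integration.integral_sum)
    (auto simp: integrable_centered_prod mult_ac intro!: sum.cong)

text \<open>Half the squared difference of two independent copies: the mean drops out, and the
  expectation is the quadratic form of the covariance.\<close>

definition W :: "(nat \<Rightarrow> real) \<Rightarrow> (nat \<Rightarrow> real) \<times> (nat \<Rightarrow> real) \<Rightarrow> real" where
  "W v z = (lin v (fst z) - lin v (snd z))\<^sup>2 / 2"

lemma measurable_W [measurable]: "W v \<in> borel_measurable (P \<Otimes>\<^sub>M P)"
  unfolding W_def by measurable

lemma W_nonneg: "0 \<le> W v z" by (simp add: W_def)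

lemma prob_space_pair: "prob_space (P \<Otimes>\<^sub>M P)"
  by (intro prob_space_pair prob_space_axioms)

lemma bil_sig_nonneg: "0 \<le> bil p sig v v"
  by (simp flip: integral_lin_sq)

lemma integral_W: "(\<integral>z. W v z \<partial>(P \<Otimes>\<^sub>M P)) = bil p sig v v"
proof -
  interpret PP: pair_prob_space P P by standard
  have "(\<integral>\<^sup>+z. ennreal (W v z) \<partial>(P \<Otimes>\<^sub>M P)) = (\<integral>\<^sup>+x. \<integral>\<^sup>+y. ennreal (W v (x, y)) \<partial>P \<partial>P)"
    by (subst nn_integral_fst[symmetric]) auto
  also have "\<dots> = (\<integral>\<^sup>+x. ennreal ((lin v x)\<^sup>2 / 2 + bil p sig v v / 2) \<partial>P)"
  proof (rule nn_integral_cong)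
    fix x
    have eq: "W v (x, y) = (lin v x)\<^sup>2 / 2 - lin v x * lin v y + (lin v y)\<^sup>2 / 2" for y
      by (simp add: W_def power2_diff field_simps)
    have i: "integrable P (\<lambda>y. W v (x, y))"
      unfolding eq using integrable_lin integrable_lin_sq by auto
    have "(\<integral>\<^sup>+y. ennreal (W v (x, y)) \<partial>P) = ennreal (\<integral>y. W v (x, y) \<partial>P)"
      by (rule nn_integral_eq_integral[OF i]) (simp add: W_nonneg)
    also have "(\<integral>y. W v (x, y) \<partial>P) = (lin v x)\<^sup>2 / 2 + bil p sig v v / 2"
      unfolding eq using integrable_lin integrable_lin_sq
      by (simp add: integral_lin integral_lin_sq prob_space)
    finally show "(\<integral>\<^sup>+y. ennreal (W v (x, y)) \<partial>P) = \<dots>" .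
  qed
  also have "\<dots> = ennreal (\<integral>x. (lin v x)\<^sup>2 / 2 + bil p sig v v / 2 \<partial>P)"
    by (rule nn_integral_eq_integral) (use integrable_lin_sq bil_sig_nonneg in auto)
  also have "(\<integral>x. (lin v x)\<^sup>2 / 2 + bil p sig v v / 2 \<partial>P) = bil p sig v v"
    using integrable_lin_sq by (simp add: integral_lin_sq prob_space)
  finally show ?thesis
    by (subst integral_eq_nn_integral) (auto simp: W_nonneg bil_sig_nonneg)
qed

lemma sub_gaussian_tail:
  assumes sg: "sub_gaussian p \<rho> P" and v: "sqn p v = 1" and t: "0 < t"
  shows "measure P {x \<in> space P. \<bar>lin v x\<bar> > t} \<le> exp (- (t\<^sup>2 * \<rho> / 2))"
proof -
  let ?v = "Matrix.vec p v"
  have v': "?v \<in> carrier_vec p" "l2_norm ?v = 1"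
    using v by (auto simp: l2_norm_eq_1_iff[of _ p] sqn_def)
  have "scalar_prod ?v (Matrix.vec p x - mean_vec p P) = lin v x" for x
    by (auto simp: scalar_prod_def lin_def mean_vec_def mu_def atLeast0LessThan intro!: sum.cong)
  with sg t v' show ?thesis unfolding sub_gaussian_def by fastforce
qed

text \<open>The class controls tails in unit directions only. A shorter nonzero vector is stretched
  to length one, which can only increase the square.\<close>

lemma lin_moment:
  assumes sg: "sub_gaussian p \<rho> P" and \<rho>: "0 < \<rho>" and v: "sqn p v \<le> 1"
  shows "(\<integral>\<^sup>+x. ennreal (exp (\<rho> / 4 * (lin v x)\<^sup>2)) \<partial>P) \<le> ennreal (tail_const \<rho>)"
proof (cases "sqn p v = 0")
  case True
  then have "\<forall>i\<in>{..<p}. (v i)\<^sup>2 = 0"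
    unfolding sqn_def by (subst (asm) sum_nonneg_eq_0_iff) auto
  then have "lin v x = 0" for x unfolding lin_def by (auto intro!: sum.neutral)
  then show ?thesis using tail_const_ge_1[OF \<rho>] by (simp add: emeasure_space_1 ennreal_leI)
next
  case False
  then have pos: "sqn p v > 0" using sqn_nonneg[of p v] by linarith
  define u where "u = (\<lambda>i. 1 / sqrt (sqn p v) * v i)"
  have c2: "(1 / sqrt (sqn p v))\<^sup>2 = 1 / sqn p v" using pos by (simp add: power_divide)
  have u1: "sqn p u = 1" unfolding u_def sqn_scale c2 using pos by simp
  have "(lin v x)\<^sup>2 \<le> (lin u x)\<^sup>2" for x
  proof -
    have "lin u x = 1 / sqrt (sqn p v) * lin v x"
      unfolding lin_def u_def sum_distrib_left by (intro sum.cong refl) simp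
    then have "(lin u x)\<^sup>2 = 1 / sqn p v * (lin v x)\<^sup>2" by (simp only: power_mult_distrib c2)
    moreover have "1 * (lin v x)\<^sup>2 \<le> 1 / sqn p v * (lin v x)\<^sup>2"
      using pos v by (intro mult_right_mono) auto
    ultimately show ?thesis by simp
  qed
  then have "(\<integral>\<^sup>+x. ennreal (exp (\<rho> / 4 * (lin v x)\<^sup>2)) \<partial>P) \<le> (\<integral>\<^sup>+x. ennreal (exp (\<rho> / 4 * (lin u x)\<^sup>2)) \<partial>P)"
    using \<rho> by (intro nn_integral_mono ennreal_leI) (simp add: mult_left_mono)
  also have "\<dots> \<le> ennreal (tail_const \<rho>)"
    by (rule nn_integral_exp_sq_le) (use prob_space_axioms \<rho> sub_gaussian_tail[OF sg u1] in auto)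
  finally show ?thesis .
qed

text \<open>\<open>(a - b)\<^sup>2 / 2 \<le> a\<^sup>2 + b\<^sup>2\<close> splits the exponent, and
  each of the two independent copies contributes one moment.\<close>

lemma W_moment:
  assumes sg: "sub_gaussian p \<rho> P" and \<rho>: "0 < \<rho>" and v: "sqn p v \<le> 1"
  shows "(\<integral>\<^sup>+z. ennreal (exp (\<rho> / 4 * W v z)) \<partial>(P \<Otimes>\<^sub>M P)) \<le> ennreal ((tail_const \<rho>)\<^sup>2)"
proof -
  interpret PP: pair_prob_space P P by standard
  let ?e = "\<lambda>x. ennreal (exp (\<rho> / 4 * (lin v x)\<^sup>2))"
  have "(\<integral>\<^sup>+z. ennreal (exp (\<rho> / 4 * W v z)) \<partial>(P \<Otimes>\<^sub>M P))
    = (\<integral>\<^sup>+x. \<integral>\<^sup>+y. ennreal (exp (\<rho> / 4 * W v (x, y))) \<partial>P \<partial>P)"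
    by (subst nn_integral_fst[symmetric]) auto
  also have "\<dots> \<le> (\<integral>\<^sup>+x. \<integral>\<^sup>+y. ?e x * ?e y \<partial>P \<partial>P)"
  proof (intro nn_integral_mono)
    fix x y
    have "W v (x, y) \<le> (lin v x)\<^sup>2 + (lin v y)\<^sup>2"
      using sum_squares_bound[of "lin v x" "- lin v y"] by (simp add: W_def power2_diff)
    then have "\<rho> / 4 * W v (x, y) \<le> \<rho> / 4 * ((lin v x)\<^sup>2 + (lin v y)\<^sup>2)"
      using \<rho> by (intro mult_left_mono) auto
    then have "exp (\<rho> / 4 * W v (x, y)) \<le> exp (\<rho> / 4 * (lin v x)\<^sup>2) * exp (\<rho> / 4 * (lin v y)\<^sup>2)"
      by (simp add: distrib_left flip: exp_add)
    then show "ennreal (exp (\<rho> / 4 * W v (x, y))) \<le> ?e x * ?e y"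
      by (simp add: ennreal_leI flip: ennreal_mult)
  qed
  also have "\<dots> = (\<integral>\<^sup>+x. ?e x \<partial>P) * (\<integral>\<^sup>+x. ?e x \<partial>P)"
    by (simp add: nn_integral_cmult nn_integral_multc)
  also have "\<dots> \<le> ennreal (tail_const \<rho>) * ennreal (tail_const \<rho>)"
    by (intro mult_mono lin_moment[OF sg \<rho> v]) auto
  also have "\<dots> = ennreal ((tail_const \<rho>)\<^sup>2)"
    using tail_const_ge_1[OF \<rho>] by (simp add: power2_eq_square flip: ennreal_mult)
  finally show ?thesis .
qed

text \<open>The first conclusion of \<open>centered_mgf_le\<close> turns the tail bound into a bound
  on the covariance; it serves for the zero estimator.\<close>

lemma bil_sig_le:
  assumes sg: "sub_gaussian p \<rho> P" and \<rho>: "0 < \<rho>"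
  shows "\<bar>bil p sig x x\<bar> \<le> (tail_const \<rho>)\<^sup>2 * 4 / \<rho> * sqn p x"
proof (rule bil_le_of_unit[where J=UNIV])
  fix v assume v: "sqn p v \<le> 1"
  have "\<rho> / 4 * (\<integral>z. W v z \<partial>(P \<Otimes>\<^sub>M P)) \<le> (tail_const \<rho>)\<^sup>2"
    by (rule centered_mgf_le(1)[OF prob_space_pair _ _ _ _ W_moment[OF sg \<rho> v]])
      (use \<rho> W_nonneg in auto)
  then show "\<bar>bil p sig v v\<bar> \<le> (tail_const \<rho>)\<^sup>2 * 4 / \<rho>"
    using \<rho> bil_sig_nonneg[of v] by (simp add: integral_W field_simps)
qed auto

end

text \<open>The pairs \<open>(2 * l, 2 * l + 1)\<close> are disjoint, so the \<open>m\<close>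
  summands are independent, as \<open>nn_integral_prod_pairs\<close> requires.\<close>

definition pair_cov :: "nat \<Rightarrow> (nat \<Rightarrow> nat \<Rightarrow> real) \<Rightarrow> nat \<Rightarrow> nat \<Rightarrow> real" where
  "pair_cov m X i j =
    (\<Sum>l<m. (X (2 * l) i - X (2 * l + 1) i) * (X (2 * l) j - X (2 * l + 1) j)) / (2 * real m)"

definition band_est :: "nat \<Rightarrow> nat \<Rightarrow> nat \<Rightarrow> (nat \<Rightarrow> nat \<Rightarrow> real) \<Rightarrow> real mat" where
  "band_est m p k X = mat p p (\<lambda>(i, j). if adj (i div k) (j div k) then pair_cov m X i j else 0)"

lemma band_est_estimator:
  assumes "2 * m \<le> n"
  shows "band_est m p k \<in> estimators n p"
  unfolding estimators_def
proof (intro CollectI conjI ballI allI impI)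
  fix i j assume ij: "i < p" "j < p"
  have c: "(\<lambda>X. X l a) \<in> borel_measurable (sample_space n p)" if "l < n" "a < p" for l a
    unfolding sample_space_def euclid_space_def
    by (rule measurable_compose[OF measurable_component_singleton[of l] measurable_component_singleton[of a]])
      (use that in auto)
  have "(\<lambda>X. pair_cov m X i j) \<in> borel_measurable (sample_space n p)"
    unfolding pair_cov_def
    by (intro borel_measurable_divide borel_measurable_const borel_measurable_sum borel_measurable_times borel_measurable_diff c)
      (use assms ij in auto)
  then show "(\<lambda>X. band_est m p k X $$ (i, j)) \<in> borel_measurable (sample_space n p)"
    using ij by (cases "adj (i div k) (j div k)") (simp_all add: band_est_def)
qed (simp add: band_est_def)

lemma sum_swap12:
  "(\<Sum>i\<in>I. \<Sum>j\<in>J. \<Sum>a\<in>K. F i j a) = (\<Sum>a\<in>K. \<Sum>i\<in>I. \<Sum>j\<in>J. F i j a)"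
proof -
  have "(\<Sum>i\<in>I. \<Sum>j\<in>J. \<Sum>a\<in>K. F i j a) = (\<Sum>i\<in>I. \<Sum>a\<in>K. \<Sum>j\<in>J. F i j a)"
    by (intro sum.cong refl sum.swap)
  also have "\<dots> = (\<Sum>a\<in>K. \<Sum>i\<in>I. \<Sum>j\<in>J. F i j a)"
    by (rule sum.swap)
  finally show ?thesis .
qed

context square_integrable_law
begin

lemma bil_pair_cov:
  assumes "0 < m"
  shows "bil p (\<lambda>i j. pair_cov m X i j - sig i j) v v
    = (\<Sum>l<m. W v (X (2 * l), X (2 * l + 1)) - bil p sig v v) / real m"
proof -
  have w: "W v (x, y) = (\<Sum>i<p. \<Sum>j<p. v i * ((x i - y i) * (x j - y j)) * v j) / 2" for x y
  proof -
    have "lin v x - lin v y = (\<Sum>i<p. v i * (x i - y i))"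
      unfolding lin_def sum_subtractf[symmetric] by (intro sum.cong refl) (simp add: algebra_simps)
    then show ?thesis
      by (simp add: W_def power2_eq_square sum_product mult_ac)
  qed
  have "bil p (\<lambda>i j. pair_cov m X i j) v v
    = (\<Sum>i<p. \<Sum>j<p. \<Sum>l<m. v i * ((X (2 * l) i - X (2 * l + 1) i) * (X (2 * l) j - X (2 * l + 1) j)) * v j / (2 * real m))"
    unfolding bil_def pair_cov_def
    by (simp add: sum_distrib_left sum_distrib_right sum_divide_distrib)
  also have "\<dots> = (\<Sum>l<m. \<Sum>i<p. \<Sum>j<p. v i * ((X (2 * l) i - X (2 * l + 1) i) * (X (2 * l) j - X (2 * l + 1) j)) * v j / (2 * real m))"
    by (rule sum_swap12)
  also have "\<dots> = (\<Sum>l<m. W v (X (2 * l), X (2 * l + 1))) / real m"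
    unfolding w sum_divide_distrib by (simp add: divide_divide_eq_left)
  finally have 1: "bil p (\<lambda>i j. pair_cov m X i j) v v = \<dots>" .
  have "bil p (\<lambda>i j. pair_cov m X i j - sig i j) v v = bil p (\<lambda>i j. pair_cov m X i j) v v - bil p sig v v"
    unfolding bil_def by (simp add: algebra_simps sum_subtractf)
  then show ?thesis using 1 assms by (simp add: sum_subtractf diff_divide_distrib)
qed

text \<open>The error form is an average of \<open>m\<close> independent centred copies of
  \<open>W\<close>, so its Laplace transform at \<open>l * m\<close> is an \<open>m\<close>-th
  power. The range \<open>\<rho> / 8\<close> is half of the exponent \<open>\<rho> / 4\<close>
  available in \<open>W_moment\<close>.\<close>

lemma pair_cov_mgf:
  assumes sg: "sub_gaussian p \<rho> P" and \<rho>: "0 < \<rho>" and v: "sqn p v \<le> 1"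
    and m: "0 < m" "2 * m \<le> n" and l: "\<bar>l\<bar> \<le> \<rho> / 8"
  shows "(\<integral>\<^sup>+X. ennreal (exp (l * real m * bil p (\<lambda>i j. pair_cov m X i j - sig i j) v v)) \<partial>PiM {..<n} (\<lambda>_. P))
    \<le> ennreal (exp (real m * (mgf_const (\<rho> / 4) ((tail_const \<rho>)\<^sup>2) * l\<^sup>2)))"
proof -
  interpret PP: pair_prob_space P P by standard
  let ?C = "mgf_const (\<rho> / 4) ((tail_const \<rho>)\<^sup>2)"
  let ?f = "\<lambda>x y. ennreal (exp (l * (W v (x, y) - bil p sig v v)))"
  have f: "case_prod ?f \<in> borel_measurable (P \<Otimes>\<^sub>M P)" by measurable
  have one: "(\<integral>\<^sup>+x. \<integral>\<^sup>+y. ?f x y \<partial>P \<partial>P) \<le> ennreal (exp (?C * l\<^sup>2))"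
  proof -
    have "(\<integral>\<^sup>+x. \<integral>\<^sup>+y. ?f x y \<partial>P \<partial>P) = (\<integral>\<^sup>+z. ennreal (exp (l * (W v z - bil p sig v v))) \<partial>(P \<Otimes>\<^sub>M P))"
      by (subst nn_integral_fst[symmetric]) auto
    also have "\<dots> \<le> ennreal (exp (?C * l\<^sup>2))"
      unfolding integral_W[symmetric]
      by (rule centered_mgf_le(2)[OF prob_space_pair _ _ _ _ W_moment[OF sg \<rho> v]])
        (use \<rho> l W_nonneg in auto)
    finally show ?thesis .
  qed
  have "(\<integral>\<^sup>+X. ennreal (exp (l * real m * bil p (\<lambda>i j. pair_cov m X i j - sig i j) v v)) \<partial>PiM {..<n} (\<lambda>_. P))
    = (\<integral>\<^sup>+X. (\<Prod>k<m. ?f (X (2 * k)) (X (2 * k + 1))) \<partial>PiM {..<n} (\<lambda>_. P))"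
  proof (intro nn_integral_cong)
    fix X
    have "l * real m * bil p (\<lambda>i j. pair_cov m X i j - sig i j) v v
      = (\<Sum>k<m. l * (W v (X (2 * k), X (2 * k + 1)) - bil p sig v v))"
    proof -
      have "l * real m * (S / real m) = l * S" for S using m by simp
      then show ?thesis unfolding bil_pair_cov[OF m(1)] by (simp only: sum_distrib_left)
    qed
    then show "ennreal (exp (l * real m * bil p (\<lambda>i j. pair_cov m X i j - sig i j) v v))
      = (\<Prod>k<m. ?f (X (2 * k)) (X (2 * k + 1)))"
      by (simp add: exp_sum prod_ennreal)
  qed
  also have "\<dots> = (\<integral>\<^sup>+x. \<integral>\<^sup>+y. ?f x y \<partial>P \<partial>P) ^ m"
    by (rule nn_integral_prod_pairs[OF prob_space_axioms f m(2)])
  also have "\<dots> \<le> ennreal (exp (?C * l\<^sup>2)) ^ m"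
    by (intro power_mono one) auto
  also have "\<dots> = ennreal (exp (real m * (?C * l\<^sup>2)))"
    by (simp add: ennreal_power exp_of_nat_mult)
  finally show ?thesis .
qed

text \<open>The deterministic half of the upper bound: the nets give \<open>2 * \<eta>\<close> on
  each window, the block decomposition makes it \<open>6 * \<eta>\<close>, and the discarded entries
  add \<open>r\<close> by the Schur test.\<close>

lemma band_est_op_norm:
  assumes p: "0 < p" and k: "0 < k"
    and r: "\<And>j. j < p \<Longrightarrow> (\<Sum>i<p. if adj (i div k) (j div k) then 0 else \<bar>sig i j\<bar>) \<le> r" "0 \<le> r"
    and \<eta>: "0 \<le> \<eta>" "\<And>b z. b < p \<Longrightarrow> z \<in> net ({b * k..<(b + 2) * k} \<inter> {..<p}) (2 * k) \<Longrightarrow>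
      \<bar>bil p (\<lambda>i j. pair_cov m X i j - sig i j)
        (net_vec ({b * k..<(b + 2) * k} \<inter> {..<p}) (2 * k) z)
        (net_vec ({b * k..<(b + 2) * k} \<inter> {..<p}) (2 * k) z)\<bar> \<le> \<eta>"
  shows "(op_norm (band_est m p k X - cov_mat p P))\<^sup>2 \<le> 2 * r\<^sup>2 + 72 * \<eta>\<^sup>2"
proof -
  let ?A = "\<lambda>i j. pair_cov m X i j - sig i j"
  let ?D = "band_est m p k X - cov_mat p P"
  have sym: "?A i j = ?A j i" for i j
    by (simp add: sig_commute[of i j] pair_cov_def mult.commute)
  have blk: "\<bar>bil p ?A x x\<bar> \<le> 2 * \<eta> * sqn p x"
    if x: "\<And>i. i \<notin> {b * k..<(b + 2) * k} \<Longrightarrow> x i = 0" for b x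
  proof -
    let ?J = "{b * k..<(b + 2) * k} \<inter> {..<p}"
    \<comment> \<open>A window may stick out beyond \<open>p\<close>. The forms do not see
      coordinates there, so the vector is cut off to fit the truncated window.\<close>
    define x' where "x' = (\<lambda>i. if i < p then x i else 0)"
    have e: "bil p ?A x x = bil p ?A x' x'" "sqn p x = sqn p x'"
      by (auto simp: bil_def sqn_def x'_def intro!: sum.cong)
    show ?thesis
    proof (cases "b < p")
      case True
      have "card ?J \<le> card {b * k..<(b + 2) * k}" by (intro card_mono) auto
      then have cJ: "card ?J \<le> 2 * k" by (simp add: algebra_simps)
      show ?thesis unfolding e
        by (rule net_bound[OF _ cJ]) (use k sym \<eta>(2)[OF True] x in \<open>auto simp: x'_def\<close>)
    next
      case False
      have "p \<le> b * k" using False k by (metis le_trans mult_le_mono2 nat_mult_1_right not_less Suc_leI One_nat_def)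
      then have "x' i = 0" for i using x[of i] by (auto simp: x'_def)
      then show ?thesis unfolding e by (simp add: bil_def sqn_def)
    qed
  qed
  have D: "?D \<in> carrier_mat p p" by (rule minus_carrier_mat[OF cov_mat_carrier])
  have Dij: "?D $$ (i, j) = (if adj (i div k) (j div k) then ?A i j else 0)
      - (if adj (i div k) (j div k) then 0 else sig i j)" if "i < p" "j < p" for i j
    using that cov_mat_carrier by (auto simp: band_est_def cov_mat_index)
  have "0 \<le> op_norm ?D \<and> op_norm ?D \<le> 6 * \<eta> + r"
  proof (rule op_norm_sym_le[OF D p])
    fix i j assume ij: "i < p" "j < p"
    show "?D $$ (i, j) = ?D $$ (j, i)"
      using ij sym[of i j] sig_commute[of i j] adj_commute[of "i div k"] by (simp add: Dij)
  next
    fix x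
    have "bil p (\<lambda>i j. ?D $$ (i, j)) x x = bil p (\<lambda>i j. if adj (i div k) (j div k) then ?A i j else 0) x x
        - bil p (\<lambda>i j. if adj (i div k) (j div k) then 0 else sig i j) x x"
      unfolding bil_def sum_subtractf[symmetric]
      by (intro sum.cong refl) (simp add: Dij algebra_simps)
    moreover have "\<bar>bil p (\<lambda>i j. if adj (i div k) (j div k) then ?A i j else 0) x x\<bar> \<le> 3 * (2 * \<eta>) * sqn p x"
      by (rule block_bound[OF k _ blk]) (use sym \<eta>(1) in auto)
    moreover have "\<bar>bil p (\<lambda>i j. if adj (i div k) (j div k) then 0 else sig i j) x x\<bar> \<le> r * sqn p x"
    proof (rule bil_row_sum_le)
      show "(if adj (i div k) (j div k) then 0 else sig i j) = (if adj (j div k) (i div k) then 0 else sig j i)" for i j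
        by (simp add: sig_commute[of i j] adj_commute[of "i div k"])
      show "(\<Sum>i<p. \<bar>if adj (i div k) (j div k) then 0 else sig i j\<bar>) \<le> r" if "j < p" for j
        using r(1)[OF that] by (simp add: if_distrib[of abs] cong: if_cong)
    qed
    ultimately show "\<bar>bil p (\<lambda>i j. ?D $$ (i, j)) x x\<bar> \<le> (6 * \<eta> + r) * sqn p x"
      by (simp add: algebra_simps)
  qed (use \<eta> r in auto)
  then have "(op_norm ?D)\<^sup>2 \<le> (6 * \<eta> + r)\<^sup>2" by (intro power_mono) auto
  also have "\<dots> \<le> 2 * r\<^sup>2 + 72 * \<eta>\<^sup>2"
    using sum_squares_bound[of "6 * \<eta>" r] by (simp add: power2_sum power_mult_distrib)
  finally show ?thesis .
qed

lemma measurable_pair_cov_bil: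
  assumes "2 * m \<le> n"
  shows "(\<lambda>X. bil p (\<lambda>i j. pair_cov m X i j - sig i j) v v) \<in> borel_measurable (PiM {..<n} (\<lambda>_. P))"
proof -
  have c: "(\<lambda>X. X l a) \<in> borel_measurable (PiM {..<n} (\<lambda>_. P))" if "l < n" "a < p" for l a
    by (rule measurable_compose[OF measurable_component_singleton[of l] measurable_coord[of a]])
      (use that in auto)
  show ?thesis
    unfolding bil_def pair_cov_def
    by (intro borel_measurable_sum borel_measurable_times borel_measurable_diff borel_measurable_divide
        borel_measurable_const c) (use assms in auto)
qed

text \<open>\<open>Z\<close> collects one net per window, at most
  \<open>p * (3 * exp 64) ^ (2 * k)\<close> points. \<open>L\<close> is the logarithm of this after
  rounding \<open>3 * exp 64\<close> up to \<open>exp 66\<close>, whence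
  \<open>132 = 2 * 66\<close>.\<close>

lemma band_est_risk:
  assumes sg: "sub_gaussian p \<rho> P" and \<rho>: "0 < \<rho>"
    and p: "0 < p" and k: "0 < k" and m: "0 < m" "2 * m \<le> n"
    and r: "\<And>j. j < p \<Longrightarrow> (\<Sum>i<p. if adj (i div k) (j div k) then 0 else \<bar>sig i j\<bar>) \<le> r" "0 \<le> r"
    and l: "0 < l" "l \<le> \<rho> / 8"
    and L: "L = ln (real p) + 132 * real k" and V: "V = real m * (mgf_const (\<rho> / 4) ((tail_const \<rho>)\<^sup>2) * l\<^sup>2)"
  shows "risk n p (band_est m p k) P
    \<le> ennreal (2 * r\<^sup>2 + 72 * (2 * ((L + V) / (l * real m))\<^sup>2 + 8 / (l * real m)\<^sup>2))"
proof -
  define J where "J b = {b * k..<(b + 2) * k} \<inter> {..<p}" for b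
  define Z where "Z = Sigma {..<p} (\<lambda>b. net (J b) (2 * k))"
  define D where "D z X = bil p (\<lambda>i j. pair_cov m X i j - sig i j)
    (net_vec (J (fst z)) (2 * k) (snd z)) (net_vec (J (fst z)) (2 * k) (snd z))" for z X
  have fJ: "finite (J b)" for b by (simp add: J_def)
  have cJ: "card (J b) \<le> 2 * k" for b
  proof -
    have "card (J b) \<le> card {b * k..<(b + 2) * k}" unfolding J_def by (intro card_mono) auto
    then show ?thesis by (simp add: algebra_simps)
  qed
  have v1: "sqn p (net_vec (J b) (2 * k) z) \<le> 1" if "z \<in> net (J b) (2 * k)" for b z
    by (rule sqn_net_vec_le) (use that k in \<open>auto simp: J_def\<close>)
  have "real (card Z) = (\<Sum>b<p. real (card (net (J b) (2 * k))))"
    unfolding Z_def by (simp add: finite_net[OF fJ])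
  also have "\<dots> \<le> (\<Sum>b<p. (3 * exp 64) ^ (2 * k))"
    by (intro sum_mono card_net_le fJ cJ)
  also have "\<dots> = real p * (3 * exp 64) ^ (2 * k)" by simp
  also have "\<dots> \<le> real p * exp 66 ^ (2 * k)"
  proof (intro mult_left_mono power_mono)
    have "3 * exp (64::real) \<le> exp 2 * exp 64"
      using exp_ge_add_one_self[of 2] by (intro mult_right_mono) auto
    then show "3 * exp (64::real) \<le> exp 66" by (simp flip: exp_add)
  qed auto
  also have "\<dots> = exp L"
    using p by (simp add: L exp_add exp_of_nat_mult[symmetric] mult.commute)
  finally have cardZ: "real (card Z) \<le> exp L" .
  have L0: "0 \<le> L" using p by (simp add: L)
  have V0: "0 \<le> V" using l \<rho> by (simp add: V mgf_const_def)
  show ?thesis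
    unfolding risk_def
  proof (rule maximal_second_moment[where Z=Z and D=D and L=L and V=V])
    show "finite Z" unfolding Z_def using finite_net[OF fJ] by auto
    show "prob_space (PiM {..<n} (\<lambda>_. P))" by (intro prob_space_PiM prob_space_axioms)
    show "D z \<in> borel_measurable (PiM {..<n} (\<lambda>_. P))" for z
      unfolding D_def by (rule measurable_pair_cov_bil[OF m(2)])
    show "(\<integral>\<^sup>+X. ennreal (exp (l * real m * D z X)) \<partial>PiM {..<n} (\<lambda>_. P)) \<le> ennreal (exp V)" if "z \<in> Z" for z
      unfolding D_def V
      by (rule pair_cov_mgf[OF sg \<rho> v1 m]) (use that l \<rho> in \<open>auto simp: Z_def\<close>)
    show "(\<integral>\<^sup>+X. ennreal (exp (- (l * real m * D z X))) \<partial>PiM {..<n} (\<lambda>_. P)) \<le> ennreal (exp V)" if "z \<in> Z" for z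
      using pair_cov_mgf[OF sg \<rho> v1 m, of "snd z" "fst z" "- l"] that l \<rho>
      unfolding D_def V by (auto simp: Z_def)
    show "(op_norm (band_est m p k X - cov_mat p P))\<^sup>2 \<le> 2 * r\<^sup>2 + 72 * \<eta>\<^sup>2"
      if "0 \<le> \<eta>" "\<And>z. z \<in> Z \<Longrightarrow> \<bar>D z X\<bar> \<le> \<eta>" for X \<eta>
      by (rule band_est_op_norm[OF p k r that(1)]) (use that(2) in \<open>force simp: Z_def D_def J_def\<close>)+
  qed (use cardZ L0 V0 l m in auto)
qed

lemma zero_est_risk:
  assumes sg: "sub_gaussian p \<rho> P" and \<rho>: "0 < \<rho>" and p: "0 < p"
  shows "risk n p (\<lambda>_. 0\<^sub>m p p) P \<le> ennreal (((tail_const \<rho>)\<^sup>2 * 4 / \<rho>)\<^sup>2)"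
proof -
  interpret pp: prob_space "PiM {..<n} (\<lambda>_. P)" by (intro prob_space_PiM prob_space_axioms)
  let ?D = "0\<^sub>m p p - cov_mat p P" and ?q = "(tail_const \<rho>)\<^sup>2 * 4 / \<rho>"
  have "0 \<le> op_norm ?D \<and> op_norm ?D \<le> ?q"
  proof (rule op_norm_sym_le[OF _ p])
    fix x
    have "bil p (\<lambda>i j. ?D $$ (i, j)) x x = - bil p sig x x"
      unfolding bil_def sum_negf[symmetric]
      by (intro sum.cong refl) (use cov_mat_carrier in \<open>auto simp: cov_mat_index\<close>)
    then show "\<bar>bil p (\<lambda>i j. ?D $$ (i, j)) x x\<bar> \<le> ?q * sqn p x"
      using bil_sig_le[OF sg \<rho>, of x] by simp
  qed (use cov_mat_carrier \<rho> sig_commute in \<open>auto simp: cov_mat_index\<close>)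
  then have "(op_norm ?D)\<^sup>2 \<le> ?q\<^sup>2" by (intro power_mono) auto
  then show ?thesis unfolding risk_def by (simp add: pp.emeasure_space_1 ennreal_leI)
qed

end

section \<open>Choice of the Chernoff parameter and of the bandwidth\<close>

definition mgf_c :: "real \<Rightarrow> real" where
  "mgf_c \<rho> = mgf_const (\<rho> / 4) ((tail_const \<rho>)\<^sup>2)"

text \<open>The exponent \<open>l\<close> in the Chernoff bound is \<open>step_const \<rho> \<gamma> * sqrt (L / m)\<close>; the constraint
  \<open>l \<le> \<rho> / 8\<close> is where \<open>p \<le> exp (\<gamma> * n)\<close> enters.\<close>

definition step_const :: "real \<Rightarrow> real \<Rightarrow> real" where
  "step_const \<rho> \<gamma> = \<rho> / 8 / sqrt (3 * (\<gamma> + 264))"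

text \<open>216 is the 72 of \<open>band_est_risk\<close> times 3, the price of
  \<open>n \<le> 3 * (n div 2)\<close> for \<open>n \<ge> 2\<close>.\<close>

definition var_const :: "real \<Rightarrow> real \<Rightarrow> real" where
  "var_const \<rho> \<gamma> = 216 * (2 * (1 + mgf_c \<rho> * (step_const \<rho> \<gamma>)\<^sup>2)\<^sup>2 + 8) / (step_const \<rho> \<gamma>)\<^sup>2"

lemma step_const_pos: "0 < \<rho> \<Longrightarrow> 0 < \<gamma> \<Longrightarrow> 0 < step_const \<rho> \<gamma>"
  by (simp add: step_const_def)

lemma var_const_nonneg: "0 \<le> var_const \<rho> \<gamma>"
  by (simp add: var_const_def)

context square_integrable_law
begin

text \<open>With \<open>l\<^sup>2\<close> proportional to \<open>L / m\<close> the Chernoff term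
  \<open>V\<close> becomes a multiple of \<open>L\<close>, and the whole second moment is of order
  \<open>L / m\<close>.\<close>

lemma band_est_risk_le:
  assumes sg: "sub_gaussian p \<rho> P" and \<rho>: "0 < \<rho>" and \<gamma>: "0 < \<gamma>"
    and p: "0 < p" "real p \<le> exp (\<gamma> * real n)" and k: "0 < k" "k \<le> 2 * n" and n: "2 \<le> n"
    and r: "\<And>j. j < p \<Longrightarrow> (\<Sum>i<p. if adj (i div k) (j div k) then 0 else \<bar>sig i j\<bar>) \<le> r" "0 \<le> r"
  shows "risk n p (band_est (n div 2) p k) P
    \<le> ennreal (2 * r\<^sup>2 + var_const \<rho> \<gamma> * (ln (real p) + 132 * real k) / real n)"
proof -
  define m where "m = n div 2"
  have m: "0 < m" "2 * m \<le> n" "n \<le> 3 * m" using n by (auto simp: m_def)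
  define L where "L = ln (real p) + 132 * real k"
  define c where "c = step_const \<rho> \<gamma>"
  define l where "l = c * sqrt (L / real m)"
  define C where "C = mgf_c \<rho>"
  define V where "V = real m * (mgf_const (\<rho> / 4) ((tail_const \<rho>)\<^sup>2) * l\<^sup>2)"
  have c: "0 < c" using \<rho> \<gamma> by (simp add: c_def step_const_pos)
  have "0 \<le> ln (real p)" using p by simp
  then have L1: "1 \<le> L" using k by (simp add: L_def)
  have lnp: "ln (real p) \<le> \<gamma> * real n" 
  proof -
    have "ln (real p) \<le> ln (exp (\<gamma> * real n))" using p by (subst ln_le_cancel_iff) auto
    then show ?thesis by simp
  qed
  \<comment> \<open>\<open>k \<le> 2 * n\<close> keeps the logarithm of the net size of order
    \<open>n\<close>, just as the growth condition does for \<open>ln p\<close>;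
    \<open>264 = 2 * 132\<close>.\<close>
  have "L \<le> (\<gamma> + 264) * real n"
    using lnp k(2) by (simp add: L_def algebra_simps)
  also have "\<dots> \<le> (\<gamma> + 264) * (3 * real m)"
    using m(3) \<gamma> by (intro mult_left_mono) auto
  finally have "L / real m \<le> 3 * (\<gamma> + 264)" using m by (simp add: field_simps)
  then have "sqrt (L / real m) \<le> sqrt (3 * (\<gamma> + 264))" by simp
  then have "l \<le> c * sqrt (3 * (\<gamma> + 264))" unfolding l_def using c by (intro mult_left_mono) auto
  also have "\<dots> = \<rho> / 8" using \<gamma> by (simp add: c_def step_const_def)
  finally have l: "0 < l" "l \<le> \<rho> / 8" using c L1 m by (auto simp: l_def)
  have l2: "l\<^sup>2 = c\<^sup>2 * (L / real m)" using L1 by (simp add: l_def power_mult_distrib)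
  have V': "V = C * c\<^sup>2 * L" unfolding V_def l2 C_def mgf_c_def using m by simp
  have lm: "(l * real m)\<^sup>2 = c\<^sup>2 * L * real m"
    unfolding power_mult_distrib l2 using m by (simp add: power2_eq_square)
  have "((L + V) / (l * real m))\<^sup>2 = (L * (1 + C * c\<^sup>2))\<^sup>2 / (c\<^sup>2 * L * real m)"
    unfolding power_divide lm V' by (simp add: algebra_simps)
  also have "\<dots> = (1 + C * c\<^sup>2)\<^sup>2 / c\<^sup>2 * (L / real m)"
    using L1 by (simp add: power_mult_distrib power2_eq_square[of L])
  finally have t1: "((L + V) / (l * real m))\<^sup>2 = (1 + C * c\<^sup>2)\<^sup>2 / c\<^sup>2 * (L / real m)" .
  have t2: "8 / (l * real m)\<^sup>2 \<le> 8 / c\<^sup>2 * (L / real m)"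
  proof -
    have "8 / (l * real m)\<^sup>2 = 8 / c\<^sup>2 * (1 / (L * real m))" by (simp add: lm)
    \<comment> \<open>The term without \<open>L\<close> in the numerator is absorbed because
      \<open>L \<ge> 1\<close>.\<close>
    also have "1 / (L * real m) \<le> L / real m"
    proof -
      have "1 * 1 \<le> L * L" using L1 by (intro mult_mono) auto
      then show ?thesis using L1 m by (simp add: field_simps)
    qed
    finally show ?thesis using c by (simp add: mult_left_mono divide_right_mono)
  qed
  have "72 * (2 * ((L + V) / (l * real m))\<^sup>2 + 8 / (l * real m)\<^sup>2)
    \<le> 72 * (2 * ((1 + C * c\<^sup>2)\<^sup>2 / c\<^sup>2 * (L / real m)) + 8 / c\<^sup>2 * (L / real m))"
    using t2 unfolding t1 by simp
  also have "\<dots> = (var_const \<rho> \<gamma> / 3) * (L / real m)"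
    by (simp add: var_const_def C_def c_def add_divide_distrib algebra_simps)
  also have "\<dots> \<le> (var_const \<rho> \<gamma> / 3) * (3 * L / real n)"
  proof (intro mult_left_mono)
    have "real n \<le> 3 * real m" using m(3) by linarith
    then have "L * real n \<le> L * (3 * real m)" using L1 by (intro mult_left_mono) auto
    then show "L / real m \<le> 3 * L / real n" using m n by (simp add: field_simps)
  qed (use var_const_nonneg in auto)
  finally have fin: "72 * (2 * ((L + V) / (l * real m))\<^sup>2 + 8 / (l * real m)\<^sup>2) \<le> var_const \<rho> \<gamma> * L / real n"
    by simp
  have "risk n p (band_est m p k) P \<le> ennreal (2 * r\<^sup>2 + 72 * (2 * ((L + V) / (l * real m))\<^sup>2 + 8 / (l * real m)\<^sup>2))"
    by (rule band_est_risk[OF sg \<rho> p(1) k(1) m(1,2) r l L_def V_def])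
  also have "\<dots> \<le> ennreal (2 * r\<^sup>2 + var_const \<rho> \<gamma> * L / real n)"
    using fin by (intro ennreal_leI) simp
  finally show ?thesis by (simp add: m_def L_def)
qed

text \<open>If two blocks are not adjacent, a whole block lies between them, so their indices are
  more than \<open>k\<close> apart and the decay condition at lag \<open>k\<close> covers the
  discarded entries.\<close>

lemma band_bias:
  assumes F: "cov_mat p P \<in> F_class p \<alpha> M0 M" and k: "0 < k" and j: "j < p"
  shows "(\<Sum>i<p. if adj (i div k) (j div k) then 0 else \<bar>sig i j\<bar>) \<le> M * real k powr (- \<alpha>)"
proof -
  let ?f = "\<lambda>j. \<Sum>i | i < p \<and> \<bar>int i - int j\<bar> > int k. \<bar>cov_mat p P $$ (i, j)\<bar>"
  have far: "\<bar>int i - int j\<bar> > int k" if "\<not> adj (i div k) (j div k)" for i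
  proof -
    have *: "a * k + k < b" if "a = i' div k" "a + 2 \<le> b div k" for a b i'
    proof -
      have "(a + 2) * k \<le> b div k * k" using that by (intro mult_right_mono) auto
      also have "\<dots> \<le> b" by simp
      finally show ?thesis using k by simp
    qed
    have **: "a + k < b" if "a div k + 2 \<le> b div k" for a b
    proof -
      have "a < (a div k + 1) * k" using k by (simp add: dividend_less_div_times)
      moreover have "(a div k + 2) * k \<le> b"
        using that by (metis div_times_less_eq_dividend le_trans mult_le_mono1)
      ultimately show ?thesis by (simp add: algebra_simps)
    qed
    from that have "i div k + 2 \<le> j div k \<or> j div k + 2 \<le> i div k" by (auto simp: adj_def)
    then show ?thesis using **[of i j] **[of j i] by auto
  qed
  have "(\<Sum>i<p. if adj (i div k) (j div k) then 0 else \<bar>sig i j\<bar>)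
    \<le> (\<Sum>i<p. if \<bar>int i - int j\<bar> > int k then \<bar>cov_mat p P $$ (i, j)\<bar> else 0)"
    by (intro sum_mono) (use far j in \<open>auto simp: cov_mat_index\<close>)
  also have "\<dots> = ?f j"
    by (subst sum.inter_filter[symmetric]) (auto intro!: sum.cong)
  also have "\<dots> \<le> (MAX j\<in>{..<p}. ?f j)"
    using j by (intro Max_ge) auto
  also have "\<dots> \<le> M * real k powr (- \<alpha>)"
    using F k unfolding F_class_def by auto
  finally show ?thesis .
qed

end

lemma minimax_risk_le:
  assumes "S \<in> estimators n p" and "\<And>P. P \<in> P_class p \<alpha> M0 M \<rho> \<Longrightarrow> risk n p S P \<le> B"
  shows "minimax_risk n p \<alpha> M0 M \<rho> \<le> B"
  unfolding minimax_risk_def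
  by (rule INF_lower2[OF assms(1)]) (rule SUP_least, rule assms(2))

text \<open>\<open>q\<close> is the balancing bandwidth: variance \<open>q / n\<close> and squared
  bias \<open>q powr (-2 * \<alpha>)\<close> are equal there.\<close>

lemma powr_identities:
  fixes \<alpha> :: real
  assumes \<alpha>: "0 < \<alpha>" and n: "1 \<le> n"
  defines "q \<equiv> real n powr (1 / (2 * \<alpha> + 1))"
  shows "1 \<le> q" "q \<le> real n" "q / real n = real n powr (- (2 * \<alpha> / (2 * \<alpha> + 1)))"
    "q powr (- 2 * \<alpha>) = real n powr (- (2 * \<alpha> / (2 * \<alpha> + 1)))"
proof -
  show "1 \<le> q" unfolding q_def using assms by (intro ge_one_powr_ge_zero) auto
  have "q \<le> real n powr 1" unfolding q_def using assms by (intro powr_mono) auto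
  then show "q \<le> real n" using n by simp
  have "q / real n = real n powr (1 / (2 * \<alpha> + 1) - 1)"
    unfolding q_def using n by (simp add: powr_diff)
  also have "1 / (2 * \<alpha> + 1) - 1 = - (2 * \<alpha> / (2 * \<alpha> + 1))" using \<alpha> by (simp add: field_simps)
  finally show "q / real n = real n powr (- (2 * \<alpha> / (2 * \<alpha> + 1)))" .
  show "q powr (- 2 * \<alpha>) = real n powr (- (2 * \<alpha> / (2 * \<alpha> + 1)))"
    unfolding q_def powr_powr by (intro arg_cong2[of _ _ _ _ "(powr)"]) auto
qed

theorem minimax_risk_upper:
  fixes \<alpha> M0 M \<rho> \<gamma> :: real
  assumes \<alpha>: "0 < \<alpha>" and M: "0 < M" and \<rho>: "0 < \<rho>" and \<gamma>: "0 < \<gamma>"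
  obtains C where "0 < C" "\<And>n p. 1 \<le> n \<Longrightarrow> 1 \<le> p \<Longrightarrow> real p \<le> exp (\<gamma> * real n) \<Longrightarrow>
    minimax_risk n p \<alpha> M0 M \<rho> \<le> ennreal (C * minimax_rate n p \<alpha>)"
proof -
  define B where "B = ((tail_const \<rho>)\<^sup>2 * 4 / \<rho>)\<^sup>2"
  define D where "D = var_const \<rho> \<gamma>"
  define C where "C = 1 + B + 4 * M\<^sup>2 + 600 * D"
  have B0: "0 \<le> B" and D0: "0 \<le> D" by (auto simp: B_def D_def var_const_nonneg)
  have C0: "0 < C" using B0 D0 by (simp add: C_def add_pos_nonneg)
  have "minimax_risk n p \<alpha> M0 M \<rho> \<le> ennreal (C * minimax_rate n p \<alpha>)"
    if n: "1 \<le> n" and p: "1 \<le> p" and pn: "real p \<le> exp (\<gamma> * real n)" for n p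
  proof -
    let ?a = "real n powr (- (2 * \<alpha> / (2 * \<alpha> + 1)))"
    have lnp: "0 \<le> ln (real p)" using p by simp
    show ?thesis
    \<comment> \<open>A single observation forms no pair. The rate is then at least one, so the zero
      estimator is good enough.\<close>
    proof (cases "n = 1")
      case True
      have "1 \<le> minimax_rate n p \<alpha>" using True p lnp by (simp add: minimax_rate_def)
      moreover have "B \<le> C" using D0 by (simp add: C_def)
      ultimately have BC: "B \<le> C * minimax_rate n p \<alpha>"
        using mult_mono[of B C 1 "minimax_rate n p \<alpha>"] C0 by simp
      have "(\<lambda>_. 0\<^sub>m p p) \<in> estimators n p" by (auto simp: estimators_def)
      moreover have "risk n p (\<lambda>_. 0\<^sub>m p p) P \<le> ennreal B" if "P \<in> P_class p \<alpha> M0 M \<rho>" for P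
      proof -
        interpret square_integrable_law p P using that by unfold_locales (simp add: P_class_def)
        show ?thesis unfolding B_def by (rule zero_est_risk) (use that \<rho> p in \<open>auto simp: P_class_def\<close>)
      qed
      ultimately have "minimax_risk n p \<alpha> M0 M \<rho> \<le> ennreal B" by (rule minimax_risk_le)
      then show ?thesis using BC by (meson ennreal_leI order_trans)
    next
      case False
      then have n2: "2 \<le> n" using n by simp
      define q where "q = real n powr (1 / (2 * \<alpha> + 1))"
      note qs = powr_identities[OF \<alpha> n, folded q_def]
      \<comment> \<open>Rounding up makes the bias no larger than at \<open>q\<close>, and
        \<open>q \<ge> 1\<close> gives \<open>k1 \<le> 2 * q\<close>.\<close>
      define k1 where "k1 = nat \<lceil>q\<rceil>"
      have k1: "q \<le> real k1" "real k1 \<le> 2 * q" "1 \<le> k1"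
        using qs(1) by (auto simp: k1_def le_of_int_ceiling) linarith+
      have k1n: "k1 \<le> 2 * n" using k1(2) qs(2) by linarith
      \<comment> \<open>If \<open>p \<le> k1\<close>, then \<open>k = p\<close>, all indices share
        block 0, nothing is discarded, and the bias \<open>r\<close> is 0.\<close>
      define k where "k = min k1 p"
      have k: "0 < k" "k \<le> 2 * n" using k1 k1n p by (auto simp: k_def)
      define r where "r = (if k1 < p then M * real k1 powr (- \<alpha>) else 0)"
      have r0: "0 \<le> r" using M by (simp add: r_def)
      have est: "band_est (n div 2) p k \<in> estimators n p"
        by (rule band_est_estimator) auto
      have rk: "risk n p (band_est (n div 2) p k) P \<le> ennreal (2 * r\<^sup>2 + D * (ln (real p) + 132 * real k) / real n)"
        if P: "P \<in> P_class p \<alpha> M0 M \<rho>" for P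
      proof -
        interpret square_integrable_law p P using P by unfold_locales (simp add: P_class_def)
        show ?thesis unfolding D_def
        proof (rule band_est_risk_le[OF _ \<rho> \<gamma> _ pn k n2 _ r0])
          fix j assume j: "j < p"
          show "(\<Sum>i<p. if adj (i div k) (j div k) then 0 else \<bar>sig i j\<bar>) \<le> r"
          proof (cases "k1 < p")
            case True
            then show ?thesis
              using band_bias[of \<alpha> M0 M k j] P k j by (simp add: r_def k_def P_class_def)
          next
            case False
            then have "k = p" by (simp add: k_def)
            then show ?thesis using j by (simp add: r_def False adj_def)
          qed
        qed (use P p in \<open>auto simp: P_class_def\<close>)
      qed
      have "2 * r\<^sup>2 + D * (ln (real p) + 132 * real k) / real n \<le> C * minimax_rate n p \<alpha>"
      proof (cases "k1 < p")
        case True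
        let ?S = "?a + ln (real p) / real n"
        have S0: "0 \<le> ln (real p) / real n" "0 \<le> ?a" using lnp by auto
        have "?a \<le> real p / real n"
          unfolding qs(3)[symmetric] using True k1 n by (intro divide_right_mono) auto
        moreover have "ln (real p) / real n \<le> real p / real n"
          using p ln_bound[of "real p"] by (intro divide_right_mono) auto
        \<comment> \<open>Both summands are at most \<open>p / n\<close>, so the minimum in the rate
          loses at most a factor 2 against their sum.\<close>
        ultimately have rate: "?S \<le> 2 * minimax_rate n p \<alpha>"
        proof -
          have "a + b \<le> 2 * min (a + b) c" if "a \<le> c" "b \<le> c" "0 \<le> a" "0 \<le> b" for a b c :: real
            using that by (auto simp: min_def)
          then show "?S \<le> 2 * minimax_rate n p \<alpha>"
            if "?a \<le> real p / real n" "ln (real p) / real n \<le> real p / real n"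
            unfolding minimax_rate_def using that S0 by blast
        qed
        have "r\<^sup>2 = M\<^sup>2 * real k1 powr (- 2 * \<alpha>)"
          using True by (simp add: r_def power_mult_distrib powr_add[symmetric] power2_eq_square[of "_ powr _"])
        also have "\<dots> \<le> M\<^sup>2 * q powr (- 2 * \<alpha>)"
          using k1 qs(1) \<alpha> by (intro mult_left_mono powr_mono2') auto
        finally have r2: "r\<^sup>2 \<le> M\<^sup>2 * ?a" unfolding qs(4) .
        have "132 * real k / real n \<le> 264 * (q / real n)"
          using k1(2) True by (simp add: k_def divide_right_mono)
        then have "(ln (real p) + 132 * real k) / real n \<le> 264 * ?S"
          unfolding qs(3) using S0 by (simp add: add_divide_distrib)
        then have "D * ((ln (real p) + 132 * real k) / real n) \<le> D * (264 * ?S)"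
          using D0 by (intro mult_left_mono)
        moreover have "M\<^sup>2 * ?a \<le> M\<^sup>2 * ?S" using S0 by (intro mult_left_mono) auto
        ultimately have "2 * r\<^sup>2 + D * (ln (real p) + 132 * real k) / real n \<le> (2 * M\<^sup>2 + 264 * D) * ?S"
          using r2 by (simp add: algebra_simps)
        also have "\<dots> \<le> (2 * M\<^sup>2 + 264 * D) * (2 * minimax_rate n p \<alpha>)"
          using rate D0 by (intro mult_left_mono) auto
        also have "\<dots> = (4 * M\<^sup>2 + 528 * D) * minimax_rate n p \<alpha>" by (simp add: algebra_simps)
        also have "\<dots> \<le> C * minimax_rate n p \<alpha>"
        proof (rule mult_right_mono)
          show "0 \<le> minimax_rate n p \<alpha>" using rate S0 by linarith
        qed (use B0 D0 in \<open>auto simp: C_def\<close>)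
        finally show ?thesis .
      next
        case False
        then have kp: "k = p" "r = 0" by (auto simp: k_def r_def)
        \<comment> \<open>Here the rate is comparable with \<open>p / n\<close>, and
          \<open>ln p \<le> p\<close> absorbs the logarithm.\<close>
        have "real p \<le> 2 * q" using False k1 by linarith
        then have "real p / real n \<le> 2 * ?a"
          unfolding qs(3)[symmetric] by (simp add: divide_right_mono)
        moreover have "0 \<le> ln (real p) / real n" "0 \<le> real p / real n" using lnp by auto
        ultimately have rate: "real p / real n \<le> 2 * minimax_rate n p \<alpha>" "0 \<le> minimax_rate n p \<alpha>"
          unfolding minimax_rate_def min_def by (smt (verit))+
        have "(ln (real p) + 132 * real k) / real n \<le> 133 * (real p / real n)"
          using p ln_bound[of "real p"] unfolding kp by (simp add: divide_right_mono)
        then have "D * ((ln (real p) + 132 * real k) / real n) \<le> D * (133 * (real p / real n))"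
          using D0 by (intro mult_left_mono)
        also have "\<dots> \<le> D * (133 * (2 * minimax_rate n p \<alpha>))"
          using D0 rate by (intro mult_left_mono) auto
        also have "\<dots> = (266 * D) * minimax_rate n p \<alpha>" by simp
        also have "\<dots> \<le> C * minimax_rate n p \<alpha>"
          using rate B0 D0 by (intro mult_right_mono) (auto simp: C_def)
        finally show ?thesis using kp by simp
      qed
      then show ?thesis
        using minimax_risk_le[OF est rk] by (meson ennreal_leI order_trans)
    qed
  qed
  then show thesis using that C0 by blast
qed

section \<open>Finitely supported laws\<close>

text \<open>Labels are pushed forward so that weights, moments and likelihoods are finite sums over
  a convenient index set.\<close>

definition finite_law :: "nat \<Rightarrow> 'a set \<Rightarrow> ('a \<Rightarrow> real) \<Rightarrow> ('a \<Rightarrow> nat \<Rightarrow> real) \<Rightarrow> (nat \<Rightarrow> real) measure" where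
  "finite_law p J w X = distr (point_measure J (\<lambda>j. ennreal (w j))) (euclid_space p) X"

text \<open>\<open>inj\<close> identifies the mass of the atom \<open>X j\<close> with
  \<open>w j\<close>, so the likelihood of a sample is a product of label weights.\<close>

locale finite_law_setup =
  fixes p :: nat and J :: "'a set" and w :: "'a \<Rightarrow> real" and X :: "'a \<Rightarrow> nat \<Rightarrow> real"
  assumes J: "finite J" and w0: "\<And>j. j \<in> J \<Longrightarrow> 0 \<le> w j" and w1: "(\<Sum>j\<in>J. w j) = 1"
    and X: "\<And>j. j \<in> J \<Longrightarrow> X j \<in> extensional {..<p}" and inj: "inj_on X J"
begin

abbreviation "P \<equiv> finite_law p J w X"

lemma X_space: "j \<in> J \<Longrightarrow> X j \<in> space (euclid_space p)"
  using X by (auto simp: euclid_space_def space_PiM PiE_def)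

lemma sets_P [measurable_cong]: "sets P = sets (euclid_space p)"
  by (simp add: finite_law_def)

lemma space_P: "space P = space (euclid_space p)"
  by (simp add: finite_law_def)

lemma meas_X: "X \<in> point_measure J (\<lambda>j. ennreal (w j)) \<rightarrow>\<^sub>M euclid_space p"
  using X_space by (auto simp: J)

lemma emeasure_P:
  assumes "A \<in> sets (euclid_space p)"
  shows "emeasure P A = ennreal (\<Sum>j | j \<in> J \<and> X j \<in> A. w j)"
proof -
  have "emeasure P A = emeasure (point_measure J (\<lambda>j. ennreal (w j))) {j \<in> J. X j \<in> A}"
    unfolding finite_law_def using assms
    by (subst emeasure_distr[OF meas_X]) (auto simp: space_point_measure intro!: arg_cong[of _ _ "emeasure _"])
  also have "\<dots> = (\<Sum>j | j \<in> J \<and> X j \<in> A. ennreal (w j))"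
    using J by (subst emeasure_point_measure_finite) auto
  also have "\<dots> = ennreal (\<Sum>j | j \<in> J \<and> X j \<in> A. w j)"
    using w0 by (intro sum_ennreal) auto
  finally show ?thesis .
qed

lemma measure_P:
  assumes "A \<in> sets (euclid_space p)"
  shows "measure P A = (\<Sum>j | j \<in> J \<and> X j \<in> A. w j)"
  unfolding measure_def emeasure_P[OF assms] using w0 by (intro enn2real_ennreal sum_nonneg) auto

sublocale prob_space P
proof
  have "{j. j \<in> J \<and> X j \<in> space P} = J" using X_space space_P by auto
  then show "emeasure P (space P) = 1"
    using emeasure_P[of "space P"] w1 by (simp add: space_P)
qed

lemma singleton_sets: "x \<in> extensional {..<p} \<Longrightarrow> {x} \<in> sets (euclid_space p)"
proof -
  assume x: "x \<in> extensional {..<p}"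
  have "{x} = PiE {..<p} (\<lambda>i. {x i})" using x by (auto simp: PiE_singleton)
  also have "\<dots> \<in> sets (euclid_space p)" unfolding euclid_space_def by (rule sets_PiM_I_finite) auto
  finally show ?thesis .
qed

lemma emeasure_singleton: "j \<in> J \<Longrightarrow> emeasure P {X j} = ennreal (w j)"
proof -
  assume j: "j \<in> J"
  have "{i. i \<in> J \<and> X i \<in> {X j}} = {j}" using j inj by (auto simp: inj_on_def)
  then show ?thesis using emeasure_P[OF singleton_sets[OF X[OF j]]] by simp
qed

lemma integrable_P:
  fixes f :: "_ \<Rightarrow> real"
  assumes f: "f \<in> borel_measurable (euclid_space p)"
  shows "integrable P f"
  unfolding finite_law_def integrable_distr_eq[OF meas_X f]
  by (rule integrable_point_measure_finite[OF J])

lemma integral_P: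
  fixes f :: "_ \<Rightarrow> real"
  assumes f: "f \<in> borel_measurable (euclid_space p)"
  shows "(\<integral>x. f x \<partial>P) = (\<Sum>j\<in>J. w j * f (X j))"
  unfolding finite_law_def
  by (subst integral_distr[OF meas_X f]) (use J w0 in \<open>auto simp: lebesgue_integral_point_measure_finite\<close>)

lemma square_integrable: "square_integrable_dist p P"
proof -
  have "(\<lambda>x. (x i)\<^sup>2) \<in> borel_measurable (euclid_space p)" if "i < p" for i
    unfolding euclid_space_def using that by simp
  then show ?thesis
    unfolding square_integrable_dist_def
    using prob_space_axioms sets_P by (intro conjI allI impI integrable_P)
qed

lemma coord_measurable: "i < p \<Longrightarrow> (\<lambda>x. x i) \<in> borel_measurable (euclid_space p)"
  unfolding euclid_space_def by simp

lemma integral_coord: "i < p \<Longrightarrow> (\<integral>x. x i \<partial>P) = (\<Sum>j\<in>J. w j * X j i)"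
  by (intro integral_P coord_measurable)

lemma cov_mat_P:
  assumes "\<And>i. i < p \<Longrightarrow> (\<Sum>j\<in>J. w j * X j i) = 0" "i < p" "i' < p"
  shows "cov_mat p P $$ (i, i') = (\<Sum>j\<in>J. w j * (X j i * X j i'))"
proof -
  have "cov_mat p P $$ (i, i') = (\<integral>x. x i * x i' \<partial>P)"
    using assms by (simp add: cov_mat_def integral_coord)
  also have "\<dots> = (\<Sum>j\<in>J. w j * (X j i * X j i'))"
    using assms by (intro integral_P borel_measurable_times coord_measurable)
  finally show ?thesis .
qed

definition obs :: "nat \<Rightarrow> (nat \<Rightarrow> 'a) \<Rightarrow> nat \<Rightarrow> nat \<Rightarrow> real" where
  "obs n Z = (\<lambda>l\<in>{..<n}. X (Z l))"

text \<open>Label sequences correspond to distinct atoms of the product measure, and the loss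
  dominates pointwise the finite sum of its values times the indicators of these atoms.\<close>

lemma risk_ge_sum:
  "ennreal (\<Sum>Z\<in>PiE {..<n} (\<lambda>_. J). (\<Prod>l<n. w (Z l)) * (op_norm (S (obs n Z) - cov_mat p P))\<^sup>2) \<le> risk n p S P"
proof -
  interpret product_sigma_finite "\<lambda>_. P" by standard
  let ?M = "PiM {..<n} (\<lambda>_. P)" and ?Z = "PiE {..<n} (\<lambda>_. J)"
  let ?g = "\<lambda>x. (op_norm (S x - cov_mat p P))\<^sup>2"
  have fin: "finite ?Z" using J by (intro finite_PiE) auto
  have eq: "{obs n Z} = PiE {..<n} (\<lambda>l. {X (Z l)})" if "Z \<in> ?Z" for Z
  proof -
    have "PiE {..<n} (\<lambda>l. {X (Z l)}) = PiE {..<n} (\<lambda>l. {obs n Z l})"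
      by (intro PiE_cong) (simp add: obs_def)
    also have "\<dots> = {obs n Z}" by (rule PiE_singleton) (simp add: obs_def extensional_def)
    finally show ?thesis ..
  qed
  have meas: "{obs n Z} \<in> sets ?M" if "Z \<in> ?Z" for Z
    unfolding eq[OF that]
  proof (rule sets_PiM_I_finite)
    fix l assume "l \<in> {..<n}"
    then have "Z l \<in> J" using that by auto
    then show "{X (Z l)} \<in> sets P" unfolding sets_P by (intro singleton_sets X)
  qed simp
  have em: "emeasure ?M {obs n Z} = ennreal (\<Prod>l<n. w (Z l))" if "Z \<in> ?Z" for Z
    unfolding eq[OF that]
  proof (subst emeasure_PiM)
    have Zl: "Z l \<in> J" if "l \<in> {..<n}" for l using that \<open>Z \<in> ?Z\<close> by auto
    then show "{X (Z l)} \<in> sets P" if "l \<in> {..<n}" for l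
      unfolding sets_P using that by (intro singleton_sets X) auto
    have "(\<Prod>l<n. emeasure P {X (Z l)}) = (\<Prod>l<n. ennreal (w (Z l)))"
      using Zl by (intro prod.cong refl emeasure_singleton) auto
    also have "\<dots> = ennreal (\<Prod>l<n. w (Z l))"
      using Zl w0 by (intro prod_ennreal) auto
    finally show "(\<Prod>l<n. emeasure P {X (Z l)}) = ennreal (\<Prod>l<n. w (Z l))" .
  qed simp
  have injo: "Z = Z'" if "Z \<in> ?Z" "Z' \<in> ?Z" "obs n Z = obs n Z'" for Z Z'
  proof (rule PiE_ext[OF that(1,2)])
    fix l assume l: "l \<in> {..<n}"
    then have "X (Z l) = X (Z' l)" using fun_cong[OF that(3), of l] by (simp add: obs_def)
    then show "Z l = Z' l" using inj that l by (auto simp: inj_on_def PiE_def Pi_def)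
  qed
  define g where "g = ?g"
  have g0: "0 \<le> g x" for x by (simp add: g_def)
  have "ennreal (\<Sum>Z\<in>?Z. (\<Prod>l<n. w (Z l)) * g (obs n Z))
    = (\<Sum>Z\<in>?Z. ennreal (g (obs n Z)) * emeasure ?M {obs n Z})"
  proof (subst sum_ennreal[symmetric])
    show "0 \<le> (\<Prod>l<n. w (Z l)) * g (obs n Z)" if "Z \<in> ?Z" for Z
      using that w0 g0 by (intro mult_nonneg_nonneg prod_nonneg) (auto simp: PiE_def Pi_def)
    show "(\<Sum>Z\<in>?Z. ennreal ((\<Prod>l<n. w (Z l)) * g (obs n Z))) = (\<Sum>Z\<in>?Z. ennreal (g (obs n Z)) * emeasure ?M {obs n Z})"
      by (intro sum.cong refl) (simp add: em mult.commute[of _ "g _"] ennreal_mult'[OF g0])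
  qed
  also have "\<dots> = (\<Sum>Z\<in>?Z. \<integral>\<^sup>+x. ennreal (g (obs n Z)) * indicator {obs n Z} x \<partial>?M)"
    by (intro sum.cong refl nn_integral_cmult_indicator[symmetric] meas)
  also have "\<dots> = (\<integral>\<^sup>+x. (\<Sum>Z\<in>?Z. ennreal (g (obs n Z)) * indicator {obs n Z} x) \<partial>?M)"
    by (intro nn_integral_sum[symmetric] borel_measurable_times_ennreal borel_measurable_const
        borel_measurable_indicator meas)
  also have "\<dots> \<le> (\<integral>\<^sup>+x. ennreal (g x) \<partial>?M)"
  proof (rule nn_integral_mono)
    fix x
    show "(\<Sum>Z\<in>?Z. ennreal (g (obs n Z)) * indicator {obs n Z} x) \<le> ennreal (g x)"
    proof (cases "\<exists>Z\<in>?Z. obs n Z = x")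
      case True
      then obtain Z0 where Z0: "Z0 \<in> ?Z" "obs n Z0 = x" by auto
      have "(\<Sum>Z\<in>?Z. ennreal (g (obs n Z)) * indicator {obs n Z} x)
        = (\<Sum>Z\<in>{Z0}. ennreal (g (obs n Z)) * indicator {obs n Z} x)"
        by (rule sum.mono_neutral_right[OF fin]) (use Z0 injo in \<open>auto simp: indicator_def\<close>)
      then show ?thesis using Z0 by simp
    next
      case False
      then have "(\<Sum>Z\<in>?Z. ennreal (g (obs n Z)) * indicator {obs n Z} x) = 0"
        by (intro sum.neutral) (auto simp: indicator_def)
      then show ?thesis by simp
    qed
  qed
  finally show ?thesis by (simp add: risk_def g_def)
qed

end

lemma minimax_risk_ge:
  assumes "\<And>S. S \<in> estimators n p \<Longrightarrow> \<exists>P\<in>P_class p \<alpha> M0 M \<rho>. ennreal B \<le> risk n p S P"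
  shows "ennreal B \<le> minimax_risk n p \<alpha> M0 M \<rho>"
  unfolding minimax_risk_def
proof (rule INF_greatest)
  fix S assume "S \<in> estimators n p"
  from assms[OF this] obtain P where "P \<in> P_class p \<alpha> M0 M \<rho>" "ennreal B \<le> risk n p S P" by auto
  then show "ennreal B \<le> (SUP P\<in>P_class p \<alpha> M0 M \<rho>. risk n p S P)" by (rule SUP_upper2)
qed

text \<open>
  An atom of mass \<open>3/4\<close> at the mean absorbs the constant in front of a Chernoff bound: the tail
  bound \<open>exp (- t\<^sup>2 \<rho> / 2)\<close> of the class has constant one and must hold for small \<open>t\<close> as well.
\<close>

definition lazy_weight :: "('c \<Rightarrow> real) \<Rightarrow> 'c option \<Rightarrow> real" where
  "lazy_weight q z = (case z of None \<Rightarrow> 3 / 4 | Some c \<Rightarrow> q c / 4)"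

definition lazy_pt :: "nat \<Rightarrow> real \<Rightarrow> ('c \<Rightarrow> nat \<Rightarrow> real) \<Rightarrow> 'c option \<Rightarrow> nat \<Rightarrow> real" where
  "lazy_pt p r Y z = (\<lambda>i\<in>{..<p}. case z of None \<Rightarrow> 0 | Some c \<Rightarrow> r * Y c i)"

definition lazy_set :: "'c set \<Rightarrow> 'c option set" where
  "lazy_set K = insert None (Some ` K)"

definition lazy_law :: "nat \<Rightarrow> 'c set \<Rightarrow> ('c \<Rightarrow> real) \<Rightarrow> real \<Rightarrow> ('c \<Rightarrow> nat \<Rightarrow> real) \<Rightarrow> (nat \<Rightarrow> real) measure" where
  "lazy_law p K q r Y = finite_law p (lazy_set K) (lazy_weight q) (lazy_pt p r Y)"

lemma sum_lazy_set:
  fixes f :: "'c option \<Rightarrow> real"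
  shows "finite K \<Longrightarrow> (\<Sum>z\<in>lazy_set K. f z) = f None + (\<Sum>c\<in>K. f (Some c))"
  unfolding lazy_set_def by (subst sum.insert) (auto simp: sum.reindex)

text \<open>The constants fit the lazy weights: the two-sided Chernoff bound gives a factor 2 and
  \<open>mgf\<close> another 2, while the part away from the mean has mass \<open>1 / 4\<close>, so
  the tail constant is exactly one. \<open>nzY\<close> separates the other support points from the
  atom at the origin.\<close>

locale lazy_law_setup =
  fixes p :: nat and K :: "'c set" and q :: "'c \<Rightarrow> real" and r :: real and Y :: "'c \<Rightarrow> nat \<Rightarrow> real"
  assumes p: "0 < p" and K: "finite K" and q0: "\<And>c. c \<in> K \<Longrightarrow> 0 \<le> q c" and q1: "(\<Sum>c\<in>K. q c) = 1" and r: "0 < r"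
    and injY: "\<And>c c'. c \<in> K \<Longrightarrow> c' \<in> K \<Longrightarrow> (\<And>i. i < p \<Longrightarrow> Y c i = Y c' i) \<Longrightarrow> c = c'"
    and nzY: "\<And>c. c \<in> K \<Longrightarrow> \<exists>i<p. Y c i \<noteq> 0"
    and mean: "\<And>i. i < p \<Longrightarrow> (\<Sum>c\<in>K. q c * Y c i) = 0"
    and mgf: "\<And>v l. sqn p v = 1 \<Longrightarrow> (\<Sum>c\<in>K. q c * exp (l * (\<Sum>i<p. v i * Y c i))) \<le> 2 * exp (l\<^sup>2)"
begin

sublocale finite_law_setup p "lazy_set K" "lazy_weight q" "lazy_pt p r Y"
proof
  show "finite (lazy_set K)" using K by (simp add: lazy_set_def)
  show "0 \<le> lazy_weight q j" if "j \<in> lazy_set K" for j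
    using that q0 by (auto simp: lazy_set_def lazy_weight_def)
  show "(\<Sum>j\<in>lazy_set K. lazy_weight q j) = 1"
    using q1 K by (simp add: sum_lazy_set lazy_weight_def flip: sum_divide_distrib)
  show "lazy_pt p r Y j \<in> extensional {..<p}" for j
    by (simp add: lazy_pt_def)
  show "inj_on (lazy_pt p r Y) (lazy_set K)"
  proof (rule inj_onI)
    fix z z' assume z: "z \<in> lazy_set K" "z' \<in> lazy_set K" and eq: "lazy_pt p r Y z = lazy_pt p r Y z'"
    have e: "(case z of None \<Rightarrow> 0 | Some c \<Rightarrow> r * Y c i) = (case z' of None \<Rightarrow> 0 | Some c \<Rightarrow> r * Y c i)"
      if "i < p" for i
      using fun_cong[OF eq, of i] that by (simp add: lazy_pt_def)
    show "z = z'"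
    proof (cases z)
      case None
      show ?thesis
      proof (cases z')
        case (Some c')
        then have "c' \<in> K" using z by (auto simp: lazy_set_def)
        then obtain i where i: "i < p" "Y c' i \<noteq> 0" using nzY by blast
        with e[of i] None Some r show ?thesis by simp
      qed (use None in simp)
    next
      case (Some c)
      then have c: "c \<in> K" using z by (auto simp: lazy_set_def)
      show ?thesis
      proof (cases z')
        case None
        obtain i where i: "i < p" "Y c i \<noteq> 0" using nzY c by blast
        with e[of i] None Some r show ?thesis by simp
      next
        case (Some c')
        then have c': "c' \<in> K" using z by (auto simp: lazy_set_def)
        have "Y c i = Y c' i" if "i < p" for i
          using e[OF that] \<open>z = Some c\<close> Some r by simp
        then show ?thesis using injY[OF c c'] \<open>z = Some c\<close> Some by simp
      qed
    qed
  qed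
qed

definition S :: "nat \<Rightarrow> nat \<Rightarrow> real" where
  "S i j = (\<Sum>c\<in>K. q c * (Y c i * Y c j))"

lemma mean_zero: "i < p \<Longrightarrow> (\<Sum>j\<in>lazy_set K. lazy_weight q j * lazy_pt p r Y j i) = 0"
proof -
  assume i: "i < p"
  have "(\<Sum>j\<in>lazy_set K. lazy_weight q j * lazy_pt p r Y j i) = r / 4 * (\<Sum>c\<in>K. q c * Y c i)"
    using i K by (simp add: sum_lazy_set lazy_weight_def lazy_pt_def sum_distrib_left mult_ac)
  then show ?thesis using mean[OF i] by simp
qed

lemma cov: "i < p \<Longrightarrow> j < p \<Longrightarrow> cov_mat p (lazy_law p K q r Y) $$ (i, j) = r\<^sup>2 / 4 * S i j"
  unfolding lazy_law_def
  by (subst cov_mat_P[OF mean_zero])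
    (use K in \<open>simp_all add: sum_lazy_set lazy_weight_def lazy_pt_def S_def sum_distrib_left power2_eq_square mult_ac\<close>)

lemma sub_gaussian_lazy:
  assumes \<rho>: "0 < \<rho>" "r\<^sup>2 \<le> 1 / (2 * \<rho>)"
  shows "sub_gaussian p \<rho> (lazy_law p K q r Y)"
  unfolding sub_gaussian_def
proof (intro allI impI ballI)
  fix t :: real and v :: "real Matrix.vec"
  assume t: "0 < t" and v: "v \<in> carrier_vec p" "l2_norm v = 1"
  have v1: "sqn p (\<lambda>i. v $ i) = 1" using v l2_norm_eq_1_iff by auto
  define lv where "lv x = (\<Sum>i<p. v $ i * x i)" for x :: "nat \<Rightarrow> real"
  have mz: "(\<integral>x. x i \<partial>P) = 0" if "i < p" for i
    using integral_coord[OF that] mean_zero[OF that] by simp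
  have sp: "scalar_prod v (Matrix.vec p x - mean_vec p P) = lv x" for x
    using mz by (auto simp: scalar_prod_def lv_def mean_vec_def atLeast0LessThan intro!: sum.cong)
  have lvm: "lv \<in> borel_measurable (euclid_space p)"
    unfolding lv_def by (intro borel_measurable_sum borel_measurable_times borel_measurable_const coord_measurable) auto
  have A: "{x \<in> space P. \<bar>lv x\<bar> > t} \<in> sets (euclid_space p)"
    unfolding space_P using lvm by measurable
  have lvX: "lv (lazy_pt p r Y (Some c)) = r * (\<Sum>i<p. v $ i * Y c i)" for c
    unfolding lv_def by (simp add: lazy_pt_def sum_distrib_left mult_ac)
  have lv0: "lv (lazy_pt p r Y None) = 0"
    unfolding lv_def by (simp add: lazy_pt_def)
  \<comment> \<open>The minimiser of \<open>l\<^sup>2 - l * t / r\<close>, with value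
    \<open>- l\<^sup>2\<close>; the bound on \<open>r\<^sup>2\<close> makes this at most
    \<open>- (t\<^sup>2 * \<rho> / 2)\<close>.\<close>
  define l where "l = t / (2 * r)"
  have l: "0 < l" "l * (t / r) = 2 * l\<^sup>2" using t r by (auto simp: l_def power2_eq_square field_simps)
  let ?L = "\<lambda>c. \<Sum>i<p. v $ i * Y c i"
  have ind: "(if \<bar>r * ?L c\<bar> > t then 1 else 0) \<le> exp (- (2 * l\<^sup>2)) * (exp (l * ?L c) + exp (- l * ?L c))" for c
  proof (cases "\<bar>r * ?L c\<bar> > t")
    case True
    then have "t / r < \<bar>?L c\<bar>" using r by (simp add: abs_mult field_simps)
    then have "2 * l\<^sup>2 \<le> l * \<bar>?L c\<bar>" using l by (metis less_imp_le mult_left_mono)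
    then have "1 \<le> exp (- (2 * l\<^sup>2)) * exp (l * \<bar>?L c\<bar>)" by (simp flip: exp_add)
    also have "\<dots> \<le> exp (- (2 * l\<^sup>2)) * (exp (l * ?L c) + exp (- l * ?L c))"
      by (intro mult_left_mono) (auto simp: abs_if)
    finally show ?thesis using True by simp
  next
    case False
    have "0 \<le> exp (- (2 * l\<^sup>2)) * (exp (l * ?L c) + exp (- l * ?L c))"
      by (intro mult_nonneg_nonneg add_nonneg_nonneg) auto
    with False show ?thesis by simp
  qed
  have "measure P {x \<in> space P. \<bar>lv x\<bar> > t}
    = (\<Sum>j\<in>lazy_set K. if \<bar>lv (lazy_pt p r Y j)\<bar> > t then lazy_weight q j else 0)"
    unfolding measure_P[OF A]
    by (subst sum.inter_filter[symmetric])
      (use K X_space space_P in \<open>auto simp: lazy_set_def intro!: sum.cong\<close>)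
  \<comment> \<open>The atom at the mean drops out because \<open>t\<close> is positive.\<close>
  also have "\<dots> = (\<Sum>c\<in>K. if \<bar>r * ?L c\<bar> > t then q c / 4 else 0)"
    using t K by (auto simp: sum_lazy_set lvX lv0 lazy_weight_def intro!: sum.cong)
  also have "\<dots> = (\<Sum>c\<in>K. q c / 4 * (if \<bar>r * ?L c\<bar> > t then 1 else 0))"
    by (intro sum.cong) auto
  also have "\<dots> \<le> (\<Sum>c\<in>K. q c / 4 * (exp (- (2 * l\<^sup>2)) * (exp (l * ?L c) + exp (- l * ?L c))))"
    by (intro sum_mono mult_left_mono ind) (use q0 in auto)
  also have "\<dots> = exp (- (2 * l\<^sup>2)) / 4 * ((\<Sum>c\<in>K. q c * exp (l * ?L c)) + (\<Sum>c\<in>K. q c * exp (- l * ?L c)))"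
    by (simp add: sum_distrib_left distrib_left sum.distrib mult_ac)
  also have "\<dots> \<le> exp (- (2 * l\<^sup>2)) / 4 * (2 * exp (l\<^sup>2) + 2 * exp ((- l)\<^sup>2))"
    by (intro mult_left_mono add_mono mgf v1) auto
  also have "\<dots> = exp (- l\<^sup>2)"
    by (simp flip: exp_add)
  also have "\<dots> \<le> exp (- (t\<^sup>2 * \<rho> / 2))"
  proof -
    have "t\<^sup>2 * \<rho> / 2 = t\<^sup>2 / (4 * r\<^sup>2) * (r\<^sup>2 * (2 * \<rho>))" using r by simp
    also have "\<dots> \<le> t\<^sup>2 / (4 * r\<^sup>2) * 1"
      using \<rho> by (intro mult_left_mono) (auto simp: field_simps)
    also have "\<dots> = l\<^sup>2" by (simp add: l_def power_divide power_mult_distrib)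
    finally show ?thesis by simp
  qed
  finally show "measure (lazy_law p K q r Y)
      {x \<in> space (lazy_law p K q r Y). \<bar>scalar_prod v (Matrix.vec p x - mean_vec p (lazy_law p K q r Y))\<bar> > t}
    \<le> exp (- (t\<^sup>2 * \<rho> / 2))"
    unfolding lazy_law_def sp .
qed

text \<open>Row sums stand in for eigenvalues, and \<open>m\<close> names the uncorrelated
  coordinate that furnishes an eigenvalue in \<open>lambda_max_le\<close>. The factor
  \<open>1 / 4\<close> of the covariance is given away.\<close>

lemma lazy_P_class:
  assumes \<rho>: "0 < \<rho>" "r\<^sup>2 \<le> 1 / (2 * \<rho>)"
    and m: "m < p" "\<And>i. i < p \<Longrightarrow> i \<noteq> m \<Longrightarrow> S i m = 0"
    and row: "\<And>i. i < p \<Longrightarrow> r\<^sup>2 * (\<Sum>j<p. \<bar>S i j\<bar>) \<le> M0"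
    and far: "\<And>k j. 1 \<le> k \<Longrightarrow> j < p \<Longrightarrow>
      r\<^sup>2 * (\<Sum>i | i < p \<and> \<bar>int i - int j\<bar> > int k. \<bar>S i j\<bar>) \<le> M * real k powr (- \<alpha>)"
  shows "lazy_law p K q r Y \<in> P_class p \<alpha> M0 M \<rho>"
proof -
  let ?P = "lazy_law p K q r Y"
  have C: "cov_mat p ?P \<in> carrier_mat p p" by (simp add: cov_mat_def)
  have sq: "square_integrable_dist p ?P" using square_integrable by (simp add: lazy_law_def)
  have quarter: "x / 4 \<le> y" if "0 \<le> x" "x \<le> y" for x y :: real using that by simp
  have "lambda_max (cov_mat p ?P) \<le> M0"
  proof (rule lambda_max_le[OF C m(1)])
    fix i assume i: "i < p"
    show "cov_mat p ?P $$ (i, m) = 0" if "i \<noteq> m" using i that m by (simp add: cov)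
    have "(\<Sum>j<p. \<bar>cov_mat p ?P $$ (i, j)\<bar>) = (r\<^sup>2 * (\<Sum>j<p. \<bar>S i j\<bar>)) / 4"
      using i by (simp add: cov abs_mult sum_distrib_left sum_divide_distrib)
    also have "\<dots> \<le> M0" by (intro quarter row i mult_nonneg_nonneg sum_nonneg) auto
    finally show "(\<Sum>j<p. \<bar>cov_mat p ?P $$ (i, j)\<bar>) \<le> M0" .
  qed
  moreover have "(MAX j\<in>{..<p}. \<Sum>i | i < p \<and> \<bar>int i - int j\<bar> > int k. \<bar>cov_mat p ?P $$ (i, j)\<bar>) \<le> M * real k powr (- \<alpha>)"
    if k: "1 \<le> k" for k
  proof (subst Max_le_iff)
    show "\<forall>a\<in>(\<lambda>j. \<Sum>i | i < p \<and> \<bar>int i - int j\<bar> > int k. \<bar>cov_mat p ?P $$ (i, j)\<bar>) ` {..<p}. a \<le> M * real k powr (- \<alpha>)"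
    proof safe
      fix j assume j: "j < p"
      have "(\<Sum>i | i < p \<and> \<bar>int i - int j\<bar> > int k. \<bar>cov_mat p ?P $$ (i, j)\<bar>)
        = (r\<^sup>2 * (\<Sum>i | i < p \<and> \<bar>int i - int j\<bar> > int k. \<bar>S i j\<bar>)) / 4"
        using j by (simp add: cov abs_mult sum_distrib_left sum_divide_distrib)
      also have "\<dots> \<le> M * real k powr (- \<alpha>)" by (intro quarter far k j mult_nonneg_nonneg sum_nonneg) auto
      finally show "(\<Sum>i | i < p \<and> \<bar>int i - int j\<bar> > int k. \<bar>cov_mat p ?P $$ (i, j)\<bar>) \<le> M * real k powr (- \<alpha>)" .
    qed
  qed (use p in auto)
  ultimately have "cov_mat p ?P \<in> F_class p \<alpha> M0 M"
    unfolding F_class_def covariance_matrices_def using sq by blast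
  then show ?thesis unfolding P_class_def using sq sub_gaussian_lazy[OF \<rho>] by simp
qed

end

section \<open>Lower bound of order log p / n\<close>

lemma sum_PiE_power:
  fixes f :: "'a \<Rightarrow> real"
  assumes "finite J"
  shows "(\<Sum>Z\<in>PiE {..<n} (\<lambda>_. J). \<Prod>l<n. f (Z l)) = (\<Sum>j\<in>J. f j) ^ n"
  using assms by (subst prod_sum_PiE[symmetric]) auto

text \<open>Termwise comparison of power series, by
  \<open>2 ^ n * fact n \<le> fact (2 * n)\<close>.\<close>

lemma cosh_le_exp_sq: "cosh x \<le> exp (x\<^sup>2 / 2)" for x :: real
proof -
  have s1: "(\<lambda>n. if even n then x ^ n /\<^sub>R fact n else 0) sums cosh x" by (rule cosh_converges)
  have "(\<lambda>n. x ^ (2 * n) / fact (2 * n)) sums cosh x"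
  proof -
    have "(\<lambda>n. if even (2 * n) then x ^ (2 * n) /\<^sub>R fact (2 * n) else 0) sums cosh x"
      by (subst sums_mono_reindex[of "\<lambda>n. 2 * n"]) (use s1 in \<open>auto simp: strict_mono_def elim!: evenE\<close>)
    then show ?thesis by (simp add: divide_inverse mult.commute)
  qed
  moreover have "(\<lambda>n. (x\<^sup>2 / 2) ^ n / fact n) sums exp (x\<^sup>2 / 2)"
    using exp_converges[of "x\<^sup>2 / 2"] by (simp add: field_simps)
  moreover have "x ^ (2 * n) / fact (2 * n) \<le> (x\<^sup>2 / 2) ^ n / fact n" for n
  proof -
    have "(2::real) ^ n * fact n \<le> fact (2 * n)"
    proof (induction n)
      case (Suc n)
      have "(2::real) ^ Suc n * fact (Suc n) = (2 * real (Suc n)) * (2 ^ n * fact n)" by simp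
      also have "\<dots> \<le> (2 * real (Suc n)) * (real (2 * n + 1) * fact (2 * n))"
      proof (intro mult_left_mono)
        have "1 * fact (2 * n) \<le> real (2 * n + 1) * fact (2 * n)" by (intro mult_right_mono) auto
        then show "2 ^ n * fact n \<le> real (2 * n + 1) * fact (2 * n)" using Suc by linarith
      qed auto
      also have "\<dots> = fact (2 * Suc n)" by (simp add: algebra_simps)
      finally show ?case .
    qed simp
    then have "x ^ (2 * n) / fact (2 * n) \<le> x ^ (2 * n) / (2 ^ n * fact n)"
      by (intro divide_left_mono) auto
    then show ?thesis by (simp add: power_mult power_divide)
  qed
  ultimately show ?thesis by (rule sums_le[rotated])
qed

text \<open>Le Cam's method for one law against a mixture, with likelihood ratios \<open>L m\<close>
  relative to \<open>F0\<close>. Where the base loss is below \<open>d\<^sup>2 / 4\<close>, every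
  alternative loses at least that much; so the base loss plus the averaged alternative losses is at
  least \<open>d\<^sup>2 / 4\<close> times the minimum of 1 and the averaged ratio.\<close>

lemma lecam_mixture:
  fixes F0 :: "'z \<Rightarrow> real" and L B t :: "nat \<Rightarrow> 'z \<Rightarrow> real" and A :: "'z \<Rightarrow> real"
  assumes fin: "finite \<Omega>" and p: "0 < p"
    and F0: "\<And>Z. Z \<in> \<Omega> \<Longrightarrow> 0 \<le> F0 Z"
    and L0: "\<And>m Z. m < p \<Longrightarrow> Z \<in> \<Omega> \<Longrightarrow> 0 \<le> L m Z"
    and L1: "\<And>m. m < p \<Longrightarrow> (\<Sum>Z\<in>\<Omega>. F0 Z * L m Z) = 1"
    and L2: "(\<Sum>Z\<in>\<Omega>. F0 Z * ((\<Sum>m<p. L m Z) / real p)\<^sup>2) \<le> 3"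
    and A: "\<And>m Z. m < p \<Longrightarrow> (t m Z)\<^sup>2 \<le> A Z"
    and B: "\<And>m Z. m < p \<Longrightarrow> (t m Z - d)\<^sup>2 \<le> B m Z"
    and d: "0 \<le> d"
  shows "d\<^sup>2 / 32 \<le> (\<Sum>Z\<in>\<Omega>. F0 Z * A Z) \<or> (\<exists>m<p. d\<^sup>2 / 32 \<le> (\<Sum>Z\<in>\<Omega>. F0 Z * L m Z * B m Z))"
proof (rule ccontr)
  assume "\<not> ?thesis"
  then have n1: "(\<Sum>Z\<in>\<Omega>. F0 Z * A Z) < d\<^sup>2 / 32"
    and n2: "\<And>m. m < p \<Longrightarrow> (\<Sum>Z\<in>\<Omega>. F0 Z * L m Z * B m Z) < d\<^sup>2 / 32" by auto
  define M where "M Z = (\<Sum>m<p. L m Z) / real p" for Z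
  \<comment> \<open>\<open>M - M\<^sup>2 / 4\<close> is below both 1 and \<open>M\<close>, and
    unlike their minimum its expectation follows from the moments \<open>L1\<close> and
    \<open>L2\<close>: it is at least \<open>1 - 3 / 4\<close>.\<close>
  have pt: "d\<^sup>2 / 4 * (M Z - (M Z)\<^sup>2 / 4) \<le> A Z + (\<Sum>m<p. L m Z * B m Z) / real p" if Z: "Z \<in> \<Omega>" for Z
  proof -
    have M0: "0 \<le> M Z" unfolding M_def using L0 Z by (intro divide_nonneg_nonneg sum_nonneg) auto
    have A0: "0 \<le> A Z" using A[OF p, of Z] by (meson order_trans zero_le_power2)
    have B0: "0 \<le> B m Z" if "m < p" for m using B[OF that, of Z] by (meson order_trans zero_le_power2)
    show ?thesis
    proof (cases "d\<^sup>2 / 4 \<le> A Z")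
      case True
      have "M Z - (M Z)\<^sup>2 / 4 \<le> 1"
        using sum_squares_bound[of "M Z / 2" 1] by (simp add: power_divide)
      then have "d\<^sup>2 / 4 * (M Z - (M Z)\<^sup>2 / 4) \<le> d\<^sup>2 / 4 * 1" by (intro mult_left_mono) auto
      moreover have "0 \<le> (\<Sum>m<p. L m Z * B m Z) / real p"
        using L0 Z B0 by (intro divide_nonneg_nonneg sum_nonneg mult_nonneg_nonneg) auto
      ultimately show ?thesis using True by linarith
    next
      case False
      have "d\<^sup>2 / 4 \<le> B m Z" if m: "m < p" for m
      proof -
        have "(t m Z)\<^sup>2 \<le> (d / 2)\<^sup>2" using A[OF m, of Z] False by (simp add: power_divide)
        then have "\<bar>t m Z\<bar> \<le> \<bar>d / 2\<bar>" by (simp only: abs_le_square_iff)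
        then have "\<bar>d / 2\<bar> \<le> \<bar>t m Z - d\<bar>" using d by linarith
        then have "(d / 2)\<^sup>2 \<le> (t m Z - d)\<^sup>2" by (simp only: abs_le_square_iff)
        then show ?thesis using B[OF m, of Z] by (simp add: power_divide)
      qed
      then have "(\<Sum>m<p. L m Z * (d\<^sup>2 / 4)) / real p \<le> (\<Sum>m<p. L m Z * B m Z) / real p"
        using L0 Z by (intro divide_right_mono sum_mono mult_left_mono) auto
      also have "(\<Sum>m<p. L m Z * (d\<^sup>2 / 4)) / real p = d\<^sup>2 / 4 * M Z"
        unfolding M_def sum_distrib_right[symmetric] by simp
      finally have 1: "d\<^sup>2 / 4 * M Z \<le> (\<Sum>m<p. L m Z * B m Z) / real p" .
      have "d\<^sup>2 / 4 * (M Z - (M Z)\<^sup>2 / 4) \<le> d\<^sup>2 / 4 * M Z"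
        by (intro mult_left_mono) auto
      then show ?thesis using 1 A0 by linarith
    qed
  qed
  have "d\<^sup>2 / 4 * (1 - 3 / 4) \<le> d\<^sup>2 / 4 * ((\<Sum>Z\<in>\<Omega>. F0 Z * M Z) - (\<Sum>Z\<in>\<Omega>. F0 Z * (M Z)\<^sup>2) / 4)"
  proof (rule mult_left_mono)
    have "(\<Sum>Z\<in>\<Omega>. F0 Z * M Z) = (\<Sum>Z\<in>\<Omega>. \<Sum>m<p. F0 Z * L m Z) / real p"
      unfolding M_def by (simp add: sum_distrib_left sum_divide_distrib)
    also have "(\<Sum>Z\<in>\<Omega>. \<Sum>m<p. F0 Z * L m Z) = (\<Sum>m<p. \<Sum>Z\<in>\<Omega>. F0 Z * L m Z)" by (rule sum.swap)
    also have "\<dots> = real p" using L1 by simp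
    finally have "(\<Sum>Z\<in>\<Omega>. F0 Z * M Z) = 1" using p by simp
    then show "1 - 3 / 4 \<le> (\<Sum>Z\<in>\<Omega>. F0 Z * M Z) - (\<Sum>Z\<in>\<Omega>. F0 Z * (M Z)\<^sup>2) / 4"
      using L2 unfolding M_def by linarith
  qed auto
  also have "\<dots> = (\<Sum>Z\<in>\<Omega>. F0 Z * (d\<^sup>2 / 4 * (M Z - (M Z)\<^sup>2 / 4)))"
    by (simp add: sum_distrib_left sum_subtractf sum_divide_distrib algebra_simps)
  also have "\<dots> \<le> (\<Sum>Z\<in>\<Omega>. F0 Z * (A Z + (\<Sum>m<p. L m Z * B m Z) / real p))"
    by (intro sum_mono mult_left_mono pt F0)
  also have "\<dots> = (\<Sum>Z\<in>\<Omega>. F0 Z * A Z) + (\<Sum>Z\<in>\<Omega>. \<Sum>m<p. F0 Z * L m Z * B m Z) / real p"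
    by (simp add: distrib_left sum.distrib sum_distrib_left sum_divide_distrib mult_ac)
  also have "(\<Sum>Z\<in>\<Omega>. \<Sum>m<p. F0 Z * L m Z * B m Z) = (\<Sum>m<p. \<Sum>Z\<in>\<Omega>. F0 Z * L m Z * B m Z)"
    by (rule sum.swap)
  also have "(\<Sum>m<p. \<Sum>Z\<in>\<Omega>. F0 Z * L m Z * B m Z) \<le> (\<Sum>m<p. d\<^sup>2 / 32)"
    by (intro sum_mono) (use n2 in \<open>auto intro: less_imp_le\<close>)
  also have "(\<Sum>Z\<in>\<Omega>. F0 Z * A Z) + (\<Sum>m<p. d\<^sup>2 / 32) / real p < d\<^sup>2 / 32 + d\<^sup>2 / 32"
    using n1 p by simp
  finally show False using p by (simp add: divide_right_mono)
qed

section \<open>Product laws with one tilted variance\<close>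

definition four_pts :: "real set" where
  "four_pts = {-1, -1/2, 1/2, 1}"

text \<open>An even sign with mean zero under the uniform law on the four points: tilting by it
  changes the variance but neither the mass nor the mean.\<close>

definition spread :: "real \<Rightarrow> real" where
  "spread y = (if \<bar>y\<bar> = 1 then 1 else -1)"

definition diag_weight :: "nat \<Rightarrow> (nat \<Rightarrow> real) \<Rightarrow> (nat \<Rightarrow> real) \<Rightarrow> real" where
  "diag_weight p e c = (\<Prod>i<p. (1 + 2 * e i * spread (c i)) / 4)"

abbreviation diag_pts :: "nat \<Rightarrow> (nat \<Rightarrow> real) set" where
  "diag_pts p \<equiv> PiE {..<p} (\<lambda>_. four_pts)"

lemma sum_four_pts: "(\<Sum>y\<in>four_pts. f y) = f (-1) + f (-1/2) + f (1/2) + f 1" for f :: "real \<Rightarrow> real"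
  by (simp add: four_pts_def)

lemma half_add_half: "(1 + 2 * a) / 2 + (1 - 2 * a) / 2 = (1::real)"
  by (simp add: field_simps)

lemma quarter_mean: "(- 1 - 2 * a) / 4 + (1 + 2 * a) / 4 = (0::real)"
  by (simp add: field_simps)

lemma sum_diag_weight:
  "(\<Sum>c\<in>diag_pts p. diag_weight p e c * (\<Prod>i<p. f i (c i)))
    = (\<Prod>i<p. \<Sum>y\<in>four_pts. (1 + 2 * e i * spread y) / 4 * f i y)"
  unfolding diag_weight_def prod.distrib[symmetric]
  by (subst prod_sum_PiE) (auto simp: four_pts_def)

lemma sum_diag_weight_1: "(\<Sum>c\<in>diag_pts p. diag_weight p e c) = 1"
  using sum_diag_weight[of p e "\<lambda>_ _. 1"] by (simp add: sum_four_pts spread_def half_add_half)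

lemma prod_if_single:
  fixes g :: "nat \<Rightarrow> real"
  assumes "m < p" "\<And>i. i < p \<Longrightarrow> i \<noteq> m \<Longrightarrow> g i = 1"
  shows "(\<Prod>i<p. g i) = g m"
proof -
  have "(\<Prod>i<p. g i) = g m * (\<Prod>i\<in>{..<p} - {m}. g i)" using assms by (subst prod.remove[of _ m]) auto
  also have "(\<Prod>i\<in>{..<p} - {m}. g i) = 1" using assms by (intro prod.neutral) auto
  finally show ?thesis by simp
qed

lemma prod_if_double:
  fixes h :: "nat \<Rightarrow> real"
  assumes m: "m < p" "m' < p" "m \<noteq> m'" and one: "\<And>i. i < p \<Longrightarrow> i \<noteq> m \<Longrightarrow> i \<noteq> m' \<Longrightarrow> h i = 1"
  shows "(\<Prod>i<p. h i) = h m * h m'"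
proof -
  have "(\<Prod>i<p. h i) = h m * (h m' * (\<Prod>i\<in>{..<p} - {m} - {m'}. h i))"
    using m by (subst prod.remove[of _ m], simp, simp, subst prod.remove[of _ m']) auto
  also have "(\<Prod>i\<in>{..<p} - {m} - {m'}. h i) = 1" using one by (intro prod.neutral) auto
  finally show ?thesis by simp
qed

lemma sum_diag_weight_single:
  assumes m: "m < p"
  shows "(\<Sum>c\<in>diag_pts p. diag_weight p e c * f (c m)) = (\<Sum>y\<in>four_pts. (1 + 2 * e m * spread y) / 4 * f y)"
proof -
  let ?f = "\<lambda>i y. if i = m then f y else 1"
  have "(\<Prod>i<p. ?f i (c i)) = f (c m)" for c
    using m prod_if_single[of m p "\<lambda>i. ?f i (c i)"] by auto
  then have "(\<Sum>c\<in>diag_pts p. diag_weight p e c * f (c m))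
      = (\<Prod>i<p. \<Sum>y\<in>four_pts. (1 + 2 * e i * spread y) / 4 * ?f i y)"
    using sum_diag_weight[of p e ?f] by simp
  also have "\<dots> = (\<Sum>y\<in>four_pts. (1 + 2 * e m * spread y) / 4 * ?f m y)"
    by (rule prod_if_single[OF m]) (simp add: sum_four_pts spread_def half_add_half)
  finally show ?thesis by simp
qed

lemma sum_diag_weight_double:
  assumes m: "m < p" "m' < p" "m \<noteq> m'"
  shows "(\<Sum>c\<in>diag_pts p. diag_weight p e c * (f (c m) * g (c m')))
    = (\<Sum>y\<in>four_pts. (1 + 2 * e m * spread y) / 4 * f y) * (\<Sum>y\<in>four_pts. (1 + 2 * e m' * spread y) / 4 * g y)"
proof -
  let ?f = "\<lambda>i y. if i = m then f y else if i = m' then g y else 1"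
  have "(\<Prod>i<p. ?f i (c i)) = f (c m) * g (c m')" for c
    using prod_if_double[OF m, of "\<lambda>i. ?f i (c i)"] m by auto
  then have "(\<Sum>c\<in>diag_pts p. diag_weight p e c * (f (c m) * g (c m')))
      = (\<Prod>i<p. \<Sum>y\<in>four_pts. (1 + 2 * e i * spread y) / 4 * ?f i y)"
    using sum_diag_weight[of p e ?f] by simp
  also have "\<dots> = (\<Sum>y\<in>four_pts. (1 + 2 * e m * spread y) / 4 * ?f m y) * (\<Sum>y\<in>four_pts. (1 + 2 * e m' * spread y) / 4 * ?f m' y)"
    by (rule prod_if_double[OF m]) (simp add: sum_four_pts spread_def half_add_half)
  finally show ?thesis using m by simp
qed

lemma diag_law_setup:
  fixes r :: real
  assumes p: "0 < p" and r: "0 < r" and e: "\<And>i. i < p \<Longrightarrow> 0 \<le> e i \<and> e i \<le> 1 / 4"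
  shows "lazy_law_setup p (diag_pts p) (diag_weight p e) r (\<lambda>c. c)"
proof
  show "finite (diag_pts p)" by (intro finite_PiE) (auto simp: four_pts_def)
  show "0 \<le> diag_weight p e c" for c
    unfolding diag_weight_def
  proof (intro prod_nonneg ballI)
    fix i assume "i \<in> {..<p}"
    then show "0 \<le> (1 + 2 * e i * spread (c i)) / 4" using e[of i] by (simp add: spread_def)
  qed
  show "(\<Sum>c\<in>diag_pts p. diag_weight p e c) = 1" by (rule sum_diag_weight_1)
  show "c = c'" if "c \<in> diag_pts p" "c' \<in> diag_pts p" "\<And>i. i < p \<Longrightarrow> c i = c' i" for c c'
    by (rule PiE_ext[OF that(1,2)]) (use that(3) in auto)
  show "\<exists>i<p. c i \<noteq> 0" if "c \<in> diag_pts p" for c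
    using that p by (intro exI[of _ 0]) (auto simp: four_pts_def PiE_def Pi_def)
  show "(\<Sum>c\<in>diag_pts p. diag_weight p e c * c i) = 0" if "i < p" for i
    using sum_diag_weight_single[OF that, of e "\<lambda>y. y"] by (simp add: sum_four_pts spread_def quarter_mean)
  fix v :: "nat \<Rightarrow> real" and l :: real
  assume v: "sqn p v = 1"
  have "(\<Sum>c\<in>diag_pts p. diag_weight p e c * exp (l * (\<Sum>i<p. v i * c i)))
    = (\<Sum>c\<in>diag_pts p. diag_weight p e c * (\<Prod>i<p. exp (l * v i * c i)))"
    by (simp add: exp_sum[symmetric] sum_distrib_left mult.assoc)
  also have "\<dots> = (\<Prod>i<p. \<Sum>y\<in>four_pts. (1 + 2 * e i * spread y) / 4 * exp (l * v i * y))"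
    by (rule sum_diag_weight)
  also have "\<dots> \<le> (\<Prod>i<p. exp ((l * v i)\<^sup>2 / 2))"
  proof (rule prod_mono, intro conjI)
    fix i assume i: "i \<in> {..<p}"
    show "0 \<le> (\<Sum>y\<in>four_pts. (1 + 2 * e i * spread y) / 4 * exp (l * v i * y))"
      using e[of i] i by (intro sum_nonneg mult_nonneg_nonneg) (auto simp: spread_def)
    let ?x = "l * v i"
    \<comment> \<open>The tilt only moves mass between the inner and the outer pair, and the outer
      pair has the larger transform \<open>cosh ?x\<close>. The absolute values are there because
      \<open>cosh\<close> is monotone on the nonnegative half-line.\<close>
    have "cosh \<bar>?x / 2\<bar> \<le> cosh \<bar>?x\<bar>" by (subst cosh_real_nonneg_le_iff) auto
    then have "cosh (?x / 2) \<le> cosh ?x" by (simp only: cosh_real_abs)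
    then have "(1 - 2 * e i) * cosh (?x / 2) \<le> (1 - 2 * e i) * cosh ?x"
      using e[of i] i by (intro mult_left_mono) auto
    moreover have "(\<Sum>y\<in>four_pts. (1 + 2 * e i * spread y) / 4 * exp (?x * y))
      = ((1 - 2 * e i) * cosh (?x / 2) + (1 + 2 * e i) * cosh ?x) / 2"
      by (simp add: sum_four_pts spread_def cosh_def field_simps)
    ultimately have "(\<Sum>y\<in>four_pts. (1 + 2 * e i * spread y) / 4 * exp (?x * y)) \<le> cosh ?x"
      by (simp add: algebra_simps)
    then show "(\<Sum>y\<in>four_pts. (1 + 2 * e i * spread y) / 4 * exp (?x * y)) \<le> exp (?x\<^sup>2 / 2)"
      using cosh_le_exp_sq[of ?x] by linarith
  qed
  also have "\<dots> = exp (l\<^sup>2 / 2)"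
    using v by (simp add: exp_sum[symmetric] power_mult_distrib sum_distrib_left[symmetric] sum_divide_distrib[symmetric] sqn_def)
  also have "\<dots> \<le> 2 * exp (l\<^sup>2)"
  proof -
    have "exp (l\<^sup>2 / 2) \<le> exp (l\<^sup>2)" by simp
    then show ?thesis by (smt (verit) exp_gt_zero)
  qed
  finally show "(\<Sum>c\<in>diag_pts p. diag_weight p e c * exp (l * (\<Sum>i<p. v i * c i))) \<le> 2 * exp (l\<^sup>2)" .
qed (use p r in auto)

lemma diag_law_S:
  fixes r :: real
  assumes p: "0 < p" and r: "0 < r" and e: "\<And>i. i < p \<Longrightarrow> 0 \<le> e i \<and> e i \<le> 1 / 4" and ij: "i < p" "j < p"
  shows "lazy_law_setup.S (diag_pts p) (diag_weight p e) (\<lambda>c. c) i j = (if i = j then 5 / 8 + 3 / 4 * e i else 0)"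
proof -
  interpret lazy_law_setup p "diag_pts p" "diag_weight p e" r "\<lambda>c. c" by (rule diag_law_setup[OF p r e])
  show ?thesis
  proof (cases "i = j")
    case True
    then show ?thesis unfolding S_def
      using sum_diag_weight_single[OF ij(1), of e "\<lambda>y. y * y"] by (simp add: sum_four_pts spread_def field_simps)
  next
    case False
    then show ?thesis unfolding S_def
      using sum_diag_weight_double[OF ij False, of e "\<lambda>y. y" "\<lambda>y. y"] by (simp add: sum_four_pts spread_def quarter_mean)
  qed
qed

lemma diag_law_P_class:
  assumes p: "0 < p" and r: "0 < r" and e: "\<And>i. i < p \<Longrightarrow> 0 \<le> e i \<and> e i \<le> 1 / 4"
    and \<rho>: "0 < \<rho>" "r\<^sup>2 \<le> 1 / (2 * \<rho>)" "r\<^sup>2 \<le> M0" and M: "0 < M"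
  shows "lazy_law p (diag_pts p) (diag_weight p e) r (\<lambda>c. c) \<in> P_class p \<alpha> M0 M \<rho>"
proof -
  interpret lazy_law_setup p "diag_pts p" "diag_weight p e" r "\<lambda>c. c" by (rule diag_law_setup[OF p r e])
  have Sij: "S i j = (if i = j then 5 / 8 + 3 / 4 * e i else 0)" if "i < p" "j < p" for i j
    by (rule diag_law_S[OF p r _ that]) (use e in auto)
  show ?thesis
  proof (rule lazy_P_class[OF \<rho>(1,2) p])
    show "S i 0 = 0" if "i < p" "i \<noteq> 0" for i using Sij[OF that(1) p] that by simp
    show "r\<^sup>2 * (\<Sum>j<p. \<bar>S i j\<bar>) \<le> M0" if "i < p" for i
    proof -
      have "(\<Sum>j<p. \<bar>S i j\<bar>) = (\<Sum>j<p. if i = j then 5 / 8 + 3 / 4 * e i else 0)"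
        using e[OF that] that by (intro sum.cong refl) (auto simp: Sij[OF that])
      also have "\<dots> = 5 / 8 + 3 / 4 * e i" using that by simp
      also have "\<dots> \<le> 1" using e[OF that] by simp
      finally have "r\<^sup>2 * (\<Sum>j<p. \<bar>S i j\<bar>) \<le> r\<^sup>2 * 1" by (intro mult_left_mono) auto
      then show ?thesis using \<rho>(3) by simp
    qed
    show "r\<^sup>2 * (\<Sum>i | i < p \<and> \<bar>int i - int j\<bar> > int k. \<bar>S i j\<bar>) \<le> M * real k powr (- \<alpha>)"
      if "1 \<le> k" "j < p" for k j
    proof -
      have "(\<Sum>i | i < p \<and> \<bar>int i - int j\<bar> > int k. \<bar>S i j\<bar>) = 0"
        using that by (intro sum.neutral) (auto simp: Sij)
      then show ?thesis using M by simp
    qed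
  qed
qed

text \<open>The bound has \<open>1 + ln p\<close> in place of \<open>ln p\<close>, so that it yields
  order \<open>1 / n\<close> for bounded \<open>p\<close> as well.\<close>

theorem minimax_risk_log_lower:
  assumes \<rho>: "0 < \<rho>" and r: "0 < r" "r\<^sup>2 \<le> 1 / (2 * \<rho>)" "r\<^sup>2 \<le> M0" and M: "0 < M" and \<gamma>: "0 < \<gamma>"
    and n: "1 \<le> n" and p: "1 \<le> p" and pn: "real p \<le> exp (\<gamma> * real n)"
  shows "ennreal (r ^ 4 / (16384 * (1 + \<gamma>)) * ((1 + ln (real p)) / real n)) \<le> minimax_risk n p \<alpha> M0 M \<rho>"
proof (rule minimax_risk_ge)
  fix T assume "T \<in> estimators n p"
  then have T: "\<And>X. X \<in> space (sample_space n p) \<Longrightarrow> T X \<in> carrier_mat p p" by (simp add: estimators_def)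
  have p0: "0 < p" using p by simp
  define x where "x = (1 + ln (real p)) / real n"
  \<comment> \<open>This size serves twice: \<open>ln p \<le> \<gamma> * n\<close> gives
    \<open>\<delta> \<le> 1 / 4\<close>, where the tilted weights are nonnegative, and
    \<open>n * \<delta>\<^sup>2 \<le> 1 / 16 + ln p\<close> gives
    \<open>(1 + \<delta>\<^sup>2) ^ n \<le> 2 * p\<close>.\<close>
  define \<delta> where "\<delta> = sqrt (x / (16 * (1 + \<gamma>)))"
  have lnp: "0 \<le> ln (real p)" "ln (real p) \<le> \<gamma> * real n"
  proof -
    have "ln (real p) \<le> ln (exp (\<gamma> * real n))" using p pn by (subst ln_le_cancel_iff) auto
    then show "ln (real p) \<le> \<gamma> * real n" by simp
  qed (use p in simp)
  have x: "0 < x" "x \<le> 1 + \<gamma>"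
    using lnp n by (auto simp: x_def field_simps intro: add_pos_nonneg)
  have \<delta>2: "\<delta>\<^sup>2 = x / (16 * (1 + \<gamma>))" using x \<gamma> by (simp add: \<delta>_def)
  have "x / (16 * (1 + \<gamma>)) \<le> (1 + \<gamma>) / (16 * (1 + \<gamma>))" using x \<gamma> by (intro divide_right_mono) auto
  also have "\<dots> = (1 / 4)\<^sup>2" using \<gamma> by (simp add: power2_eq_square field_simps)
  finally have "\<delta>\<^sup>2 \<le> (1 / 4)\<^sup>2" by (simp only: \<delta>2)
  then have \<delta>: "0 \<le> \<delta>" "\<delta> \<le> 1 / 4" using x \<gamma> by (auto simp: \<delta>_def intro: power2_le_imp_le)
  define e0 :: "nat \<Rightarrow> real" where "e0 = (\<lambda>_. 0)"
  define e where "e m = (\<lambda>i. if i = m then \<delta> else 0)" for m :: nat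
  have e0: "0 \<le> e0 i \<and> e0 i \<le> 1 / 4" for i by (simp add: e0_def)
  have e: "0 \<le> e m i \<and> e m i \<le> 1 / 4" for m i using \<delta> by (simp add: e_def)
  let ?K = "diag_pts p" and ?Y = "\<lambda>c :: nat \<Rightarrow> real. c"
  let ?B = "lazy_law p ?K (diag_weight p e0) r ?Y"
  let ?Q = "\<lambda>m. lazy_law p ?K (diag_weight p (e m)) r ?Y"
  interpret P0: lazy_law_setup p ?K "diag_weight p e0" r ?Y by (rule diag_law_setup[OF p0 r(1) e0])
  have cls0: "?B \<in> P_class p \<alpha> M0 M \<rho>" by (rule diag_law_P_class[OF p0 r(1) e0 \<rho> r(2,3) M])
  have cls: "?Q m \<in> P_class p \<alpha> M0 M \<rho>" for m by (rule diag_law_P_class[OF p0 r(1) e \<rho> r(2,3) M])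
  define \<Omega> where "\<Omega> = PiE {..<n} (\<lambda>_. lazy_set ?K)"
  define W0 where "W0 = lazy_weight (diag_weight p e0)"
  define ratio where "ratio m z = (case z of None \<Rightarrow> 1 | Some c \<Rightarrow> 1 + 2 * \<delta> * spread (c m))" for m and z :: "(nat \<Rightarrow> real) option"
  define F0 where "F0 Z = (\<Prod>l<n. W0 (Z l))" for Z
  define L where "L m Z = (\<Prod>l<n. ratio m (Z l))" for m Z
  have fJ: "finite (lazy_set ?K)" by (rule P0.J)
  have ratio0: "0 \<le> ratio m z" for m z using \<delta> by (auto simp: ratio_def spread_def split: option.split)
  have Wm: "lazy_weight (diag_weight p (e m)) z = W0 z * ratio m z" if "m < p" for m z
  proof (cases z)
    case (Some c)
    have "(\<Prod>i<p. 1 + 2 * e m i * spread (c i)) = 1 + 2 * e m m * spread (c m)"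
      by (rule prod_if_single[OF that]) (simp add: e_def)
    then show ?thesis using Some
      by (simp add: lazy_weight_def W0_def ratio_def diag_weight_def prod_dividef e0_def e_def power_one_over field_simps)
  qed (simp add: lazy_weight_def W0_def ratio_def)
  have E1: "(\<Sum>z\<in>lazy_set ?K. W0 z * ratio m z) = 1" if "m < p" for m
  proof -
    interpret Pm: lazy_law_setup p ?K "diag_weight p (e m)" r ?Y by (rule diag_law_setup[OF p0 r(1) e])
    show ?thesis using Pm.w1 by (simp add: Wm[OF that])
  qed
  \<comment> \<open>Away from the atom, ratios at distinct coordinates are independent with mean
    one, so only \<open>m = m'\<close> leaves a trace; laziness quarters its
    \<open>4 * \<delta>\<^sup>2\<close>.\<close>
  have E2: "(\<Sum>z\<in>lazy_set ?K. W0 z * (ratio m z * ratio m' z)) = 1 + (if m = m' then \<delta>\<^sup>2 else 0)"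
    if m: "m < p" "m' < p" for m m'
  proof -
    let ?q = "diag_weight p e0"
    have "(\<Sum>z\<in>lazy_set ?K. W0 z * (ratio m z * ratio m' z))
      = 3 / 4 + (\<Sum>c\<in>?K. ?q c * ((1 + 2 * \<delta> * spread (c m)) * (1 + 2 * \<delta> * spread (c m')))) / 4"
      by (subst sum_lazy_set[OF P0.K]) (simp add: W0_def lazy_weight_def ratio_def sum_divide_distrib)
    also have "(\<Sum>c\<in>?K. ?q c * ((1 + 2 * \<delta> * spread (c m)) * (1 + 2 * \<delta> * spread (c m'))))
      = 1 + (if m = m' then 4 * \<delta>\<^sup>2 else 0)"
    proof (cases "m = m'")
      case True
      then show ?thesis
        using sum_diag_weight_single[OF m(1), of e0 "\<lambda>y. (1 + 2 * \<delta> * spread y) * (1 + 2 * \<delta> * spread y)"]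
        by (simp add: sum_four_pts spread_def e0_def power2_eq_square algebra_simps)
    next
      case False
      then show ?thesis
        using sum_diag_weight_double[OF m False, of e0 "\<lambda>y. 1 + 2 * \<delta> * spread y" "\<lambda>y. 1 + 2 * \<delta> * spread y"]
        by (simp add: sum_four_pts spread_def e0_def half_add_half)
    qed
    finally show ?thesis by (auto simp: field_simps)
  qed
  have L1: "(\<Sum>Z\<in>\<Omega>. F0 Z * L m Z) = 1" if "m < p" for m
    using sum_PiE_power[OF fJ, where n=n and f="\<lambda>z. W0 z * ratio m z"] E1[OF that]
    unfolding F0_def L_def \<Omega>_def by (simp add: prod.distrib)
  have L2: "(\<Sum>Z\<in>\<Omega>. F0 Z * ((\<Sum>m<p. L m Z) / real p)\<^sup>2) \<le> 3"
  proof -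
    have "(\<Sum>Z\<in>\<Omega>. F0 Z * (\<Sum>m<p. L m Z)\<^sup>2) = (\<Sum>Z\<in>\<Omega>. \<Sum>m<p. \<Sum>m'<p. F0 Z * (L m Z * L m' Z))"
      unfolding power2_eq_square sum_product by (simp only: sum_distrib_left)
    also have "\<dots> = (\<Sum>m<p. \<Sum>m'<p. \<Sum>Z\<in>\<Omega>. F0 Z * (L m Z * L m' Z))"
      by (subst sum.swap, intro sum.cong refl, rule sum.swap)
    also have "\<dots> = (\<Sum>m<p. \<Sum>m'<p. (1 + (if m = m' then \<delta>\<^sup>2 else 0)) ^ n)"
    proof (intro sum.cong refl)
      fix m m' assume "m \<in> {..<p}" "m' \<in> {..<p}"
      then have "(\<Sum>z\<in>lazy_set ?K. W0 z * (ratio m z * ratio m' z)) = 1 + (if m = m' then \<delta>\<^sup>2 else 0)" by (intro E2) auto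
      then show "(\<Sum>Z\<in>\<Omega>. F0 Z * (L m Z * L m' Z)) = (1 + (if m = m' then \<delta>\<^sup>2 else 0)) ^ n"
        using sum_PiE_power[OF fJ, where n=n and f="\<lambda>z. W0 z * (ratio m z * ratio m' z)"]
        unfolding F0_def L_def \<Omega>_def by (simp add: prod.distrib)
    qed
    \<comment> \<open>The mixture tolerates diagonal terms as large as \<open>p\<close>: there are
      only \<open>p\<close> of them among \<open>p\<^sup>2\<close> pairs.\<close>
    also have "\<dots> \<le> (\<Sum>m<p. \<Sum>m'<p. 1 + (if m = m' then 2 * real p else 0))"
    proof (intro sum_mono)
      fix m m'
      have "(1 + \<delta>\<^sup>2) ^ n \<le> exp (\<delta>\<^sup>2) ^ n" by (intro power_mono) auto
      also have "\<dots> = exp (real n * \<delta>\<^sup>2)" by (simp add: exp_of_nat_mult)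
      also have "real n * \<delta>\<^sup>2 \<le> 1 / 16 + ln (real p)"
      proof -
        have "real n * \<delta>\<^sup>2 = (1 + ln (real p)) / (16 * (1 + \<gamma>))" using n by (simp add: \<delta>2 x_def)
        also have "\<dots> \<le> (1 + ln (real p)) / 16" using \<gamma> lnp by (intro divide_left_mono) auto
        finally show ?thesis using lnp by simp
      qed
      also have "exp (1 / 16 + ln (real p)) = exp (1 / 16) * real p" using p by (simp add: exp_add)
      also have "\<dots> \<le> 2 * real p"
      proof (intro mult_right_mono)
        have "exp (1 / 16 :: real) \<le> 1 + 1 / 16 + (1 / 16)\<^sup>2" by (rule exp_bound) auto
        then show "exp (1 / 16 :: real) \<le> 2" by (simp add: power2_eq_square)
      qed auto
      finally have "(1 + \<delta>\<^sup>2) ^ n \<le> 2 * real p" by simp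
      then show "(1 + (if m = m' then \<delta>\<^sup>2 else 0)) ^ n \<le> 1 + (if m = m' then 2 * real p else 0)" by simp
    qed
    also have "\<dots> = 3 * (real p)\<^sup>2"
      by (simp add: sum.distrib power2_eq_square)
    finally have "(\<Sum>Z\<in>\<Omega>. F0 Z * (\<Sum>m<p. L m Z)\<^sup>2) / (real p)\<^sup>2 \<le> 3"
      using p by (simp add: field_simps)
    moreover have "F0 Z * ((\<Sum>m<p. L m Z) / real p)\<^sup>2 = F0 Z * (\<Sum>m<p. L m Z)\<^sup>2 / (real p)\<^sup>2" for Z
      by (simp only: power_divide times_divide_eq_right)
    ultimately show ?thesis by (simp only: sum_divide_distrib)
  qed
  \<comment> \<open>The shift of the \<open>m\<close>-th diagonal covariance entry:
    \<open>r\<^sup>2 / 4\<close> from scaling and laziness, \<open>3 / 4 * \<delta>\<close> from the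
    tilt.\<close>
  define d where "d = r\<^sup>2 / 4 * (3 / 4 * \<delta>)"
  \<comment> \<open>Outside \<open>\<Omega>\<close> the values of \<open>t\<close>, \<open>A\<close>
    and \<open>B\<close> are chosen so that the two loss hypotheses of \<open>lecam_mixture\<close>
    hold for every \<open>Z\<close>.\<close>
  define t where "t m Z = (if Z \<in> \<Omega> then T (P0.obs n Z) $$ (m, m) - r\<^sup>2 / 4 * (5 / 8) else 0)" for m Z
  define A where "A Z = (if Z \<in> \<Omega> then (op_norm (T (P0.obs n Z) - cov_mat p ?B))\<^sup>2 else 0)" for Z
  define B where "B m Z = (if Z \<in> \<Omega> then (op_norm (T (P0.obs n Z) - cov_mat p (?Q m)))\<^sup>2 else d\<^sup>2)" for m Z
  have obs_sp: "P0.obs n Z \<in> space (sample_space n p)" if "Z \<in> \<Omega>" for Z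
    using that P0.X_space unfolding P0.obs_def sample_space_def \<Omega>_def by (auto simp: space_PiM)
  have C: "cov_mat p Q \<in> carrier_mat p p" for Q by (simp add: cov_mat_def)
  have diff: "(T (P0.obs n Z) $$ (m, m) - cov_mat p Q $$ (m, m))\<^sup>2 \<le> (op_norm (T (P0.obs n Z) - cov_mat p Q))\<^sup>2"
    if "Z \<in> \<Omega>" "m < p" for Z m Q
    using op_norm_entry[OF minus_carrier_mat[OF C[of Q], of "T (P0.obs n Z)"] that(2)] C[of Q] that(2)
      T[OF obs_sp[OF that(1)]] by simp
  have "d\<^sup>2 / 32 \<le> (\<Sum>Z\<in>\<Omega>. F0 Z * A Z) \<or> (\<exists>m<p. d\<^sup>2 / 32 \<le> (\<Sum>Z\<in>\<Omega>. F0 Z * L m Z * B m Z))"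
  proof (rule lecam_mixture[where t=t])
    show "finite \<Omega>" unfolding \<Omega>_def using fJ by (intro finite_PiE) auto
    show "0 \<le> F0 Z" if "Z \<in> \<Omega>" for Z
      using that P0.w0 unfolding F0_def W0_def \<Omega>_def by (intro prod_nonneg) (auto simp: PiE_def Pi_def)
    show "0 \<le> L m Z" for m Z unfolding L_def by (intro prod_nonneg ratio0)
    show "(t m Z)\<^sup>2 \<le> A Z" if m: "m < p" for m Z
    proof (cases "Z \<in> \<Omega>")
      case True
      have "cov_mat p ?B $$ (m, m) = r\<^sup>2 / 4 * (5 / 8)"
        unfolding P0.cov[OF m m] diag_law_S[where e=e0, OF p0 r(1) e0 m m] by (simp add: e0_def)
      then show ?thesis using diff[OF True m, of ?B] True by (simp only: t_def A_def if_True)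
    qed (simp add: t_def A_def)
    show "(t m Z - d)\<^sup>2 \<le> B m Z" if m: "m < p" for m Z
    proof (cases "Z \<in> \<Omega>")
      case True
      interpret Pm: lazy_law_setup p ?K "diag_weight p (e m)" r ?Y by (rule diag_law_setup[OF p0 r(1) e])
      have "cov_mat p (?Q m) $$ (m, m) = r\<^sup>2 / 4 * (5 / 8) + d"
        unfolding Pm.cov[OF m m] diag_law_S[where e="e m", OF p0 r(1) e m m] by (simp add: e_def d_def algebra_simps)
      then show ?thesis using diff[OF True m, of "?Q m"] True by (simp only: t_def B_def if_True diff_diff_eq)
    qed (simp add: t_def B_def)
    show "0 \<le> d" using \<delta> by (simp add: d_def)
  qed (use p0 L1 L2 in auto)
  then have "\<exists>P\<in>P_class p \<alpha> M0 M \<rho>. ennreal (d\<^sup>2 / 32) \<le> risk n p T P"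
  proof
    assume "d\<^sup>2 / 32 \<le> (\<Sum>Z\<in>\<Omega>. F0 Z * A Z)"
    also have "\<dots> = (\<Sum>Z\<in>\<Omega>. (\<Prod>l<n. lazy_weight (diag_weight p e0) (Z l)) * (op_norm (T (P0.obs n Z) - cov_mat p ?B))\<^sup>2)"
      by (intro sum.cong refl) (simp add: F0_def W0_def A_def)
    finally have "ennreal (d\<^sup>2 / 32) \<le> ennreal \<dots>" by (rule ennreal_leI)
    also have "\<dots> \<le> risk n p T ?B"
      using P0.risk_ge_sum[of n T] by (simp add: \<Omega>_def lazy_law_def)
    finally show ?thesis using cls0 by blast
  next
    assume "\<exists>m<p. d\<^sup>2 / 32 \<le> (\<Sum>Z\<in>\<Omega>. F0 Z * L m Z * B m Z)"
    then obtain m where m: "m < p" "d\<^sup>2 / 32 \<le> (\<Sum>Z\<in>\<Omega>. F0 Z * L m Z * B m Z)" by auto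
    interpret Pm: lazy_law_setup p ?K "diag_weight p (e m)" r ?Y by (rule diag_law_setup[OF p0 r(1) e])
    note m(2)
    also have "(\<Sum>Z\<in>\<Omega>. F0 Z * L m Z * B m Z)
      = (\<Sum>Z\<in>\<Omega>. (\<Prod>l<n. lazy_weight (diag_weight p (e m)) (Z l)) * (op_norm (T (Pm.obs n Z) - cov_mat p (?Q m)))\<^sup>2)"
      by (intro sum.cong refl) (simp add: F0_def L_def prod.distrib Wm[OF m(1)] B_def P0.obs_def Pm.obs_def)
    finally have "ennreal (d\<^sup>2 / 32) \<le> ennreal \<dots>" by (rule ennreal_leI)
    also have "\<dots> \<le> risk n p T (?Q m)"
      using Pm.risk_ge_sum[of n T] by (simp add: \<Omega>_def lazy_law_def)
    finally show ?thesis using cls by blast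
  qed
  moreover have "r ^ 4 / (16384 * (1 + \<gamma>)) * ((1 + ln (real p)) / real n) \<le> d\<^sup>2 / 32"
  proof -
    have "d\<^sup>2 / 32 = r ^ 4 * (9 / 8192) * \<delta>\<^sup>2" by (simp add: d_def power_mult_distrib power_divide)
    also have "\<dots> = r ^ 4 * (9 / 131072) / (1 + \<gamma>) * x" by (simp add: \<delta>2)
    finally have "d\<^sup>2 / 32 = r ^ 4 * (9 / 131072) / (1 + \<gamma>) * x" .
    moreover have "r ^ 4 * (1 / 16384) / (1 + \<gamma>) * x \<le> r ^ 4 * (9 / 131072) / (1 + \<gamma>) * x"
      using x \<gamma> by (intro mult_right_mono divide_right_mono mult_left_mono) auto
    moreover have "r ^ 4 / (16384 * (1 + \<gamma>)) * ((1 + ln (real p)) / real n) = r ^ 4 * (1 / 16384) / (1 + \<gamma>) * x"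
      by (simp add: x_def field_simps)
    ultimately show ?thesis by linarith
  qed
  ultimately show "\<exists>P\<in>P_class p \<alpha> M0 M \<rho>. ennreal (r ^ 4 / (16384 * (1 + \<gamma>)) * ((1 + ln (real p)) / real n)) \<le> risk n p T P"
    by (meson ennreal_leI order_trans)
qed

section \<open>Lower bound of order k / n\<close>

lemma sinh_le_x_cosh: "0 \<le> x \<Longrightarrow> sinh x \<le> x * cosh x" for x :: real
proof -
  assume x: "0 \<le> x"
  have "0 * cosh 0 - sinh 0 \<le> x * cosh x - sinh x"
  proof (rule DERIV_nonneg_imp_nondecreasing[OF x])
    fix y :: real assume "0 \<le> y"
    then have "0 \<le> y * sinh y" by simp
    moreover have "((\<lambda>y. y * cosh y - sinh y) has_real_derivative y * sinh y) (at y)"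
      by (auto intro!: derivative_eq_intros)
    ultimately show "\<exists>d. ((\<lambda>y. y * cosh y - sinh y) has_real_derivative d) (at y) \<and> 0 \<le> d" by blast
  qed
  then show ?thesis by simp
qed

lemma abs_sinh_le: "\<bar>sinh x\<bar> \<le> \<bar>x\<bar> * cosh x" for x :: real
proof (cases "0 \<le> x")
  case False
  then show ?thesis using sinh_le_x_cosh[of "- x"] by simp
qed (use sinh_le_x_cosh[of x] in simp)

text \<open>The left side is the Laplace transform of a sign with mean \<open>w\<close>, for
  \<open>w\<close> in \<open>[-1, 1]\<close>. The tilt enters as \<open>w\<^sup>2 / 2\<close>, free
  of \<open>x\<close>, so over \<open>k\<close> signs it costs a bounded factor as long as
  \<open>k * w\<^sup>2\<close> is bounded.\<close>

lemma cosh_plus_sinh_le: "cosh x + w * sinh x \<le> exp (x\<^sup>2 + w\<^sup>2 / 2)" for x w :: real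
proof -
  have "w * sinh x \<le> \<bar>w\<bar> * \<bar>sinh x\<bar>" by (simp flip: abs_mult)
  also have "\<dots> \<le> \<bar>w\<bar> * (\<bar>x\<bar> * cosh x)" by (intro mult_left_mono abs_sinh_le) auto
  finally have "cosh x + w * sinh x \<le> cosh x * (1 + \<bar>w\<bar> * \<bar>x\<bar>)" by (simp add: algebra_simps)
  also have "\<dots> \<le> exp (x\<^sup>2 / 2) * exp (\<bar>w\<bar> * \<bar>x\<bar>)"
    by (intro mult_mono cosh_le_exp_sq exp_ge_add_one_self) auto
  also have "\<dots> = exp (x\<^sup>2 / 2 + \<bar>w\<bar> * \<bar>x\<bar>)" by (simp add: exp_add)
  also have "\<dots> \<le> exp (x\<^sup>2 + w\<^sup>2 / 2)"
    using sum_squares_bound[of "\<bar>w\<bar>" "\<bar>x\<bar>"] by simp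
  finally show ?thesis .
qed

abbreviation sgn_pts :: "nat \<Rightarrow> (nat \<Rightarrow> real) set" where
  "sgn_pts k \<equiv> PiE {..<k} (\<lambda>_. {-1, 1})"

lemma finite_sgn_pts: "finite (sgn_pts k)"
  by (intro finite_PiE) auto

lemma sgn_ptsD: "b \<in> sgn_pts k \<Longrightarrow> j < k \<Longrightarrow> (b j)\<^sup>2 = 1 \<and> \<bar>b j\<bar> = 1"
  by (auto simp: PiE_def Pi_def)

lemma sum_sgn_prod:
  fixes f :: "nat \<Rightarrow> real \<Rightarrow> 'b :: comm_semiring_1"
  shows "(\<Sum>b\<in>sgn_pts k. \<Prod>j<k. f j (b j)) = (\<Prod>j<k. f j (-1) + f j 1)"
  by (subst prod_sum_PiE[symmetric]) auto

lemma card_sgn_pts: "(\<Sum>b\<in>sgn_pts k. 1 :: real) = 2 ^ k"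
  by (simp add: card_PiE)

text \<open>
  The imaginary part of a Riesz product replaces the normalised sum of the signs: it has the same
  correlation with each sign, but is bounded, so it can tilt the conditional means of the other block.
\<close>

definition hub :: "nat \<Rightarrow> (nat \<Rightarrow> real) \<Rightarrow> real" where
  "hub k b = Im (\<Prod>j<k. 1 + \<i> * of_real (b j / sqrt (real k)))"

text \<open>The squared modulus of the Riesz product is constant, \<open>(1 + 1 / k) ^ k\<close>,
  and hence at most \<open>exp 1\<close>.\<close>

lemma hub_sq_le:
  assumes b: "b \<in> sgn_pts k" and k: "0 < k"
  shows "(hub k b)\<^sup>2 \<le> 3"
proof -
  let ?z = "\<Prod>j<k. 1 + \<i> * of_real (b j / sqrt (real k)) :: complex"
  have "(hub k b)\<^sup>2 \<le> (cmod ?z)\<^sup>2"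
    unfolding hub_def by (simp add: cmod_power2)
  also have "\<dots> = (\<Prod>j<k. (cmod (1 + \<i> * of_real (b j / sqrt (real k))))\<^sup>2)"
    by (simp add: prod_norm[symmetric] prod_power_distrib)
  also have "\<dots> = (\<Prod>j<k. 1 + 1 / real k)"
  proof (rule prod.cong[OF refl])
    fix j assume "j \<in> {..<k}"
    then have "(b j)\<^sup>2 = 1" using sgn_ptsD[OF b, of j] by simp
    then show "(cmod (1 + \<i> * of_real (b j / sqrt (real k))))\<^sup>2 = 1 + 1 / real k"
      by (simp add: cmod_power2 power_divide)
  qed
  also have "\<dots> = (1 + 1 / real k) ^ k" by simp
  also have "\<dots> \<le> exp (1 / real k) ^ k"
    by (intro power_mono exp_ge_add_one_self) auto
  also have "\<dots> = exp 1" using k by (simp flip: exp_of_nat_mult)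
  also have "\<dots> \<le> 3" by (rule exp_le)
  finally show ?thesis .
qed

text \<open>Each factor averages to 1, so the mean of the product is real.\<close>

lemma sum_hub: "(\<Sum>b\<in>sgn_pts k. hub k b) = 0"
proof -
  have "(\<Sum>b\<in>sgn_pts k. \<Prod>j<k. 1 + \<i> * of_real (b j / sqrt (real k))) = (\<Prod>j<k. 2 :: complex)"
    by (subst sum_sgn_prod[where f="\<lambda>_ y. 1 + \<i> * of_real (y / sqrt (real k))"]) simp
  then have "(\<Sum>b\<in>sgn_pts k. hub k b) = Im (2 ^ k)"
    unfolding hub_def by (simp flip: Im_sum)
  also have "(2 :: complex) ^ k = of_real (2 ^ k)" by simp
  finally show ?thesis by (simp only: Im_complex_of_real)
qed

text \<open>Weighting by \<open>b j\<close> selects the linear term of the \<open>j\<close>-th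
  factor, while the other factors average to 1.\<close>

lemma sum_hub_coord:
  assumes j: "j < k"
  shows "(\<Sum>b\<in>sgn_pts k. hub k b * b j) = 2 ^ k / sqrt (real k)"
proof -
  let ?t = "1 / sqrt (real k)"
  let ?f = "\<lambda>l y. (1 + \<i> * of_real (y / sqrt (real k))) * (if l = j then of_real y else 1) :: complex"
  have e: "hub k b * b j = Im (\<Prod>l<k. ?f l (b l))" for b
  proof -
    have "(\<Prod>l<k. ?f l (b l)) = (\<Prod>l<k. 1 + \<i> * of_real (b l / sqrt (real k))) * of_real (b j)"
      unfolding prod.distrib using j by (simp add: if_distrib prod.delta cong: if_cong)
    then show ?thesis using j by (simp add: hub_def)
  qed
  have "(\<Sum>b\<in>sgn_pts k. \<Prod>l<k. ?f l (b l)) = (\<Prod>l<k. ?f l (-1) + ?f l 1)"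
    by (rule sum_sgn_prod)
  also have "\<dots> = (\<Prod>l<k. 2 * (if l = j then \<i> * of_real ?t else 1))"
    by (intro prod.cong refl) (auto simp: algebra_simps)
  also have "\<dots> = 2 ^ k * (\<i> * of_real ?t)"
    unfolding prod.distrib using j by (simp add: prod.delta)
  also have "\<dots> = \<i> * of_real (2 ^ k * ?t)" by simp
  finally have "(\<Sum>b\<in>sgn_pts k. hub k b * b j) = Im (\<i> * of_real (2 ^ k * ?t))"
    unfolding e by (simp only: Im_sum[symmetric])
  then show ?thesis by simp
qed

section \<open>Two blocks of signs coupled through the hub\<close>

definition pair_pts :: "nat \<Rightarrow> ((nat \<Rightarrow> real) \<times> (nat \<Rightarrow> real)) set" where
  "pair_pts k = sgn_pts k \<times> sgn_pts k"

definition hub_weight :: "nat \<Rightarrow> real \<Rightarrow> (nat \<Rightarrow> real) \<Rightarrow> (nat \<Rightarrow> real) \<times> (nat \<Rightarrow> real) \<Rightarrow> real" where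
  "hub_weight k s \<theta> c = (\<Prod>i<k. (1 + \<theta> i * fst c i * (s * hub k (snd c))) / 2) / 2 ^ k"

definition hub_vec :: "nat \<Rightarrow> (nat \<Rightarrow> real) \<times> (nat \<Rightarrow> real) \<Rightarrow> nat \<Rightarrow> real" where
  "hub_vec k c i = (if i < k then fst c i else if i < 2 * k then snd c (i - k) else 0)"

text \<open>For fixed \<open>b\<close> the signs of the first block are independent, so product test
  functions factorise. The identity holds for every real \<open>\<theta>\<close>, including one with
  an entry set to 0, as in \<open>hub_affinity\<close>.\<close>

lemma sum_hub_weight:
  "(\<Sum>c\<in>pair_pts k. hub_weight k s \<theta> c * ((\<Prod>i<k. f i (fst c i)) * h (snd c)))
    = (\<Sum>b\<in>sgn_pts k. h b / 2 ^ k *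
        (\<Prod>i<k. (1 - \<theta> i * (s * hub k b)) / 2 * f i (-1) + (1 + \<theta> i * (s * hub k b)) / 2 * f i 1))"
proof -
  have "(\<Sum>c\<in>pair_pts k. hub_weight k s \<theta> c * ((\<Prod>i<k. f i (fst c i)) * h (snd c)))
    = (\<Sum>a\<in>sgn_pts k. \<Sum>b\<in>sgn_pts k. hub_weight k s \<theta> (a, b) * ((\<Prod>i<k. f i (a i)) * h b))"
    unfolding pair_pts_def by (subst sum.cartesian_product) (simp add: case_prod_beta)
  also have "\<dots> = (\<Sum>b\<in>sgn_pts k. \<Sum>a\<in>sgn_pts k. hub_weight k s \<theta> (a, b) * ((\<Prod>i<k. f i (a i)) * h b))"
    by (rule sum.swap)
  also have "\<dots> = (\<Sum>b\<in>sgn_pts k. h b / 2 ^ k * (\<Sum>a\<in>sgn_pts k. \<Prod>i<k. (1 + \<theta> i * a i * (s * hub k b)) / 2 * f i (a i)))"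
    unfolding hub_weight_def sum_distrib_left prod.distrib by (intro sum.cong refl) simp
  also have "\<dots> = (\<Sum>b\<in>sgn_pts k. h b / 2 ^ k *
        (\<Prod>i<k. (1 - \<theta> i * (s * hub k b)) / 2 * f i (-1) + (1 + \<theta> i * (s * hub k b)) / 2 * f i 1))"
  proof (intro sum.cong refl arg_cong2[of _ _ _ _ "(*)"])
    fix b
    show "(\<Sum>a\<in>sgn_pts k. \<Prod>i<k. (1 + \<theta> i * a i * (s * hub k b)) / 2 * f i (a i))
      = (\<Prod>i<k. (1 - \<theta> i * (s * hub k b)) / 2 * f i (-1) + (1 + \<theta> i * (s * hub k b)) / 2 * f i 1)"
      using sum_sgn_prod[where k=k and f="\<lambda>i y. (1 + \<theta> i * y * (s * hub k b)) / 2 * f i y"] by simp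
  qed
  finally show ?thesis .
qed

lemma half_diff_add: "(1 - a) / 2 + (1 + a) / 2 = (1::real)"
  by (simp add: field_simps)

lemma sum_hub_weight_0:
  "(\<Sum>c\<in>pair_pts k. hub_weight k s \<theta> c * h (snd c)) = (\<Sum>b\<in>sgn_pts k. h b) / 2 ^ k"
  using sum_hub_weight[of k s \<theta> "\<lambda>_ _. 1" h] by (simp add: half_diff_add sum_divide_distrib)

lemma sum_hub_weight_1:
  assumes i: "i < k"
  shows "(\<Sum>c\<in>pair_pts k. hub_weight k s \<theta> c * (fst c i * h (snd c))) = \<theta> i * s * (\<Sum>b\<in>sgn_pts k. hub k b * h b) / 2 ^ k"
proof -
  let ?f = "\<lambda>l y. if l = i then y else 1 :: real"
  have e: "(\<Prod>l<k. ?f l (a l)) = a i" for a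
    using i prod_if_single[of i k "\<lambda>l. ?f l (a l)"] by auto
  have "(\<Prod>l<k. (1 - \<theta> l * (s * hub k b)) / 2 * ?f l (-1) + (1 + \<theta> l * (s * hub k b)) / 2 * ?f l 1) = \<theta> i * (s * hub k b)" for b
    by (subst prod_if_single[OF i]) (auto simp: field_simps)
  then show ?thesis
    using sum_hub_weight[of k s \<theta> ?f h] unfolding e
    by (simp add: sum_distrib_left sum_divide_distrib mult_ac)
qed

text \<open>Two signs of the first block are correlated only through the hub they share, so their
  covariance is of second order in \<open>s\<close>.\<close>

lemma sum_hub_weight_2:
  assumes i: "i < k" "i' < k" "i \<noteq> i'"
  shows "(\<Sum>c\<in>pair_pts k. hub_weight k s \<theta> c * (fst c i * fst c i'))
    = \<theta> i * \<theta> i' * s\<^sup>2 * (\<Sum>b\<in>sgn_pts k. (hub k b)\<^sup>2) / 2 ^ k"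
proof -
  let ?f = "\<lambda>l y. if l = i \<or> l = i' then y else 1 :: real"
  have e: "(\<Prod>l<k. ?f l (a l)) = a i * a i'" for a
    using i prod_if_double[of i k i' "\<lambda>l. ?f l (a l)"] by auto
  have "(\<Prod>l<k. (1 - \<theta> l * (s * hub k b)) / 2 * ?f l (-1) + (1 + \<theta> l * (s * hub k b)) / 2 * ?f l 1)
      = \<theta> i * (s * hub k b) * (\<theta> i' * (s * hub k b))" for b
    by (subst prod_if_double[OF i]) (auto simp: field_simps)
  then show ?thesis
    using sum_hub_weight[of k s \<theta> ?f "\<lambda>_. 1"] unfolding e
    by (simp add: sum_distrib_left sum_divide_distrib mult_ac power2_eq_square)
qed

lemma sum_hub_vec:
  fixes f :: "nat \<Rightarrow> real \<Rightarrow> real"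
  assumes "2 * k \<le> p" "\<And>i. f i 0 = 0"
  shows "(\<Sum>i<p. f i (hub_vec k c i)) = (\<Sum>i<k. f i (fst c i)) + (\<Sum>j<k. f (k + j) (snd c j))"
proof -
  have "(\<Sum>i<p. f i (hub_vec k c i)) = (\<Sum>i<2 * k. f i (hub_vec k c i))"
    using assms by (intro sum.mono_neutral_right) (auto simp: hub_vec_def)
  also have "{..<2 * k} = {..<k} \<union> (\<lambda>j. k + j) ` {..<k}"
  proof -
    have "x \<in> {..<k} \<union> (\<lambda>j. k + j) ` {..<k}" if "x < 2 * k" for x
    proof (cases "x < k")
      case False
      then have "x = k + (x - k)" "x - k < k" using that by auto
      then show ?thesis by blast
    qed simp
    then show ?thesis by auto
  qed
  also have "(\<Sum>i\<in>\<dots>. f i (hub_vec k c i)) = (\<Sum>i<k. f i (hub_vec k c i)) + (\<Sum>i\<in>(\<lambda>j. k + j) ` {..<k}. f i (hub_vec k c i))"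
    by (intro sum.union_disjoint) auto
  also have "(\<Sum>i\<in>(\<lambda>j. k + j) ` {..<k}. f i (hub_vec k c i)) = (\<Sum>j<k. f (k + j) (snd c j))"
    by (subst sum.reindex) (auto simp: hub_vec_def)
  also have "(\<Sum>i<k. f i (hub_vec k c i)) = (\<Sum>i<k. f i (fst c i))"
    by (intro sum.cong) (auto simp: hub_vec_def)
  finally show ?thesis .
qed

text \<open>Averaging over \<open>\<theta>\<close> and its flip at \<open>i\<close> reduces each
  coordinate to a two-point problem. \<open>\<psi>\<close> replaces the root of the product of the
  two likelihoods by anything whose square lies below that product, which allows a function that is
  multiplicative over observations and has an explicit sum.\<close>

lemma assouad:
  fixes F :: "(nat \<Rightarrow> real) \<Rightarrow> 'z \<Rightarrow> real" and \<psi> :: "nat \<Rightarrow> (nat \<Rightarrow> real) \<Rightarrow> 'z \<Rightarrow> real"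
  assumes fin: "finite \<Omega>"
    and F0: "\<And>\<theta> Z. \<theta> \<in> sgn_pts k \<Longrightarrow> Z \<in> \<Omega> \<Longrightarrow> 0 \<le> F \<theta> Z"
    and F1: "\<And>\<theta>. \<theta> \<in> sgn_pts k \<Longrightarrow> (\<Sum>Z\<in>\<Omega>. F \<theta> Z) = 1"
    and \<psi>: "\<And>i \<theta> Z. i < k \<Longrightarrow> \<theta> \<in> sgn_pts k \<Longrightarrow> Z \<in> \<Omega> \<Longrightarrow> (\<psi> i \<theta> Z)\<^sup>2 \<le> F \<theta> Z * F (\<theta>(i := - \<theta> i)) Z"
    and \<psi>1: "\<And>i \<theta>. i < k \<Longrightarrow> \<theta> \<in> sgn_pts k \<Longrightarrow> 3 / 4 \<le> (\<Sum>Z\<in>\<Omega>. \<psi> i \<theta> Z)"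
    and loss: "\<And>\<theta> Z. \<theta> \<in> sgn_pts k \<Longrightarrow> Z \<in> \<Omega> \<Longrightarrow> (\<Sum>i<k. (\<tau> i Z - c * \<theta> i)\<^sup>2) \<le> loss \<theta> Z"
  shows "\<exists>\<theta>\<in>sgn_pts k. real k * c\<^sup>2 / 2 \<le> (\<Sum>Z\<in>\<Omega>. F \<theta> Z * loss \<theta> Z)"
proof (rule ccontr)
  assume "\<not> ?thesis"
  then have neg: "(\<Sum>Z\<in>\<Omega>. F \<theta> Z * loss \<theta> Z) < real k * c\<^sup>2 / 2" if "\<theta> \<in> sgn_pts k" for \<theta>
    using that by (auto simp: not_le)
  define G where "G i \<theta> = (\<Sum>Z\<in>\<Omega>. F \<theta> Z * (\<tau> i Z - c * \<theta> i)\<^sup>2)" for i \<theta>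
  have flip: "\<theta>(i := - \<theta> i) \<in> sgn_pts k" if "\<theta> \<in> sgn_pts k" "i < k" for \<theta> i
    using that by (auto simp: PiE_def Pi_def extensional_def)
  \<comment> \<open>For positive \<open>x + y\<close> the right side is minimal over
    \<open>u\<close> at \<open>4 * c\<^sup>2 * x * y / (x + y)\<close>, which dominates the left
    side as \<open>w \<le> sqrt (x * y)\<close>. Summed with masses 1 and affinity
    \<open>3 / 4\<close>, the bracket is at least \<open>4 * (3 / 4) - 1 - 1 = 1\<close>.\<close>
  have key: "c\<^sup>2 * (4 * w - x - y) \<le> x * (u - c * e)\<^sup>2 + y * (u + c * e)\<^sup>2"
    if "0 \<le> x" "0 \<le> y" "w\<^sup>2 \<le> x * y" "e\<^sup>2 = 1" for x y w u e :: real
  proof -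
    define a b where "a = sqrt x" and "b = sqrt y"
    have ab: "x = a\<^sup>2" "y = b\<^sup>2" "0 \<le> a" "0 \<le> b" using that by (auto simp: a_def b_def)
    have "w\<^sup>2 \<le> (a * b)\<^sup>2" using that(3) by (simp add: ab power_mult_distrib)
    then have "\<bar>w\<bar> \<le> \<bar>a * b\<bar>" by (simp only: abs_le_square_iff)
    moreover have "\<bar>a * b\<bar> = a * b" using ab by simp
    ultimately have "w \<le> a * b" by linarith
    then have 1: "c\<^sup>2 * (4 * w - x - y) \<le> c\<^sup>2 * (4 * (a * b) - x - y)"
      by (intro mult_left_mono) auto
    define R where "R = x * (u - c * e)\<^sup>2 + y * (u + c * e)\<^sup>2"
    define Q where "Q = c\<^sup>2 * (4 * (a * b) - x - y)"
    \<comment> \<open>A sum of squares certificate; the summand with \<open>e\<^sup>2 - 1\<close>,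
      zero for signs, makes it a polynomial identity.\<close>
    have "(2 * c * e * (a - b) - u * (a + b))\<^sup>2 + u\<^sup>2 * (a - b)\<^sup>2
      = 2 * (R - Q + c\<^sup>2 * (e\<^sup>2 - 1) * (2 * (a - b)\<^sup>2 - x - y))"
      by (simp add: R_def Q_def ab power2_eq_square algebra_simps)
    also have "\<dots> = 2 * (R - Q)" using that(4) by simp
    finally have "0 \<le> 2 * (R - Q)"
      by (metis add_nonneg_nonneg mult_nonneg_nonneg zero_le_power2)
    then show ?thesis using 1 unfolding R_def[symmetric] Q_def[symmetric] by simp
  qed
  have pair: "c\<^sup>2 \<le> G i \<theta> + G i (\<theta>(i := - \<theta> i))" if i: "i < k" and \<theta>: "\<theta> \<in> sgn_pts k" for i \<theta>
  proof -
    let ?\<theta> = "\<theta>(i := - \<theta> i)"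
    have "c\<^sup>2 * 1 \<le> c\<^sup>2 * (4 * (\<Sum>Z\<in>\<Omega>. \<psi> i \<theta> Z) - (\<Sum>Z\<in>\<Omega>. F \<theta> Z) - (\<Sum>Z\<in>\<Omega>. F ?\<theta> Z))"
      using \<psi>1[OF i \<theta>] F1[OF \<theta>] F1[OF flip[OF \<theta> i]] by (intro mult_left_mono) auto
    also have "\<dots> = (\<Sum>Z\<in>\<Omega>. c\<^sup>2 * (4 * \<psi> i \<theta> Z - F \<theta> Z - F ?\<theta> Z))"
      by (simp only: sum_distrib_left[symmetric] sum_subtractf)
    also have "\<dots> \<le> (\<Sum>Z\<in>\<Omega>. F \<theta> Z * (\<tau> i Z - c * \<theta> i)\<^sup>2 + F ?\<theta> Z * (\<tau> i Z + c * \<theta> i)\<^sup>2)"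
      using F0 \<theta> flip[OF \<theta> i] \<psi>[OF i \<theta>] sgn_ptsD[OF \<theta> i] by (intro sum_mono key) auto
    also have "\<dots> = G i \<theta> + G i ?\<theta>"
      by (simp add: G_def sum.distrib)
    finally show ?thesis by simp
  qed
  have avg: "real (card (sgn_pts k)) * c\<^sup>2 / 2 \<le> (\<Sum>\<theta>\<in>sgn_pts k. G i \<theta>)" if i: "i < k" for i
  proof -
    have "(\<Sum>\<theta>\<in>sgn_pts k. G i (\<theta>(i := - \<theta> i))) = (\<Sum>\<theta>\<in>sgn_pts k. G i \<theta>)"
      by (rule sum.reindex_bij_witness[of _ "\<lambda>\<theta>. \<theta>(i := - \<theta> i)" "\<lambda>\<theta>. \<theta>(i := - \<theta> i)"])
        (use flip i in auto)
    then have "2 * (\<Sum>\<theta>\<in>sgn_pts k. G i \<theta>) = (\<Sum>\<theta>\<in>sgn_pts k. G i \<theta> + G i (\<theta>(i := - \<theta> i)))"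
      by (simp add: sum.distrib)
    moreover have "(\<Sum>\<theta>\<in>sgn_pts k. c\<^sup>2) \<le> (\<Sum>\<theta>\<in>sgn_pts k. G i \<theta> + G i (\<theta>(i := - \<theta> i)))"
      by (intro sum_mono pair i)
    ultimately show ?thesis by simp
  qed
  have ne: "sgn_pts k \<noteq> {}" by (simp add: PiE_eq_empty_iff)
  have "real k * (real (card (sgn_pts k)) * c\<^sup>2 / 2) = (\<Sum>i<k. real (card (sgn_pts k)) * c\<^sup>2 / 2)" by simp
  also have "\<dots> \<le> (\<Sum>i<k. \<Sum>\<theta>\<in>sgn_pts k. G i \<theta>)"
    by (intro sum_mono avg) auto
  also have "\<dots> = (\<Sum>\<theta>\<in>sgn_pts k. \<Sum>i<k. G i \<theta>)" by (rule sum.swap)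
  also have "\<dots> \<le> (\<Sum>\<theta>\<in>sgn_pts k. \<Sum>Z\<in>\<Omega>. F \<theta> Z * loss \<theta> Z)"
  proof (rule sum_mono)
    fix \<theta> assume \<theta>: "\<theta> \<in> sgn_pts k"
    have "(\<Sum>i<k. G i \<theta>) = (\<Sum>Z\<in>\<Omega>. F \<theta> Z * (\<Sum>i<k. (\<tau> i Z - c * \<theta> i)\<^sup>2))"
      unfolding G_def by (subst sum.swap) (simp add: sum_distrib_left)
    also have "\<dots> \<le> (\<Sum>Z\<in>\<Omega>. F \<theta> Z * loss \<theta> Z)"
      by (intro sum_mono mult_left_mono loss F0 \<theta>)
    finally show "(\<Sum>i<k. G i \<theta>) \<le> (\<Sum>Z\<in>\<Omega>. F \<theta> Z * loss \<theta> Z)" .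
  qed
  also have "\<dots> < (\<Sum>\<theta>\<in>sgn_pts k. real k * c\<^sup>2 / 2)"
    by (intro sum_strict_mono neg finite_sgn_pts ne)
  finally show False by (simp add: mult_ac)
qed

lemma scaled_hub_sq_le:
  assumes "b \<in> sgn_pts k" "0 < k"
  shows "(s * hub k b)\<^sup>2 \<le> 3 * s\<^sup>2"
proof -
  have "(s * hub k b)\<^sup>2 = s\<^sup>2 * (hub k b)\<^sup>2" by (rule power_mult_distrib)
  also have "\<dots> \<le> s\<^sup>2 * 3"
    by (rule mult_left_mono[OF hub_sq_le[OF assms]]) (rule zero_le_power2)
  also have "\<dots> = 3 * s\<^sup>2" by (rule mult.commute)
  finally show ?thesis .
qed

lemma hub_weight_nonneg:
  assumes \<theta>: "\<theta> \<in> sgn_pts k" and c: "c \<in> pair_pts k" and k: "0 < k" and s: "12 * real k * s\<^sup>2 \<le> 1"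
  shows "0 \<le> hub_weight k s \<theta> c"
proof -
  have "0 \<le> (1 + \<theta> i * fst c i * (s * hub k (snd c))) / 2" if i: "i \<in> {..<k}" for i
  proof -
    have ab: "fst c \<in> sgn_pts k" "snd c \<in> sgn_pts k" using c by (simp_all add: pair_pts_def mem_Times_iff)
    have "12 * s\<^sup>2 \<le> 12 * real k * s\<^sup>2" using k by (intro mult_right_mono) auto
    then have "(s * hub k (snd c))\<^sup>2 \<le> 1" using scaled_hub_sq_le[OF ab(2) k, of s] s by linarith
    then have "\<bar>s * hub k (snd c)\<bar> \<le> 1" by (simp only: abs_square_le_1)
    moreover have "\<bar>\<theta> i\<bar> = 1" "\<bar>fst c i\<bar> = 1"
      using sgn_ptsD[OF \<theta>, of i] sgn_ptsD[OF ab(1), of i] i by blast+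
    ultimately have "\<bar>\<theta> i * fst c i * (s * hub k (snd c))\<bar> \<le> 1"
      by (simp only: abs_mult mult_1)
    moreover have "0 \<le> (1 + x) / 2" if "\<bar>x\<bar> \<le> 1" for x :: real using that by simp
    ultimately show ?thesis by blast
  qed
  then have "0 \<le> (\<Prod>i<k. (1 + \<theta> i * fst c i * (s * hub k (snd c))) / 2)"
    by (rule prod_nonneg)
  then show ?thesis unfolding hub_weight_def by (rule divide_nonneg_nonneg) simp
qed

lemma sum_sgn_coord: "j < k \<Longrightarrow> (\<Sum>b\<in>sgn_pts k. b j) = 0"
proof -
  assume j: "j < k"
  let ?f = "\<lambda>l y. if l = j then y else 1 :: real"
  have "(\<Prod>l<k. ?f l (b l)) = b j" for b
    using j prod_if_single[of j k "\<lambda>l. ?f l (b l)"] by auto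
  then have "(\<Sum>b\<in>sgn_pts k. b j) = (\<Prod>l<k. ?f l (-1) + ?f l 1)"
    using sum_sgn_prod[where k=k and f="?f"] by simp
  also have "\<dots> = 0" using j by (intro prod_zero) auto
  finally show ?thesis .
qed

lemma sum_sgn_coord_2: "i < k \<Longrightarrow> j < k \<Longrightarrow> i \<noteq> j \<Longrightarrow> (\<Sum>b\<in>sgn_pts k. b i * b j) = 0"
proof -
  assume ij: "i < k" "j < k" "i \<noteq> j"
  let ?f = "\<lambda>l y. if l = i \<or> l = j then y else 1 :: real"
  have "(\<Prod>l<k. ?f l (b l)) = b i * b j" for b
    using ij prod_if_double[of i k j "\<lambda>l. ?f l (b l)"] by auto
  then have "(\<Sum>b\<in>sgn_pts k. b i * b j) = (\<Prod>l<k. ?f l (-1) + ?f l 1)"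
    using sum_sgn_prod[where k=k and f="?f"] by simp
  also have "\<dots> = 0" using ij by (intro prod_zero) auto
  finally show ?thesis .
qed

lemma finite_pair_pts: "finite (pair_pts k)"
  unfolding pair_pts_def by (intro finite_cartesian_product finite_sgn_pts)

lemma sum_hub_weight_const: "(\<Sum>c\<in>pair_pts k. hub_weight k s \<theta> c) = 1"
  using sum_hub_weight_0[of k s \<theta> "\<lambda>_. 1"] card_sgn_pts[of k] by simp

text \<open>Given \<open>b\<close>, a sign of the first block contributes
  \<open>cosh x + w * sinh x\<close>, and since \<open>12 * k * s\<^sup>2 \<le> 1\<close> all tilts
  together cost at most \<open>exp (1 / 8)\<close>. What remains is a product of hyperbolic cosines
  for the untilted second block; the surplus fits under the factor 2.\<close>

lemma hub_weight_mgf: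
  assumes k: "0 < k" "2 * k \<le> p" and s: "12 * real k * s\<^sup>2 \<le> 1" and \<theta>: "\<theta> \<in> sgn_pts k"
    and v: "sqn p v = 1"
  shows "(\<Sum>c\<in>pair_pts k. hub_weight k s \<theta> c * exp (l * (\<Sum>i<p. v i * hub_vec k c i))) \<le> 2 * exp (l\<^sup>2)"
proof -
  let ?x = "\<lambda>i. l * v i"
  let ?h = "\<lambda>b. \<Prod>j<k. exp (?x (k + j) * b j)"
  have split: "exp (l * (\<Sum>i<p. v i * hub_vec k c i)) = (\<Prod>i<k. exp (?x i * fst c i)) * ?h (snd c)" for c
    using sum_hub_vec[OF k(2), of "\<lambda>i y. ?x i * y" c]
    by (simp add: sum_distrib_left exp_add exp_sum mult.assoc)
  have inner: "(\<Prod>i<k. (1 - \<theta> i * (s * hub k b)) / 2 * exp (?x i * (-1)) + (1 + \<theta> i * (s * hub k b)) / 2 * exp (?x i * 1))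
      \<le> exp ((\<Sum>i<k. (?x i)\<^sup>2) + 1 / 8)" if b: "b \<in> sgn_pts k" for b
  proof -
    have "(\<Prod>i<k. (1 - \<theta> i * (s * hub k b)) / 2 * exp (?x i * (-1)) + (1 + \<theta> i * (s * hub k b)) / 2 * exp (?x i * 1))
      \<le> (\<Prod>i<k. exp ((?x i)\<^sup>2 + 3 * s\<^sup>2 / 2))"
    proof (rule prod_mono, intro conjI)
      fix i assume i: "i \<in> {..<k}"
      let ?w = "\<theta> i * (s * hub k b)"
      have w2: "?w\<^sup>2 \<le> 3 * s\<^sup>2"
        using scaled_hub_sq_le[OF b k(1), of s] sgn_ptsD[OF \<theta>, of i] i by (simp add: power_mult_distrib)
      have "12 * s\<^sup>2 \<le> 12 * real k * s\<^sup>2" using k by (intro mult_right_mono) auto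
      then have "?w\<^sup>2 \<le> 1" using w2 s by linarith
      then have "\<bar>?w\<bar> \<le> 1" by (simp only: abs_square_le_1)
      then show "0 \<le> (1 - ?w) / 2 * exp (?x i * (-1)) + (1 + ?w) / 2 * exp (?x i * 1)"
        by (intro add_nonneg_nonneg mult_nonneg_nonneg) (auto simp: abs_le_iff)
      have "(1 - ?w) / 2 * exp (?x i * (-1)) + (1 + ?w) / 2 * exp (?x i * 1) = cosh (?x i) + ?w * sinh (?x i)"
        by (simp add: cosh_def sinh_def field_simps)
      also have "\<dots> \<le> exp ((?x i)\<^sup>2 + ?w\<^sup>2 / 2)" by (rule cosh_plus_sinh_le)
      also have "\<dots> \<le> exp ((?x i)\<^sup>2 + 3 * s\<^sup>2 / 2)" using w2 by simp
      finally show "(1 - ?w) / 2 * exp (?x i * (-1)) + (1 + ?w) / 2 * exp (?x i * 1) \<le> exp ((?x i)\<^sup>2 + 3 * s\<^sup>2 / 2)" .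
    qed
    also have "\<dots> = exp ((\<Sum>i<k. (?x i)\<^sup>2) + real k * (3 * s\<^sup>2 / 2))"
      by (simp add: exp_sum[symmetric] sum.distrib)
    also have "\<dots> \<le> exp ((\<Sum>i<k. (?x i)\<^sup>2) + 1 / 8)" using s by (simp add: mult.assoc)
    finally show ?thesis .
  qed
  have outer: "(\<Sum>b\<in>sgn_pts k. ?h b / 2 ^ k) \<le> exp (\<Sum>j<k. (?x (k + j))\<^sup>2)"
  proof -
    have "(\<Sum>b\<in>sgn_pts k. ?h b / 2 ^ k) = (\<Sum>b\<in>sgn_pts k. ?h b) / 2 ^ k" by (simp add: sum_divide_distrib)
    also have "(\<Sum>b\<in>sgn_pts k. ?h b) = (\<Prod>j<k. exp (?x (k + j) * (-1)) + exp (?x (k + j) * 1))"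
      by (rule sum_sgn_prod)
    also have "\<dots> / 2 ^ k = (\<Prod>j<k. (exp (?x (k + j) * (-1)) + exp (?x (k + j) * 1)) / 2)"
      by (simp add: prod_dividef)
    also have "\<dots> \<le> (\<Prod>j<k. exp ((?x (k + j))\<^sup>2))"
    proof (rule prod_mono, intro conjI)
      fix j
      have "(exp (?x (k + j) * (-1)) + exp (?x (k + j) * 1)) / 2 = cosh (?x (k + j))"
        by (simp add: cosh_def)
      also have "\<dots> \<le> exp ((?x (k + j))\<^sup>2)" using cosh_plus_sinh_le[of _ 0] by simp
      finally show "(exp (?x (k + j) * (-1)) + exp (?x (k + j) * 1)) / 2 \<le> exp ((?x (k + j))\<^sup>2)" .
    qed (simp add: add_nonneg_nonneg)
    also have "\<dots> = exp (\<Sum>j<k. (?x (k + j))\<^sup>2)" by (simp add: exp_sum)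
    finally show ?thesis .
  qed
  have norm: "(\<Sum>i<k. (?x i)\<^sup>2) + (\<Sum>j<k. (?x (k + j))\<^sup>2) \<le> l\<^sup>2"
  proof -
    have "(\<Sum>i<k. (?x i)\<^sup>2) + (\<Sum>j<k. (?x (k + j))\<^sup>2) = (\<Sum>i<2 * k. (?x i)\<^sup>2)"
    proof -
      have "{..<2 * k} = {..<k} \<union> {k..<2 * k}" by auto
      then have "(\<Sum>i<2 * k. (?x i)\<^sup>2) = (\<Sum>i<k. (?x i)\<^sup>2) + (\<Sum>i\<in>{k..<2 * k}. (?x i)\<^sup>2)"
        by (simp add: sum.union_disjoint ivl_disj_int)
      also have "(\<Sum>i\<in>{k..<2 * k}. (?x i)\<^sup>2) = (\<Sum>j<k. (?x (k + j))\<^sup>2)"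
        using sum.shift_bounds_nat_ivl[of "\<lambda>i. (?x i)\<^sup>2" 0 k k]
        by (simp add: atLeast0LessThan add.commute mult_2)
      finally show ?thesis by simp
    qed
    also have "\<dots> \<le> (\<Sum>i<p. (?x i)\<^sup>2)" using k by (intro sum_mono2) auto
    also have "\<dots> = l\<^sup>2" using v by (simp add: power_mult_distrib sum_distrib_left[symmetric] sqn_def)
    finally show ?thesis .
  qed
  have "(\<Sum>c\<in>pair_pts k. hub_weight k s \<theta> c * exp (l * (\<Sum>i<p. v i * hub_vec k c i)))
    = (\<Sum>c\<in>pair_pts k. hub_weight k s \<theta> c * ((\<Prod>i<k. exp (?x i * fst c i)) * ?h (snd c)))"
    by (simp only: split)
  also have "\<dots> = (\<Sum>b\<in>sgn_pts k. ?h b / 2 ^ k *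
      (\<Prod>i<k. (1 - \<theta> i * (s * hub k b)) / 2 * exp (?x i * (-1)) + (1 + \<theta> i * (s * hub k b)) / 2 * exp (?x i * 1)))"
    by (rule sum_hub_weight[where f="\<lambda>i y. exp (?x i * y)" and h="?h"])
  also have "\<dots> \<le> (\<Sum>b\<in>sgn_pts k. ?h b / 2 ^ k * exp ((\<Sum>i<k. (?x i)\<^sup>2) + 1 / 8))"
  proof (rule sum_mono)
    fix b assume b: "b \<in> sgn_pts k"
    have "0 \<le> ?h b / 2 ^ k" by (rule divide_nonneg_nonneg) (simp_all add: prod_nonneg)
    from mult_left_mono[OF inner[OF b] this]
    show "?h b / 2 ^ k *
      (\<Prod>i<k. (1 - \<theta> i * (s * hub k b)) / 2 * exp (?x i * (-1)) + (1 + \<theta> i * (s * hub k b)) / 2 * exp (?x i * 1))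
      \<le> ?h b / 2 ^ k * exp ((\<Sum>i<k. (?x i)\<^sup>2) + 1 / 8)" .
  qed
  also have "\<dots> = (\<Sum>b\<in>sgn_pts k. ?h b / 2 ^ k) * exp ((\<Sum>i<k. (?x i)\<^sup>2) + 1 / 8)"
    by (simp only: sum_distrib_right)
  also have "\<dots> \<le> exp (\<Sum>j<k. (?x (k + j))\<^sup>2) * exp ((\<Sum>i<k. (?x i)\<^sup>2) + 1 / 8)"
    by (intro mult_right_mono outer) auto
  also have "\<dots> = exp ((\<Sum>i<k. (?x i)\<^sup>2) + (\<Sum>j<k. (?x (k + j))\<^sup>2) + 1 / 8)"
    by (simp add: exp_add mult_ac)
  also have "\<dots> \<le> exp (l\<^sup>2 + 1 / 8)" using norm by simp
  also have "\<dots> = exp (1 / 8) * exp (l\<^sup>2)" by (simp add: exp_add)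
  also have "\<dots> \<le> 2 * exp (l\<^sup>2)"
  proof (intro mult_right_mono)
    have "exp (1 / 8 :: real) \<le> 1 + 1 / 8 + (1 / 8)\<^sup>2" by (rule exp_bound) auto
    then show "exp (1 / 8 :: real) \<le> 2" by (simp add: power2_eq_square)
  qed auto
  finally show ?thesis .
qed

lemma hub_law_setup:
  fixes r :: real
  assumes k: "0 < k" "2 * k \<le> p" and s: "12 * real k * s\<^sup>2 \<le> 1" and \<theta>: "\<theta> \<in> sgn_pts k" and r: "0 < r"
  shows "lazy_law_setup p (pair_pts k) (hub_weight k s \<theta>) r (hub_vec k)"
proof
  show "0 < p" using k by simp
  show "finite (pair_pts k)" by (rule finite_pair_pts)
  show "0 \<le> hub_weight k s \<theta> c" if "c \<in> pair_pts k" for c by (rule hub_weight_nonneg[OF \<theta> that k(1) s])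
  show "(\<Sum>c\<in>pair_pts k. hub_weight k s \<theta> c) = 1" by (rule sum_hub_weight_const)
  show "0 < r" by (rule r)
  show "c = c'" if c: "c \<in> pair_pts k" "c' \<in> pair_pts k" and eq: "\<And>i. i < p \<Longrightarrow> hub_vec k c i = hub_vec k c' i" for c c'
  proof (rule prod_eqI)
    have ab: "fst c \<in> sgn_pts k" "snd c \<in> sgn_pts k" "fst c' \<in> sgn_pts k" "snd c' \<in> sgn_pts k"
      using c by (simp_all add: pair_pts_def mem_Times_iff)
    show "fst c = fst c'"
    proof (rule PiE_ext[OF ab(1,3)])
      fix i assume "i \<in> {..<k}"
      then show "fst c i = fst c' i" using eq[of i] k by (simp add: hub_vec_def)
    qed
    show "snd c = snd c'"
    proof (rule PiE_ext[OF ab(2,4)])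
      fix i assume "i \<in> {..<k}"
      then show "snd c i = snd c' i" using eq[of "k + i"] k by (simp add: hub_vec_def)
    qed
  qed
  show "\<exists>i<p. hub_vec k c i \<noteq> 0" if "c \<in> pair_pts k" for c
  proof -
    have "fst c \<in> sgn_pts k" using that by (simp_all add: pair_pts_def mem_Times_iff)
    then have "\<bar>fst c 0\<bar> = 1" using sgn_ptsD k by blast
    then show ?thesis using k by (intro exI[of _ 0]) (auto simp: hub_vec_def)
  qed
  show "(\<Sum>c\<in>pair_pts k. hub_weight k s \<theta> c * hub_vec k c i) = 0" if "i < p" for i
  proof -
    consider "i < k" | "k \<le> i" "i < 2 * k" | "2 * k \<le> i" by linarith
    then show ?thesis
    proof cases
      case 1
      then show ?thesis
        using sum_hub_weight_1[OF 1, of s \<theta> "\<lambda>_. 1"] sum_hub[of k] by (simp add: hub_vec_def)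
    next
      case 2
      then show ?thesis
        using sum_hub_weight_0[of k s \<theta> "\<lambda>b. b (i - k)"] sum_sgn_coord[of "i - k" k] by (simp add: hub_vec_def)
    next
      case 3
      then show ?thesis by (simp add: hub_vec_def)
    qed
  qed
  show "(\<Sum>c\<in>pair_pts k. hub_weight k s \<theta> c * exp (l * (\<Sum>i<p. v i * hub_vec k c i))) \<le> 2 * exp (l\<^sup>2)"
    if "sqn p v = 1" for v l
    by (rule hub_weight_mgf[OF k s \<theta> that])
qed

text \<open>Each cross entry is small, but along a row of the first block all cross entries are
  equal, so they add up to the full size \<open>s\<close> on the normalised indicator of the second
  block.\<close>

lemma hub_law_S:
  fixes k p :: nat and s r :: real and \<theta> :: "nat \<Rightarrow> real"
  assumes k: "0 < k" "2 * k \<le> p" and s: "12 * real k * s\<^sup>2 \<le> 1" "0 \<le> s" and \<theta>: "\<theta> \<in> sgn_pts k" and r: "0 < r"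
  defines "S \<equiv> lazy_law_setup.S (pair_pts k) (hub_weight k s \<theta>) (hub_vec k)"
  shows "\<And>i j. i < k \<Longrightarrow> j < k \<Longrightarrow> S i (k + j) = \<theta> i * s / sqrt (real k)"
    and "\<And>i j. 2 * k \<le> i \<Longrightarrow> S i j = 0" and "\<And>i j. S i j = S j i"
    and "\<And>i. \<bar>S i i\<bar> \<le> 1"
    and "\<And>i j. i \<noteq> j \<Longrightarrow> \<bar>S i j\<bar> \<le> 3 * s\<^sup>2 + s / sqrt (real k)"
proof -
  interpret H: lazy_law_setup p "pair_pts k" "hub_weight k s \<theta>" r "hub_vec k"
    by (rule hub_law_setup[OF k s(1) \<theta> r])
  have SS: "S i j = (\<Sum>c\<in>pair_pts k. hub_weight k s \<theta> c * (hub_vec k c i * hub_vec k c j))" for i j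
    by (simp only: S_def H.S_def)
  show cross: "S i (k + j) = \<theta> i * s / sqrt (real k)" if "i < k" "j < k" for i j
    using sum_hub_weight_1[OF that(1), of s \<theta> "\<lambda>b. b j"] that sum_hub_coord[OF that(2)] by (simp add: SS hub_vec_def)
  show zero: "S i j = 0" if "2 * k \<le> i" for i j
    using that by (simp add: SS hub_vec_def)
  show sym: "S i j = S j i" for i j
    by (simp add: SS mult.commute)
  show "\<bar>S i i\<bar> \<le> 1" for i
  proof -
    have "hub_vec k c i * hub_vec k c i \<le> 1" if "c \<in> pair_pts k" for c
    proof -
      have ab: "fst c \<in> sgn_pts k" "snd c \<in> sgn_pts k" using that by (simp_all add: pair_pts_def mem_Times_iff)
      show ?thesis
        using sgn_ptsD[OF ab(1), of i] sgn_ptsD[OF ab(2), of "i - k"] by (auto simp: hub_vec_def power2_eq_square)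
    qed
    then have "S i i \<le> (\<Sum>c\<in>pair_pts k. hub_weight k s \<theta> c * 1)"
      unfolding SS by (intro sum_mono mult_left_mono H.q0)
    moreover have "0 \<le> S i i"
      unfolding SS by (rule sum_nonneg, rule mult_nonneg_nonneg, erule H.q0) (rule zero_le_square)
    ultimately show ?thesis using H.q1 by simp
  qed
  have v0: "0 \<le> 3 * s\<^sup>2 + s / sqrt (real k)" using s by simp
  have BB: "S i j = 0" if "k \<le> i" "i < 2 * k" "k \<le> j" "j < 2 * k" "i \<noteq> j" for i j
    using sum_hub_weight_0[of k s \<theta> "\<lambda>b. b (i - k) * b (j - k)"] sum_sgn_coord_2[of "i - k" k "j - k"] that
    by (simp add: SS hub_vec_def)
  have AA: "\<bar>S i j\<bar> \<le> 3 * s\<^sup>2" if "i < k" "j < k" "i \<noteq> j" for i j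
  proof -
    have "S i j = \<theta> i * \<theta> j * s\<^sup>2 * (\<Sum>b\<in>sgn_pts k. (hub k b)\<^sup>2) / 2 ^ k"
      using sum_hub_weight_2[OF that, of s \<theta>] that by (simp add: SS hub_vec_def)
    then have "\<bar>S i j\<bar> = s\<^sup>2 * ((\<Sum>b\<in>sgn_pts k. (hub k b)\<^sup>2) / 2 ^ k)"
      using sgn_ptsD[OF \<theta>, of i] sgn_ptsD[OF \<theta>, of j] that by (simp add: abs_mult sum_nonneg)
    moreover have "(\<Sum>b\<in>sgn_pts k. (hub k b)\<^sup>2) / 2 ^ k \<le> 3"
    proof -
      have "(\<Sum>b\<in>sgn_pts k. (hub k b)\<^sup>2) \<le> (\<Sum>b\<in>sgn_pts k. 3)"
        by (rule sum_mono, rule hub_sq_le[OF _ k(1)])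
      also have "\<dots> = 3 * 2 ^ k" using card_sgn_pts[of k] by simp
      finally show ?thesis by (simp add: field_simps)
    qed
    then have "s\<^sup>2 * ((\<Sum>b\<in>sgn_pts k. (hub k b)\<^sup>2) / 2 ^ k) \<le> s\<^sup>2 * 3"
      by (rule mult_left_mono) (rule zero_le_power2)
    ultimately show ?thesis by linarith
  qed
  have AB: "\<bar>S i j\<bar> \<le> s / sqrt (real k)" if "i < k" "k \<le> j" "j < 2 * k" for i j
    using cross[of i "j - k"] that sgn_ptsD[OF \<theta> that(1)] s by (simp add: abs_mult)
  show "\<bar>S i j\<bar> \<le> 3 * s\<^sup>2 + s / sqrt (real k)" if "i \<noteq> j" for i j
  proof -
    have t: "0 \<le> s / sqrt (real k)" "0 \<le> 3 * s\<^sup>2" using s by auto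
    consider "i < k" "j < k" | "i < k" "k \<le> j" "j < 2 * k" | "j < k" "k \<le> i" "i < 2 * k"
      | "k \<le> i" "i < 2 * k" "k \<le> j" "j < 2 * k" | "2 * k \<le> i" | "2 * k \<le> j" by linarith
    then show ?thesis
    proof cases
      case 1 then show ?thesis using AA[of i j] that t by linarith
    next
      case 2 then show ?thesis using AB[of i j] t by linarith
    next
      case 3 then show ?thesis using AB[of j i] sym[of i j] t by linarith
    next
      case 4 then show ?thesis using BB[of i j] that v0 by simp
    next
      case 5 then show ?thesis using zero[of i j] v0 by simp
    next
      case 6 then show ?thesis using zero[of j i] sym[of i j] v0 by simp
    qed
  qed
qed

text \<open>The hypothesis on \<open>n\<close> says
  \<open>k / n \<le> k powr (-2 * \<alpha>)\<close>. Cross entries of a row sum to order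
  \<open>sqrt (k / n)\<close>, hence to order \<open>k powr (-\<alpha>)\<close>, the decay required
  at lags up to \<open>2 * k\<close>.\<close>

lemma hub_law_P_class:
  fixes r :: real
  assumes \<alpha>: "0 < \<alpha>" and k: "0 < k" "2 * k < p" and n: "real k powr (2 * \<alpha> + 1) \<le> real n"
    and s: "s = 1 / sqrt (12 * real n)" and \<theta>: "\<theta> \<in> sgn_pts k"
    and \<rho>: "0 < \<rho>" and r: "0 < r" "r\<^sup>2 \<le> 1 / (2 * \<rho>)" "r\<^sup>2 \<le> M0 / 3" "r\<^sup>2 \<le> M / (2 * 2 powr \<alpha>)"
  shows "lazy_law p (pair_pts k) (hub_weight k s \<theta>) r (hub_vec k) \<in> P_class p \<alpha> M0 M \<rho>"
proof -
  have kn: "real k \<le> real n"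
  proof -
    have "real k powr 1 \<le> real k powr (2 * \<alpha> + 1)" using \<alpha> k by (intro powr_mono) auto
    then show ?thesis using n k by simp
  qed
  have n0: "0 < real n" using kn k by linarith
  have s2: "s\<^sup>2 = 1 / (12 * real n)" using n0 by (simp add: s power_divide)
  have s0: "0 < s" using n0 by (simp add: s)
  have s12: "12 * real k * s\<^sup>2 \<le> 1" using kn n0 by (simp add: s2)
  have k2: "2 * k \<le> p" using k by simp
  note SL = hub_law_S[OF k(1) k2 s12 less_imp_le[OF s0] \<theta> r(1)]
  interpret H: lazy_law_setup p "pair_pts k" "hub_weight k s \<theta>" r "hub_vec k"
    by (rule hub_law_setup[OF k(1) k2 s12 \<theta> r(1)])
  define v where "v = 3 * s\<^sup>2 + s / sqrt (real k)"
  have v0: "0 \<le> v" using s0 by (simp add: v_def)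
  define ka where "ka = real k powr (- \<alpha>)"
  have ka: "0 < ka" "ka \<le> 1"
  proof -
    show "0 < ka" using k by (simp add: ka_def)
    have "real k powr (- \<alpha>) \<le> real k powr 0" using \<alpha> k by (intro powr_mono) auto
    then show "ka \<le> 1" using k by (simp add: ka_def)
  qed
  have kdn: "real k / real n \<le> ka\<^sup>2"
  proof -
    have "real k / real n \<le> real k / real k powr (2 * \<alpha> + 1)"
      using n n0 k by (intro divide_left_mono) auto
    also have "\<dots> = real k powr (1 - (2 * \<alpha> + 1))" using k by (subst powr_diff) simp
    also have "\<dots> = ka\<^sup>2" unfolding ka_def by (simp add: power2_eq_square flip: powr_add)
    finally show ?thesis .
  qed
  \<comment> \<open>The cross part dominates; the part within the first block is even of order
    \<open>ka\<^sup>2\<close>.\<close>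
  have v: "2 * real k * v \<le> 2 * ka"
  proof -
    have "ka\<^sup>2 \<le> ka * 1" unfolding power2_eq_square using ka by (intro mult_left_mono) auto
    then have 1: "2 * real k * (3 * s\<^sup>2) \<le> ka / 2" using kdn by (simp add: s2)
    have "(2 * real k * (s / sqrt (real k)))\<^sup>2 = 4 * (real k)\<^sup>2 * (s\<^sup>2 / real k)"
      using k by (simp add: power_mult_distrib power_divide)
    also have "\<dots> = 1 / 3 * (real k / real n)"
      using k by (simp add: s2 power2_eq_square[of "real k"])
    also have "\<dots> \<le> (ka)\<^sup>2"
    proof -
      have "0 \<le> real k / real n" by simp
      then show ?thesis using kdn by linarith
    qed
    finally have "2 * real k * (s / sqrt (real k)) \<le> ka"
      by (rule power2_le_imp_le) (rule less_imp_le[OF ka(1)])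
    moreover have "x + y \<le> 2 * ka" if "x \<le> ka / 2" "y \<le> ka" for x y
      using that ka by linarith
    ultimately show ?thesis unfolding v_def distrib_left using 1 by blast
  qed
  have off: "\<bar>H.S i j\<bar> \<le> (if i < 2 * k then v else 0)" if "i \<noteq> j" for i j
    using SL(5)[OF that] SL(2)[of i j] by (auto simp: v_def)
  have offsum: "(\<Sum>i\<in>A. \<bar>H.S i j\<bar>) \<le> 2 * ka" if A: "A \<subseteq> {..<p}" "j \<notin> A" for A j
  proof -
    have fA: "finite A" using A finite_subset by blast
    have "(\<Sum>i\<in>A. \<bar>H.S i j\<bar>) \<le> (\<Sum>i\<in>A. if i < 2 * k then v else 0)"
      using A by (intro sum_mono off) auto
    also have "\<dots> = (\<Sum>i\<in>{i\<in>A. i < 2 * k}. v)"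
      by (rule sum.inter_filter[OF fA, symmetric])
    also have "\<dots> \<le> real (2 * k) * v"
    proof -
      have "card {i\<in>A. i < 2 * k} \<le> card {..<2 * k}" by (intro card_mono) auto
      then have "real (card {i\<in>A. i < 2 * k}) \<le> real (2 * k)" by simp
      then show ?thesis using v0 by (simp add: mult_right_mono)
    qed
    also have "\<dots> \<le> 2 * ka" using v by simp
    finally show ?thesis .
  qed
  show ?thesis
  \<comment> \<open>By \<open>2 * k < p\<close> the last coordinate is identically zero, hence
    uncorrelated with all others.\<close>
  proof (rule H.lazy_P_class[OF \<rho> r(2), of "p - 1"])
    show "p - 1 < p" using k by simp
    show "H.S i (p - 1) = 0" if "i < p" "i \<noteq> p - 1" for i
    proof -
      have "H.S (p - 1) i = 0" by (rule SL(2)) (use k in simp)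
      then show ?thesis by (subst SL(3))
    qed
    show "r\<^sup>2 * (\<Sum>j<p. \<bar>H.S i j\<bar>) \<le> M0" if i: "i < p" for i
    proof -
      have "(\<Sum>j<p. \<bar>H.S i j\<bar>) = \<bar>H.S i i\<bar> + (\<Sum>j\<in>{..<p} - {i}. \<bar>H.S j i\<bar>)"
      proof -
        have "(\<Sum>j\<in>{..<p} - {i}. \<bar>H.S i j\<bar>) = (\<Sum>j\<in>{..<p} - {i}. \<bar>H.S j i\<bar>)"
          by (intro sum.cong refl arg_cong[of _ _ abs] SL(3))
        then show ?thesis using i by (subst sum.remove[of _ i]) simp_all
      qed
      also have "\<dots> \<le> 1 + 2 * ka" by (intro add_mono SL(4) offsum) auto
      also have "\<dots> \<le> 3" using ka by simp
      finally have "r\<^sup>2 * (\<Sum>j<p. \<bar>H.S i j\<bar>) \<le> r\<^sup>2 * 3" by (intro mult_left_mono) auto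
      then show ?thesis using r(3) by simp
    qed
    show "r\<^sup>2 * (\<Sum>i | i < p \<and> \<bar>int i - int j\<bar> > int l. \<bar>H.S i j\<bar>) \<le> M * real l powr (- \<alpha>)"
      if l: "1 \<le> l" and j: "j < p" for l j
    \<comment> \<open>Lags below \<open>2 * k\<close> are compared with the decay at
      \<open>2 * k\<close>, paid for by \<open>2 powr \<alpha>\<close> in the bound on
      \<open>r\<close>; at larger lags no correlated pair is left.\<close>
    proof (cases "l < 2 * k")
      case True
      have "(\<Sum>i | i < p \<and> \<bar>int i - int j\<bar> > int l. \<bar>H.S i j\<bar>) \<le> 2 * ka"
        by (rule offsum) auto
      then have "r\<^sup>2 * (\<Sum>i | i < p \<and> \<bar>int i - int j\<bar> > int l. \<bar>H.S i j\<bar>) \<le> M / (2 * 2 powr \<alpha>) * (2 * ka)"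
        using r by (intro mult_mono sum_nonneg) (auto intro: order_trans[OF zero_le_power2])
      also have "\<dots> = M * (2 * real k) powr (- \<alpha>)"
        by (simp add: ka_def powr_mult powr_minus_divide)
      also have "\<dots> \<le> M * real l powr (- \<alpha>)"
      proof (intro mult_left_mono powr_mono2')
        have "0 \<le> M / (2 * 2 powr \<alpha>)" using r(4) by (meson order_trans zero_le_power2)
        then show "0 \<le> M" by (simp add: zero_le_divide_iff)
      qed (use \<alpha> l True in auto)
      finally show ?thesis .
    next
      case False
      have "H.S i j = 0" if "\<bar>int i - int j\<bar> > int l" for i
      proof -
        have "2 * k \<le> i \<or> 2 * k \<le> j" using that False by linarith
        then show ?thesis by (metis SL(2) SL(3))
      qed
      then have "(\<Sum>i | i < p \<and> \<bar>int i - int j\<bar> > int l. \<bar>H.S i j\<bar>) = 0" by (intro sum.neutral) auto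
      moreover have "0 \<le> M / (2 * 2 powr \<alpha>)" using r(4) by (meson order_trans zero_le_power2)
      then have "0 \<le> M" by (simp add: zero_le_divide_iff)
      ultimately show ?thesis by simp
    qed
  qed
qed

lemma hub_weight_upd:
  assumes i: "i < k"
  shows "hub_weight k s (\<theta>(i := e)) c
    = (1 + e * fst c i * (s * hub k (snd c))) / 2 *
      ((\<Prod>j\<in>{..<k} - {i}. (1 + \<theta> j * fst c j * (s * hub k (snd c))) / 2) / 2 ^ k)"
proof -
  have "(\<Prod>j<k. (1 + (\<theta>(i := e)) j * fst c j * (s * hub k (snd c))) / 2)
    = (1 + e * fst c i * (s * hub k (snd c))) / 2 *
      (\<Prod>j\<in>{..<k} - {i}. (1 + (\<theta>(i := e)) j * fst c j * (s * hub k (snd c))) / 2)"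
    using i by (subst prod.remove[of _ i]) simp_all
  also have "(\<Prod>j\<in>{..<k} - {i}. (1 + (\<theta>(i := e)) j * fst c j * (s * hub k (snd c))) / 2)
    = (\<Prod>j\<in>{..<k} - {i}. (1 + \<theta> j * fst c j * (s * hub k (snd c))) / 2)"
    by (intro prod.cong) simp_all
  finally show ?thesis by (simp only: hub_weight_def times_divide_eq_right)
qed

text \<open>With \<open>g = s * hub k b\<close>, the geometric mean of the two likelihoods is the
  weight untilted at \<open>i\<close> times \<open>sqrt (1 - g\<^sup>2)\<close>. For
  \<open>g\<^sup>2 \<le> 1\<close> dropping the root gives a smaller expression, polynomial in
  \<open>g\<close>.\<close>

definition hub_affinity :: "nat \<Rightarrow> real \<Rightarrow> nat \<Rightarrow> (nat \<Rightarrow> real) \<Rightarrow> (nat \<Rightarrow> real) \<times> (nat \<Rightarrow> real) \<Rightarrow> real" where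
  "hub_affinity k s i \<theta> c = hub_weight k s (\<theta>(i := 0)) c * (1 - (s * hub k (snd c))\<^sup>2)"

lemma hub_affinity_sq_le:
  assumes k: "0 < k" and s: "12 * real k * s\<^sup>2 \<le> 1" and \<theta>: "\<theta> \<in> sgn_pts k" and i: "i < k" and c: "c \<in> pair_pts k"
  shows "(hub_affinity k s i \<theta> c)\<^sup>2 \<le> hub_weight k s \<theta> c * hub_weight k s (\<theta>(i := - \<theta> i)) c"
proof -
  have ab: "fst c \<in> sgn_pts k" "snd c \<in> sgn_pts k" using c by (simp_all add: pair_pts_def mem_Times_iff)
  define g where "g = s * hub k (snd c)"
  define R where "R = (\<Prod>j\<in>{..<k} - {i}. (1 + \<theta> j * fst c j * g) / 2) / 2 ^ k"
  define u where "u = \<theta> i * fst c i * g"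
  have w: "hub_weight k s (\<theta>(i := e)) c = (1 + e * fst c i * g) / 2 * R" for e
    unfolding hub_weight_upd[OF i] g_def R_def ..
  have w1: "hub_weight k s \<theta> c = (1 + u) / 2 * R"
    using w[of "\<theta> i"] by (simp add: u_def)
  have w2: "hub_weight k s (\<theta>(i := - \<theta> i)) c = (1 - u) / 2 * R"
    unfolding w by (simp add: u_def)
  have w0: "hub_affinity k s i \<theta> c = R / 2 * (1 - g\<^sup>2)"
    unfolding hub_affinity_def w g_def[symmetric] by simp
  have "12 * s\<^sup>2 \<le> 12 * real k * s\<^sup>2" using k by (intro mult_right_mono) auto
  then have g1: "g\<^sup>2 \<le> 1" using scaled_hub_sq_le[OF ab(2) k, of s] s unfolding g_def by linarith
  have "u\<^sup>2 = (\<theta> i)\<^sup>2 * (fst c i)\<^sup>2 * g\<^sup>2" by (simp only: u_def power_mult_distrib)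
  also have "(\<theta> i)\<^sup>2 = 1" using sgn_ptsD[OF \<theta> i] by blast
  also have "(fst c i)\<^sup>2 = 1" using sgn_ptsD[OF ab(1) i] by blast
  finally have u2: "u\<^sup>2 = g\<^sup>2" by simp
  have "(1 - g\<^sup>2) * (1 - g\<^sup>2) \<le> (1 - g\<^sup>2) * 1"
    using g1 by (intro mult_left_mono) auto
  then have "(R / 2)\<^sup>2 * ((1 - g\<^sup>2) * (1 - g\<^sup>2)) \<le> (R / 2)\<^sup>2 * ((1 - g\<^sup>2) * 1)"
    by (rule mult_left_mono) (rule zero_le_power2)
  moreover have "(hub_affinity k s i \<theta> c)\<^sup>2 = (R / 2)\<^sup>2 * ((1 - g\<^sup>2) * (1 - g\<^sup>2))"
    unfolding w0 by (simp only: power_mult_distrib power2_eq_square[of "1 - g\<^sup>2"])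
  moreover have "hub_weight k s \<theta> c * hub_weight k s (\<theta>(i := - \<theta> i)) c = (R / 2)\<^sup>2 * ((1 - g\<^sup>2) * 1)"
  proof -
    have "hub_weight k s \<theta> c * hub_weight k s (\<theta>(i := - \<theta> i)) c = (R / 2)\<^sup>2 * (1 - u\<^sup>2)"
      unfolding w1 w2 by (simp add: power2_eq_square field_simps)
    then show ?thesis unfolding u2 by simp
  qed
  ultimately show ?thesis by (simp only:)
qed

lemma sum_hub_affinity:
  assumes k: "0 < k"
  shows "1 - 3 * s\<^sup>2 \<le> (\<Sum>c\<in>pair_pts k. hub_affinity k s i \<theta> c)"
proof -
  have "(\<Sum>c\<in>pair_pts k. hub_affinity k s i \<theta> c) = (\<Sum>b\<in>sgn_pts k. 1 - (s * hub k b)\<^sup>2) / 2 ^ k"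
    unfolding hub_affinity_def by (rule sum_hub_weight_0)
  moreover have "(\<Sum>b\<in>sgn_pts k. 1 - 3 * s\<^sup>2) \<le> (\<Sum>b\<in>sgn_pts k. 1 - (s * hub k b)\<^sup>2)"
    by (intro sum_mono diff_left_mono scaled_hub_sq_le k)
  moreover have "(\<Sum>b\<in>sgn_pts k. 1 - 3 * s\<^sup>2) = 2 ^ k * (1 - 3 * s\<^sup>2)"
    using card_sgn_pts[of k] by simp
  moreover have "x \<le> y / 2 ^ k" if "2 ^ k * x \<le> y" for x y :: real
    using that by (simp add: field_simps)
  ultimately show ?thesis by metis
qed

theorem minimax_risk_hub_lower:
  fixes r :: real
  assumes \<alpha>: "0 < \<alpha>" and k: "0 < k" "2 * k < p" and n: "real k powr (2 * \<alpha> + 1) \<le> real n"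
    and \<rho>: "0 < \<rho>" and r: "0 < r" "r\<^sup>2 \<le> 1 / (2 * \<rho>)" "r\<^sup>2 \<le> M0 / 3" "r\<^sup>2 \<le> M / (2 * 2 powr \<alpha>)"
  shows "ennreal (r ^ 4 / 384 * (real k / real n)) \<le> minimax_risk n p \<alpha> M0 M \<rho>"
proof (rule minimax_risk_ge)
  fix T assume "T \<in> estimators n p"
  then have T: "\<And>X. X \<in> space (sample_space n p) \<Longrightarrow> T X \<in> carrier_mat p p" by (simp add: estimators_def)
  have kn: "real k \<le> real n"
  proof -
    have "real k powr 1 \<le> real k powr (2 * \<alpha> + 1)" using \<alpha> k by (intro powr_mono) auto
    then show ?thesis using n k by simp
  qed
  have n0: "0 < real n" using kn k by linarith
  \<comment> \<open>12 gives \<open>12 * k * s\<^sup>2 \<le> 1\<close> for \<open>k \<le> n\<close>,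
    and \<open>3 * n * s\<^sup>2 = 1 / 4\<close>, the loss of affinity that \<open>assouad\<close>
    allows.\<close>
  define s where "s = 1 / sqrt (12 * real n)"
  have s2: "s\<^sup>2 = 1 / (12 * real n)" using n0 by (simp add: s_def power_divide)
  have s0: "0 < s" using n0 by (simp add: s_def)
  have s12: "12 * real k * s\<^sup>2 \<le> 1" using kn n0 by (simp add: s2)
  have k2: "2 * k \<le> p" using k by simp
  define J where "J = lazy_set (pair_pts k)"
  define \<Omega> where "\<Omega> = PiE {..<n} (\<lambda>_. J)"
  define Ob where "Ob Z = (\<lambda>l\<in>{..<n}. lazy_pt p r (hub_vec k) (Z l))" for Z
  define w where "w \<theta> = lazy_weight (hub_weight k s \<theta>)" for \<theta>
  define F where "F \<theta> Z = (\<Prod>l<n. w \<theta> (Z l))" for \<theta> Z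
  define \<phi> where "\<phi> i \<theta> z = (case z of None \<Rightarrow> 3 / 4 | Some c \<Rightarrow> hub_affinity k s i \<theta> c / 4)" for i \<theta> and z :: "((nat \<Rightarrow> real) \<times> (nat \<Rightarrow> real)) option"
  define Q where "Q \<theta> = lazy_law p (pair_pts k) (hub_weight k s \<theta>) r (hub_vec k)" for \<theta>
  define c where "c = r\<^sup>2 / 4 * s"
  \<comment> \<open>Row \<open>i\<close> of the estimate applied to the normalised indicator of the
    second block; its target under \<open>\<theta>\<close> is \<open>c * \<theta> i\<close>.\<close>
  define \<tau> where "\<tau> i Z = (\<Sum>j<k. T (Ob Z) $$ (i, k + j)) / sqrt (real k)" for i Z
  have fJ: "finite J" by (simp add: J_def lazy_set_def finite_pair_pts)
  have hub_setup: "lazy_law_setup p (pair_pts k) (hub_weight k s \<theta>) r (hub_vec k)" if "\<theta> \<in> sgn_pts k" for \<theta>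
    by (rule hub_law_setup[OF k(1) k2 s12 that r(1)])
  have wsum: "0 \<le> w \<theta> z" "(\<Sum>z\<in>J. w \<theta> z) = 1" if "\<theta> \<in> sgn_pts k" "z \<in> J" for \<theta> z
  proof -
    interpret H: lazy_law_setup p "pair_pts k" "hub_weight k s \<theta>" r "hub_vec k" by (rule hub_setup[OF that(1)])
    show "0 \<le> w \<theta> z" "(\<Sum>z\<in>J. w \<theta> z) = 1" using H.w0 H.w1 that(2) by (simp_all add: w_def J_def)
  qed
  have flip: "\<theta>(i := - \<theta> i) \<in> sgn_pts k" if "\<theta> \<in> sgn_pts k" "i < k" for \<theta> i
    using that by (auto simp: PiE_def Pi_def extensional_def)
  have \<Omega>J: "Z l \<in> J" if "Z \<in> \<Omega>" "l < n" for Z l using that by (auto simp: \<Omega>_def)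
  have None_J: "None \<in> J" by (simp add: J_def lazy_set_def)
  have "\<exists>\<theta>\<in>sgn_pts k. real k * c\<^sup>2 / 2 \<le> (\<Sum>Z\<in>\<Omega>. F \<theta> Z * (op_norm (T (Ob Z) - cov_mat p (Q \<theta>)))\<^sup>2)"
  proof (rule assouad[where \<psi>="\<lambda>i \<theta> Z. \<Prod>l<n. \<phi> i \<theta> (Z l)" and \<tau>=\<tau>])
    show "finite \<Omega>" unfolding \<Omega>_def using fJ by (intro finite_PiE) auto
    show "0 \<le> F \<theta> Z" if "\<theta> \<in> sgn_pts k" "Z \<in> \<Omega>" for \<theta> Z
      unfolding F_def by (rule prod_nonneg) (use wsum(1)[OF that(1)] \<Omega>J[OF that(2)] in blast)
    show "(\<Sum>Z\<in>\<Omega>. F \<theta> Z) = 1" if "\<theta> \<in> sgn_pts k" for \<theta>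
      unfolding F_def \<Omega>_def sum_PiE_power[OF fJ] wsum(2)[OF that None_J] by simp
    show "(\<Prod>l<n. \<phi> i \<theta> (Z l))\<^sup>2 \<le> F \<theta> Z * F (\<theta>(i := - \<theta> i)) Z"
      if i: "i < k" and \<theta>: "\<theta> \<in> sgn_pts k" and Z: "Z \<in> \<Omega>" for i \<theta> Z
    proof -
      have "(\<phi> i \<theta> z)\<^sup>2 \<le> w \<theta> z * w (\<theta>(i := - \<theta> i)) z" if z: "z \<in> J" for z
      proof (cases z)
        case None
        then show ?thesis by (simp add: \<phi>_def w_def lazy_weight_def power2_eq_square)
      next
        case (Some y)
        then have "y \<in> pair_pts k" using z by (auto simp: J_def lazy_set_def)
        from hub_affinity_sq_le[OF k(1) s12 \<theta> i this]
        show ?thesis using Some by (simp add: \<phi>_def w_def lazy_weight_def power_divide)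
      qed
      then have "(\<Prod>l<n. (\<phi> i \<theta> (Z l))\<^sup>2) \<le> (\<Prod>l<n. w \<theta> (Z l) * w (\<theta>(i := - \<theta> i)) (Z l))"
        using \<Omega>J[OF Z] by (intro prod_mono) simp
      then show ?thesis unfolding F_def by (simp only: prod_power_distrib prod.distrib)
    qed
    show "3 / 4 \<le> (\<Sum>Z\<in>\<Omega>. \<Prod>l<n. \<phi> i \<theta> (Z l))" if "i < k" "\<theta> \<in> sgn_pts k" for i \<theta>
    proof -
      have "1 - 3 * s\<^sup>2 \<le> (\<Sum>z\<in>J. \<phi> i \<theta> z)"
      proof -
        have "(\<Sum>z\<in>J. \<phi> i \<theta> z) = 3 / 4 + (\<Sum>y\<in>pair_pts k. hub_affinity k s i \<theta> y) / 4"
          unfolding J_def by (subst sum_lazy_set[OF finite_pair_pts]) (simp add: \<phi>_def sum_divide_distrib)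
        moreover have "1 - 3 * s\<^sup>2 \<le> (\<Sum>y\<in>pair_pts k. hub_affinity k s i \<theta> y)"
          by (rule sum_hub_affinity[OF k(1)])
        moreover have "0 \<le> s\<^sup>2" by simp
        ultimately show ?thesis by linarith
      qed
      moreover have "0 \<le> 1 - 3 * s\<^sup>2"
      proof -
        have "3 * s\<^sup>2 = 1 / (4 * real n)" by (simp add: s2)
        also have "\<dots> \<le> 1" using n0 kn k by simp
        finally show ?thesis by simp
      qed
      ultimately have "(1 - 3 * s\<^sup>2) ^ n \<le> (\<Sum>z\<in>J. \<phi> i \<theta> z) ^ n" by (intro power_mono)
      \<comment> \<open>Bernoulli's inequality: the affinity of \<open>n\<close> observations stays
        at least \<open>1 - 3 * n * s\<^sup>2 = 3 / 4\<close>.\<close>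
      moreover have "1 + real n * (- (3 * s\<^sup>2)) \<le> (1 + - (3 * s\<^sup>2)) ^ n"
        using \<open>0 \<le> 1 - 3 * s\<^sup>2\<close> by (intro Bernoulli_inequality) simp
      moreover have "real n * (- (3 * s\<^sup>2)) = - (1 / 4)" using n0 by (simp add: s2)
      ultimately show ?thesis unfolding \<Omega>_def sum_PiE_power[OF fJ] by simp
    qed
    show "(\<Sum>i<k. (\<tau> i Z - c * \<theta> i)\<^sup>2) \<le> (op_norm (T (Ob Z) - cov_mat p (Q \<theta>)))\<^sup>2"
      if \<theta>: "\<theta> \<in> sgn_pts k" and Z: "Z \<in> \<Omega>" for \<theta> Z
    proof -
      interpret H: lazy_law_setup p "pair_pts k" "hub_weight k s \<theta>" r "hub_vec k" by (rule hub_setup[OF \<theta>])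
      let ?D = "T (Ob Z) - cov_mat p (Q \<theta>)"
      define u where "u i = (if k \<le> i \<and> i < 2 * k then 1 / sqrt (real k) else 0)" for i
      have usum: "(\<Sum>j<p. x j * u j) = (\<Sum>j<k. x (k + j)) / sqrt (real k)" for x
      proof -
        have "(\<Sum>j<p. x j * u j) = (\<Sum>j\<in>{k..<2 * k}. x j * u j)"
          using k2 by (intro sum.mono_neutral_right) (auto simp: u_def)
        also have "\<dots> = (\<Sum>j\<in>{k..<2 * k}. x j / sqrt (real k))"
          by (intro sum.cong) (auto simp: u_def)
        also have "\<dots> = (\<Sum>j<k. x (k + j) / sqrt (real k))"
          using sum.shift_bounds_nat_ivl[of "\<lambda>i. x i / sqrt (real k)" 0 k k]
          by (simp add: atLeast0LessThan add.commute mult_2)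
        finally show ?thesis by (simp add: sum_divide_distrib)
      qed
      have u1: "sqn p u = 1"
      proof -
        have "sqn p u = (\<Sum>j<p. u j * u j)" by (simp add: sqn_def power2_eq_square)
        also have "\<dots> = (\<Sum>j<k. u (k + j)) / sqrt (real k)" by (rule usum)
        also have "(\<Sum>j<k. u (k + j)) = (\<Sum>j<k. 1 / sqrt (real k))" by (intro sum.cong) (auto simp: u_def)
        finally show ?thesis using k by simp
      qed
      have C: "cov_mat p (Q \<theta>) \<in> carrier_mat p p" by (simp add: cov_mat_def)
      have "Ob Z \<in> space (sample_space n p)"
        using H.X_space \<Omega>J[OF Z] unfolding Ob_def sample_space_def by (auto simp: space_PiM J_def)
      then have TC: "T (Ob Z) \<in> carrier_mat p p" by (rule T)
      have row: "(\<Sum>j<p. ?D $$ (i, j) * u j) = \<tau> i Z - c * \<theta> i" if i: "i < k" for i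
      proof -
        have "?D $$ (i, k + j) = T (Ob Z) $$ (i, k + j) - r\<^sup>2 / 4 * (\<theta> i * s / sqrt (real k))" if j: "j < k" for j
        proof -
          have "cov_mat p (Q \<theta>) $$ (i, k + j) = r\<^sup>2 / 4 * H.S i (k + j)"
            unfolding Q_def by (rule H.cov) (use i j k2 in auto)
          also have "H.S i (k + j) = \<theta> i * s / sqrt (real k)"
            by (rule hub_law_S(1)[OF k(1) k2 s12 less_imp_le[OF s0] \<theta> r(1) i j])
          finally show ?thesis using TC C i j k2 by simp
        qed
        then have "(\<Sum>j<k. ?D $$ (i, k + j)) = (\<Sum>j<k. T (Ob Z) $$ (i, k + j)) - real k * (r\<^sup>2 / 4 * (\<theta> i * s / sqrt (real k)))"
          by (simp add: sum_subtractf)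
        then have "(\<Sum>j<p. ?D $$ (i, j) * u j) = \<tau> i Z - real k * (r\<^sup>2 / 4 * (\<theta> i * s / sqrt (real k))) / sqrt (real k)"
          unfolding usum \<tau>_def by (simp only: diff_divide_distrib)
        also have "real k * (r\<^sup>2 / 4 * (\<theta> i * s / sqrt (real k))) / sqrt (real k) = c * \<theta> i"
        proof -
          have "real k * (A / sqrt (real k)) / sqrt (real k) = A" for A using k by simp
          from this[of "r\<^sup>2 / 4 * (\<theta> i * s)"] show ?thesis by (simp add: c_def mult_ac)
        qed
        finally show ?thesis .
      qed
      have "(\<Sum>i<k. (\<tau> i Z - c * \<theta> i)\<^sup>2) = (\<Sum>i<k. (\<Sum>j<p. ?D $$ (i, j) * u j)\<^sup>2)"
        by (intro sum.cong refl) (simp add: row)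
      also have "\<dots> \<le> (\<Sum>i<p. (\<Sum>j<p. ?D $$ (i, j) * u j)\<^sup>2)"
        using k by (intro sum_mono2) auto
      also have "\<dots> \<le> (op_norm ?D)\<^sup>2"
        by (rule op_norm_ge[OF minus_carrier_mat[OF C] u1])
      finally show ?thesis .
    qed
  qed
  then obtain \<theta> where \<theta>: "\<theta> \<in> sgn_pts k"
    and ge: "real k * c\<^sup>2 / 2 \<le> (\<Sum>Z\<in>\<Omega>. F \<theta> Z * (op_norm (T (Ob Z) - cov_mat p (Q \<theta>)))\<^sup>2)" by blast
  interpret H: lazy_law_setup p "pair_pts k" "hub_weight k s \<theta>" r "hub_vec k" by (rule hub_setup[OF \<theta>])
  have c2: "r ^ 4 / 384 * (real k / real n) = real k * c\<^sup>2 / 2"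
    by (simp add: c_def power_mult_distrib power_divide s2)
  have "ennreal (r ^ 4 / 384 * (real k / real n)) \<le> ennreal (\<Sum>Z\<in>\<Omega>. F \<theta> Z * (op_norm (T (Ob Z) - cov_mat p (Q \<theta>)))\<^sup>2)"
    unfolding c2 by (rule ennreal_leI[OF ge])
  also have "\<dots> \<le> risk n p T (Q \<theta>)"
    using H.risk_ge_sum[of n T] by (simp only: \<Omega>_def J_def F_def w_def Ob_def H.obs_def Q_def lazy_law_def)
  finally have "ennreal (r ^ 4 / 384 * (real k / real n)) \<le> risk n p T (Q \<theta>)" .
  moreover have "Q \<theta> \<in> P_class p \<alpha> M0 M \<rho>"
    unfolding Q_def by (rule hub_law_P_class[OF \<alpha> k n s_def \<theta> \<rho> r])
  ultimately show "\<exists>P\<in>P_class p \<alpha> M0 M \<rho>. ennreal (r ^ 4 / 384 * (real k / real n)) \<le> risk n p T P"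
    by (rule bexI)
qed

section \<open>Combination of the two lower bounds with the upper bound\<close>

theorem theorem1:
  fixes \<alpha> M0 M \<rho> \<gamma> :: real
  assumes "\<alpha> > 0" and "M0 > 0" and "M > 0" and "\<rho> > 0" and "\<gamma> > 0"
  shows "\<exists>c C :: real. 0 < c \<and> c \<le> C \<and>
    (\<forall>n p :: nat. n \<ge> 1 \<longrightarrow> p \<ge> 1 \<longrightarrow> real p \<le> exp (\<gamma> * real n) \<longrightarrow>
      ennreal (c * minimax_rate n p \<alpha>) \<le> minimax_risk n p \<alpha> M0 M \<rho> \<and>
      minimax_risk n p \<alpha> M0 M \<rho> \<le> ennreal (C * minimax_rate n p \<alpha>))"
proof -
  obtain C where C: "0 < C" "\<And>n p. 1 \<le> n \<Longrightarrow> 1 \<le> p \<Longrightarrow> real p \<le> exp (\<gamma> * real n) \<Longrightarrow>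
    minimax_risk n p \<alpha> M0 M \<rho> \<le> ennreal (C * minimax_rate n p \<alpha>)"
    using minimax_risk_upper[OF assms(1,3,4,5)] by metis
  \<comment> \<open>One scale for all laws: tail condition, eigenvalue bound and decay;
    \<open>M0 / 3\<close> also covers the weaker demand of the diagonal laws.\<close>
  define R where "R = min (1 / (2 * \<rho>)) (min (M0 / 3) (M / (2 * 2 powr \<alpha>)))"
  define r where "r = sqrt R"
  have R: "0 < R" using assms by (simp add: R_def)
  have r: "0 < r" "r\<^sup>2 \<le> 1 / (2 * \<rho>)" "r\<^sup>2 \<le> M0 / 3" "r\<^sup>2 \<le> M / (2 * 2 powr \<alpha>)" "r\<^sup>2 \<le> M0"
    using R assms by (auto simp: r_def R_def)
  define A where "A = r ^ 4 / (16384 * (1 + \<gamma>))"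
  define A' where "A' = min A (r ^ 4 / 384)"
  have A'0: "0 < A'" using r assms by (simp add: A'_def A_def)
  \<comment> \<open>With 8 the two lower bounds get weights \<open>1 / 2\<close> and
    \<open>1 / 8\<close>, whose sum is below one, so their maximum suffices.\<close>
  define c where "c = A' / 8"
  have c0: "0 < c" using A'0 by (simp add: c_def)
  have lower: "ennreal (c * minimax_rate n p \<alpha>) \<le> minimax_risk n p \<alpha> M0 M \<rho>"
    if n: "1 \<le> n" and p: "1 \<le> p" and pn: "real p \<le> exp (\<gamma> * real n)" for n p
  proof -
    let ?a = "real n powr (- (2 * \<alpha> / (2 * \<alpha> + 1)))"
    let ?risk = "minimax_risk n p \<alpha> M0 M \<rho>"
    have n0: "0 < real n" using n by simp
    have lnp: "0 \<le> ln (real p)" using p by simp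
    \<comment> \<open>The logarithm is taken out of the minimum: it is handled by the logarithmic
      bound, what stays inside by the hub bound.\<close>
    have rate: "minimax_rate n p \<alpha> \<le> min ?a (real p / real n) + ln (real p) / real n"
    proof -
      have "min (a + b) c \<le> min a c + b" if "0 \<le> b" for a b c :: real
        using that by (auto simp: min_def)
      moreover have "0 \<le> ln (real p) / real n" using lnp by simp
      ultimately show ?thesis unfolding minimax_rate_def by blast
    qed
    have "ennreal (A' * ((1 + ln (real p)) / real n)) \<le> ennreal (A * ((1 + ln (real p)) / real n))"
      using lnp by (intro ennreal_leI mult_right_mono) (auto simp: A'_def)
    also have "\<dots> \<le> ?risk"
      unfolding A_def by (rule minimax_risk_log_lower[OF assms(4) r(1,2,5) assms(3,5) n p pn])
    finally have log: "ennreal (A' * ((1 + ln (real p)) / real n)) \<le> ?risk" .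
    show ?thesis
    \<comment> \<open>Two blocks and an idle coordinate need \<open>p \<ge> 3\<close>. For smaller
      \<open>p\<close> the minimum is at most \<open>2 / n\<close>, covered by the 1 in
      \<open>1 + ln p\<close>.\<close>
    proof (cases "p \<le> 2")
      case True
      have "min ?a (real p / real n) \<le> 2 / real n"
        using True n0 by (intro min.coboundedI2 divide_right_mono) auto
      then have "minimax_rate n p \<alpha> \<le> 2 * ((1 + ln (real p)) / real n)"
        using rate lnp n0 by (simp add: field_simps)
      then have "c * minimax_rate n p \<alpha> \<le> c * (2 * ((1 + ln (real p)) / real n))"
        using c0 by (intro mult_left_mono) auto
      also have "\<dots> \<le> A' * ((1 + ln (real p)) / real n)"
        using A'0 lnp n0 by (simp add: c_def field_simps)
      finally show ?thesis using log by (meson ennreal_leI order_trans)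
    next
      case False
      define q where "q = real n powr (1 / (2 * \<alpha> + 1))"
      note qs = powr_identities[OF assms(1) n, folded q_def]
      \<comment> \<open>The largest block size with \<open>2 * k < p\<close> and
        \<open>k \<le> q\<close>; both roundings together lose at most a factor 4 against the
        minimum of \<open>q\<close> and \<open>p\<close>.\<close>
      define k where "k = min ((p - 1) div 2) (nat \<lfloor>q\<rfloor>)"
      have q1: "1 \<le> nat \<lfloor>q\<rfloor>" "real (nat \<lfloor>q\<rfloor>) \<le> q" "q \<le> 2 * real (nat \<lfloor>q\<rfloor>)"
      proof -
        have fl: "real_of_int \<lfloor>q\<rfloor> \<le> q" "q < real_of_int \<lfloor>q\<rfloor> + 1" "1 \<le> \<lfloor>q\<rfloor>"
          using qs(1) by (auto simp: le_floor_iff)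
        then have m: "real (nat \<lfloor>q\<rfloor>) = real_of_int \<lfloor>q\<rfloor>" by simp
        show "1 \<le> nat \<lfloor>q\<rfloor>" using nat_mono[OF fl(3)] by (simp only: nat_one_as_int[symmetric] nat_1 One_nat_def)
        have "1 \<le> real_of_int \<lfloor>q\<rfloor>" using fl(3) by (simp only: of_int_1_le_iff)
        then show "real (nat \<lfloor>q\<rfloor>) \<le> q" "q \<le> 2 * real (nat \<lfloor>q\<rfloor>)" using fl(1,2) m by linarith+
      qed
      have "0 < (p - 1) div 2" "2 * ((p - 1) div 2) < p" using False by presburger+
      then have k: "0 < k" "2 * k < p" using q1(1) by (auto simp only: k_def min_less_iff_conj intro: le_less_trans[OF mult_le_mono2[OF min.cobounded1]])
      have "real k powr (2 * \<alpha> + 1) \<le> q powr (2 * \<alpha> + 1)"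
        using q1(2) assms(1) by (intro powr_mono2) (auto simp: k_def)
      also have "\<dots> = real n" using assms(1) n by (simp add: q_def powr_powr)
      finally have kn: "real k powr (2 * \<alpha> + 1) \<le> real n" .
      have "ennreal (A' * (real k / real n)) \<le> ennreal (r ^ 4 / 384 * (real k / real n))"
        by (intro ennreal_leI mult_right_mono) (auto simp: A'_def)
      also have "\<dots> \<le> ?risk"
        by (rule minimax_risk_hub_lower[OF assms(1) k kn assms(4) r(1-4)])
      finally have hub: "ennreal (A' * (real k / real n)) \<le> ?risk" .
      have "min ?a (real p / real n) \<le> 4 * (real k / real n)"
      proof (cases "(p - 1) div 2 \<le> nat \<lfloor>q\<rfloor>")
        case True
        then have "p \<le> 4 * k" using k(1) by (simp add: k_def)
        then have "real p \<le> 4 * real k" by linarith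
        then have "real p / real n \<le> 4 * real k / real n" by (intro divide_right_mono) auto
        then show ?thesis by simp
      next
        case False
        then have "q \<le> 4 * real k" using q1 by (simp add: k_def)
        then have "q / real n \<le> 4 * real k / real n" by (intro divide_right_mono) auto
        then show ?thesis unfolding qs(3) by simp
      qed
      then have rate': "minimax_rate n p \<alpha> \<le> 4 * (real k / real n) + (1 + ln (real p)) / real n"
      proof -
        have "0 \<le> 1 / real n" by simp
        then show ?thesis
          using rate \<open>min ?a (real p / real n) \<le> 4 * (real k / real n)\<close>
          unfolding add_divide_distrib by linarith
      qed
      define x y where "x = real k / real n" and "y = (1 + ln (real p)) / real n"
      have "c * minimax_rate n p \<alpha> \<le> c * (4 * x + y)"
        using rate' c0 unfolding x_def y_def by (intro mult_left_mono) auto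
      also have "\<dots> \<le> max (A' * x) (A' * y)"
      proof -
        have "c * (4 * x + y) = (A' * x) / 2 + (A' * y) / 8" by (simp add: c_def algebra_simps)
        moreover have "0 \<le> A' * y" using A'0 lnp by (simp add: y_def)
        moreover have "A' * x \<le> max (A' * x) (A' * y)" "A' * y \<le> max (A' * x) (A' * y)" by auto
        ultimately show ?thesis by linarith
      qed
      finally have "ennreal (c * minimax_rate n p \<alpha>) \<le> ennreal (max (A' * x) (A' * y))" by (rule ennreal_leI)
      also have "\<dots> \<le> ?risk"
        using hub log by (auto simp: x_def y_def max_def)
      finally show ?thesis .
    qed
  qed
  have rate0: "0 \<le> minimax_rate n p \<alpha>" if "1 \<le> p" for n p
    using that by (simp add: minimax_rate_def)
  have "minimax_risk n p \<alpha> M0 M \<rho> \<le> ennreal (max C c * minimax_rate n p \<alpha>)"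
    if "1 \<le> n" "1 \<le> p" "real p \<le> exp (\<gamma> * real n)" for n p
  proof -
    have "C * minimax_rate n p \<alpha> \<le> max C c * minimax_rate n p \<alpha>"
      by (intro mult_right_mono rate0 that) auto
    then show ?thesis using C(2)[OF that] by (meson ennreal_leI order_trans)
  qed
  with lower c0 show ?thesis by (intro exI[of _ c] exI[of _ "max C c"]) auto
qed

end
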